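(* Fix an integer $d\ge2$ and $\lambda>0$. For each $n$, consider a system with $n$ servers and $\lfloor\lambda n\rfloor$ jobs, where each job is replicated on a subset of $d$ servers chosen uniformly at random from all subsets of size $d$, independently of other jobs; let $H_n$ be the associated random $d$-uniform (multi-)hypergraph, with servers as vertices and jobs as hyperedges. (i) If $d=2$ and $\lambda<1/2$, then, with high probability, the makespan of $H_n$ is bounded above by $1$. (ii) Otherwise (i.e. if it is not the case that both $d=2$ and $\lambda<1/2$), if $k\ge2$ is an integer such that $$\gamma_k(d)<\lambda\cdot d!<\gamma_{k+1}(d),$$ then, with high probability, the $k$-core of $H_n$ is non-empty and the $(k+1)$-core of $H_n$ is empty, and the makespan of $H_n$ is bounded between $k/d$ and $k$.
   Context: "With high probability" means with probability tending to $1$ as $n\to\infty$. For $\mu>0$ let $Z_\mu$ be a Poisson random variable with mean $\mu$, and for integers $k\ge2$, $d\ge2$ define $$\gamma_k(d)=\inf_{\mu>0}\frac{\mu\,(d-1)!}{\bigl(\mathbb{P}(Z_\mu\ge k-1)\bigr)^{d-1}}.$$ For a finite $d$-uniform hypergraph $H=(V,E)$ (each hyperedge contains exactly $d$ vertices; repeated hyperedges allowed), vertices represent servers working at unit rate and hyperedges represent jobs of unit size. The makespan of $H$ is the optimal value $$\min_{x}\ \max_{e\in E}\ \frac{1}{\sum_{v\in V}x(v,e)}$$ over all $x=(x(v,e))_{v\in V,e\in E}$ subject to $x(v,e)\ge0$ for all $v\in V,e\in E$; $x(v,e)=0$ if $v\notin e$; and $\sum_{e:v\in e}x(v,e)\le1$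 for every $v\in V$. Here $x(v,e)$ is the fraction of its capacity that server $v$ devotes to job $e$. The $k$-core of a hypergraph is its largest vertex-induced subgraph in which the degree of each vertex is at least $k$; equivalently, it is obtained by recursively deleting all vertices of degree smaller than $k$ together with the hyperedges incident on them. It may be empty. *)

theory Defs
  imports "HOL-Probability.Probability"
begin

text \<open>
  Hyperedges are named by elements of an index set, and \<open>ends\<close> gives the set of vertices of a
  hyperedge, so that distinct hyperedges may have the same vertices.
\<close>

record ('v, 'e) hypergraph =
  verts :: "'v set"
  hedges :: "'e set"
  ends :: "'e \<Rightarrow> 'v set"

definition vdegree :: "('v, 'e) hypergraph \<Rightarrow> 'v \<Rightarrow> nat" where
  "vdegree H v = card {e \<in> hedges H. v \<in> ends H e}"

definition induced :: "('v, 'e) hypergraph \<Rightarrow> 'v set \<Rightarrow> ('v, 'e) hypergraph" where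
  "induced H W = H\<lparr>verts := W, hedges := {e \<in> hedges H. ends H e \<subseteq> W}\<rparr>"

definition min_degree_ge :: "nat \<Rightarrow> ('v, 'e) hypergraph \<Rightarrow> bool" where
  "min_degree_ge k H \<longleftrightarrow> (\<forall>v\<in>verts H. k \<le> vdegree H v)"

definition core :: "nat \<Rightarrow> ('v, 'e) hypergraph \<Rightarrow> ('v, 'e) hypergraph" where
  "core k H = induced H (\<Union>{W. W \<subseteq> verts H \<and> min_degree_ge k (induced H W)})"

text \<open>The union is itself a set of the given family, hence its largest element.\<close>

lemma core_verts_subset: "verts (core k H) \<subseteq> verts H"
  by (auto simp: core_def induced_def)

lemma core_min_degree_ge:
  assumes "finite (hedges H)"
  shows "min_degree_ge k (core k H)"
  unfolding min_degree_ge_def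
proof
  fix v assume "v \<in> verts (core k H)"
  then obtain W where W: "W \<subseteq> verts H" "min_degree_ge k (induced H W)" "v \<in> W"
    by (auto simp: core_def induced_def)
  then have "k \<le> vdegree (induced H W) v"
    by (auto simp: min_degree_ge_def induced_def)
  also have "\<dots> \<le> vdegree (core k H) v"
    unfolding vdegree_def
    by (rule card_mono) (use assms W in \<open>auto simp: core_def induced_def\<close>)
  finally show "k \<le> vdegree (core k H) v" .
qed

lemma core_largest:
  assumes "W \<subseteq> verts H" "min_degree_ge k (induced H W)"
  shows "W \<subseteq> verts (core k H)"
  using assms by (auto simp: core_def induced_def)

definition allocations :: "('v, 'e) hypergraph \<Rightarrow> ('v \<Rightarrow> 'e \<Rightarrow> real) set" where
  "allocations H = {x.
     (\<forall>v\<in>verts H. \<forall>e\<in>hedges H. 0 \<le> x v e) \<and>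
     (\<forall>v\<in>verts H. \<forall>e\<in>hedges H. v \<notin> ends H e \<longrightarrow> x v e = 0) \<and>
     (\<forall>v\<in>verts H. (\<Sum>e | e \<in> hedges H \<and> v \<in> ends H e. x v e) \<le> 1)}"

text \<open>
  Extended nonnegative reals, because a job that gets no capacity never completes: \<open>1 / 0 = \<infinity>\<close>
  there, whereas \<open>1 / 0 = 0\<close> on the reals. Without jobs the maximum is \<open>0\<close>.
\<close>

definition completion_time ::
    "('v, 'e) hypergraph \<Rightarrow> ('v \<Rightarrow> 'e \<Rightarrow> real) \<Rightarrow> ennreal" where
  "completion_time H x = (SUP e\<in>hedges H. 1 / ennreal (\<Sum>v\<in>verts H. x v e))"

definition makespan :: "('v, 'e) hypergraph \<Rightarrow> ennreal" where
  "makespan H = (INF x\<in>allocations H. completion_time H x)"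

text \<open>For finite hypergraphs the infimum is a minimum.\<close>

lemma makespan_attained:
  assumes fin: "finite (verts H)" "finite (hedges H)"
  shows "\<exists>x\<in>allocations H. makespan H = completion_time H x"
proof -
  define B where "B = (\<lambda>v e. if v \<in> verts H \<and> e \<in> hedges H \<and> v \<in> ends H e
                             then {0..1::real} else {0})"
  define K where "K = {x. \<forall>v e. x v e \<in> B v e}"
  define S where "S = K \<inter> (\<Inter>v\<in>verts H. {x. (\<Sum>e | e \<in> hedges H \<and> v \<in> ends H e. x v e) \<le> 1})"
  have "K = Pi\<^sub>E UNIV (\<lambda>v. Pi\<^sub>E UNIV (B v))"
    by (auto simp: K_def PiE_def Pi_def)
  moreover have "compact (Pi\<^sub>E UNIV (\<lambda>v. Pi\<^sub>E UNIV (B v)))"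
  proof -
    have *: "compact (Pi\<^sub>E UNIV C)" if "\<And>i. compact (C i)"
      for C :: "'i \<Rightarrow> 'c::topological_space set"
      using compactin_PiE[of "\<lambda>_. euclidean" UNIV C] that
      by (simp add: euclidean_product_topology)
    show ?thesis
      by (intro *) (simp add: B_def)
  qed
  ultimately have K: "compact K"
    by simp
  have coord: "continuous_on A (\<lambda>x::'a \<Rightarrow> 'b \<Rightarrow> real. x v e)" for A v e
  proof -
    have "continuous_on A (\<lambda>x::'a \<Rightarrow> 'b \<Rightarrow> real. x v)"
      by (rule continuous_on_subset[OF continuous_on_product_coordinates subset_UNIV])
    then show ?thesis
      by (rule continuous_on_product_then_coordinatewise)
  qed
  have "closed {x::'a \<Rightarrow> 'b \<Rightarrow> real. (\<Sum>e | e \<in> hedges H \<and> v \<in> ends H e. x v e) \<le> 1}" for v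
    by (intro closed_Collect_le continuous_intros coord)
  then have S: "compact S"
    unfolding S_def by (intro compact_Int_closed K closed_INT) auto
  have "(\<lambda>_ _. 0) \<in> S"
    by (auto simp: S_def K_def B_def)
  then have ne: "S \<noteq> {}"
    by blast
  have sup: "continuous_on S (\<lambda>x. SUP e\<in>F. 1 / ennreal (\<Sum>v\<in>verts H. x v e))"
    if "finite F" for F
    using that
  proof induction
    case empty
    show ?case by simp
  next
    case (insert e F)
    have "continuous_on S (\<lambda>x. inverse (ennreal (\<Sum>v\<in>verts H. x v e)))"
      by (intro continuous_on_inverse_ennreal continuous_on_ennreal continuous_on_sum coord)
    with insert show ?case
      by (auto simp: divide_ennreal_def sup_max intro!: continuous_on_max)
  qed
  then have "continuous_on S (completion_time H)"
    using fin by (simp add: completion_time_def[abs_def])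
  from continuous_attains_inf[OF S ne this]
  obtain x where x: "x \<in> S" and min: "\<And>y. y \<in> S \<Longrightarrow> completion_time H x \<le> completion_time H y"
    by blast
  have xA: "x \<in> allocations H"
  proof -
    have xB: "x v e \<in> B v e" for v e
      using x by (simp add: S_def K_def)
    have "0 \<le> x v e" "v \<notin> ends H e \<Longrightarrow> x v e = 0" for v e
      using xB[of v e] by (auto simp: B_def split: if_splits)
    with x show ?thesis
      by (simp add: allocations_def S_def)
  qed
  have "completion_time H x \<le> completion_time H y" if y: "y \<in> allocations H" for y
  proof -
    define z where "z = (\<lambda>v e. if v \<in> verts H \<and> e \<in> hedges H \<and> v \<in> ends H e then y v e else 0)"
    have eq: "z v e = y v e" if "v \<in> verts H" "e \<in> hedges H" for v e
      using that y by (auto simp: z_def allocations_def)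
    have sum: "(\<Sum>e | e \<in> hedges H \<and> v \<in> ends H e. y v e) \<le> 1" if "v \<in> verts H" for v
      using that y by (auto simp: allocations_def)
    have "y v e \<le> 1" if "v \<in> verts H" "e \<in> hedges H" "v \<in> ends H e" for v e
    proof -
      have "y v e \<le> (\<Sum>e | e \<in> hedges H \<and> v \<in> ends H e. y v e)"
        by (rule member_le_sum) (use that y fin in \<open>auto simp: allocations_def\<close>)
      with sum[OF that(1)] show ?thesis by simp
    qed
    moreover have "0 \<le> y v e" if "v \<in> verts H" "e \<in> hedges H" for v e
      using that y by (auto simp: allocations_def)
    ultimately have "z \<in> K"
      by (auto simp: K_def B_def z_def)
    moreover have "(\<Sum>e | e \<in> hedges H \<and> v \<in> ends H e. z v e) \<le> 1" if "v \<in> verts H" for v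
      using sum[OF that] that by (simp add: eq)
    ultimately have "z \<in> S"
      by (simp add: S_def)
    then have "completion_time H x \<le> completion_time H z"
      by (rule min)
    also have "completion_time H z = completion_time H y"
      unfolding completion_time_def
      by (intro SUP_cong sum.cong arg_cong2[where f = "(/)"] arg_cong[where f = ennreal]) (auto simp: eq)
    finally show ?thesis .
  qed
  with xA have "makespan H = completion_time H x"
    unfolding makespan_def by (intro antisym INF_lower INF_greatest) auto
  with xA show ?thesis
    by blast
qed

definition gamma :: "nat \<Rightarrow> nat \<Rightarrow> real" where
  "gamma k d = (INF \<mu>\<in>{0<..}.
     \<mu> * fact (d - 1) / measure_pmf.prob (poisson_pmf \<mu>) {k - 1..} ^ (d - 1))"

text \<open>
  \<open>Pi_pmf\<close> is the product distribution: the \<open>m\<close> jobs choose their servers independently.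
  The uniform distribution on \<open>d\<close>-subsets is meaningful only if \<open>d \<le> n\<close>.
\<close>

definition random_hypergraph :: "nat \<Rightarrow> nat \<Rightarrow> nat \<Rightarrow> (nat, nat) hypergraph pmf" where
  "random_hypergraph d n m =
     map_pmf (\<lambda>f. \<lparr>verts = {..<n}, hedges = {..<m}, ends = f\<rparr>)
       (Pi_pmf {..<m} {} (\<lambda>_. pmf_of_set {A. A \<subseteq> {..<n} \<and> card A = d}))"

definition jobs_hypergraph :: "nat \<Rightarrow> real \<Rightarrow> nat \<Rightarrow> (nat, nat) hypergraph pmf" where
  "jobs_hypergraph d lam n = random_hypergraph d n (nat \<lfloor>lam * real n\<rfloor>)"

definition whp :: "(nat \<Rightarrow> 'a pmf) \<Rightarrow> ('a \<Rightarrow> bool) \<Rightarrow> bool" where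
  "whp D P \<longleftrightarrow> (\<lambda>n. measure_pmf.prob (D n) {x. P x}) \<longlonglongrightarrow> 1"

end

theory Submission
  imports Defs "HOL-Combinatorics.Multiset_Permutations" "HOL-Real_Asymp.Real_Asymp"
begin

text \<open>
  Assigning every job to the server that is deleted together with it while peeling shows that an
  empty \<open>(k + 1)\<close>-core forces makespan at most \<open>k\<close>; a nonempty \<open>k\<close>-core has at least \<open>k / d\<close> jobs
  per server, which forces makespan at least \<open>k / d\<close>. So (ii) reduces to the \<open>k\<close>-core threshold.

  For the threshold, \<open>d\<close>-subsets are replaced by words of \<open>d\<close> independent uniform vertices, at the
  price of a bounded factor in probabilities. Given the degrees, the words are a uniform arrangement
  of a multiset. If a vertex is light (degree below \<open>k\<close>), delete one of its hyperedges: the other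
  \<open>d - 1\<close> points removed are uniform among the remaining ones, so the points at heavy vertices
  undergo binomial thinning. The exponential of \<open>\<theta>\<close> times the expected number of heavy points at a
  prescribed later time is nearly a supermartingale, for either sign of \<open>\<theta>\<close>. Hence, after \<open>m - t\<close>
  steps with \<open>t = x m\<close>, the number of heavy points concentrates at \<open>n \<mu> P(Z \<ge> k - 1)\<close>, where
  \<open>\<mu> = \<lambda> d x powr ((d - 1) / d)\<close> and \<open>Z\<close> is Poisson with mean \<open>\<mu>\<close>. Peeling stops when all \<open>d t\<close>
  points are heavy, and comparing the two quantities gives \<open>\<gamma>\<^sub>k(d)\<close>. Cores of at most
  \<open>\<epsilon> n\<close> hyperedges are excluded by a first moment bound, which needs \<open>k \<ge> 3\<close>.

  For (i), a graph whose edges have no system of distinct endpoints contains two cycles joined by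
  a path (or sharing one), and the expected number of such configurations is \<open>O(1 / n)\<close>.
\<close>

section \<open>Binomial thinning\<close>

text \<open>Write \<open>P\<close> for the probability that \<open>Z \<ge> k - 1\<close>. Solving
  \<open>\<mu> = lam * d * x powr ((d - 1) / d)\<close> for \<open>x\<close>, the inequality
  \<open>lam * d * x < \<mu> * P\<close> becomes \<open>\<mu> / (lam * d) < P ^ (d - 1)\<close>,
  that is, \<open>\<mu> * fact (d - 1) / P ^ (d - 1) < lam * fact d\<close>. This is how the
  quotient in \<open>gamma\<close> arises.

  Peeling is never set up as a random process. For fixed degrees, configurations with a prescribed
  number of core hyperedges are counted. Deleting at any light vertex preserves that number, so the
  counts satisfy a recursive inequality that carries the exponential moment along.

  The obstacle: deleting points without replacement agrees with independent thinning only to first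
  order. At a vertex with \<open>j\<close> of \<open>s\<close> points the discrepancy is of order
  \<open>(j / s) ^ 2\<close>. Over linearly many steps it stays bounded when the squared degrees sum
  to \<open>O(n)\<close>, so configurations with a larger \<open>square_sum\<close> are set aside by
  Markov's inequality. The need for bounded increments forces the truncation at \<open>J\<close>.
  The constants are fixed in the order \<open>C\<close>, \<open>J\<close>, \<open>\<theta>\<close>,
  and only then \<open>n\<close> grows.\<close>

text \<open>
  \<open>thin n p f\<close> is the expectation of \<open>f\<close> under the binomial distribution with parameters
  \<open>n\<close> and \<open>p\<close>; the recursion makes sense for all real \<open>p\<close>.
\<close>

primrec thin :: "nat \<Rightarrow> real \<Rightarrow> (nat \<Rightarrow> real) \<Rightarrow> real" where
  "thin 0 p f = f 0"
| "thin (Suc n) p f = p * thin n p (\<lambda>i. f (Suc i)) + (1 - p) * thin n p f"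

lemma thin_add: "thin n p (\<lambda>i. f i + g i) = thin n p f + thin n p g"
  by (induction n arbitrary: f g) (auto simp: algebra_simps)

lemma thin_cmult: "thin n p (\<lambda>i. c * f i) = c * thin n p f"
  by (induction n arbitrary: f) (auto simp: algebra_simps)

lemma thin_diff: "thin n p (\<lambda>i. f i - g i) = thin n p f - thin n p g"
  using thin_add[of n p "\<lambda>i. f i - g i" g] by simp

lemma thin_const [simp]: "thin n p (\<lambda>i. c) = c"
  by (induction n) (auto simp: algebra_simps)

lemma thin_sum: "thin n p (\<lambda>i. \<Sum>j\<in>A. f j i) = (\<Sum>j\<in>A. thin n p (f j))"
  by (induction A rule: infinite_finite_induct) (auto simp: thin_add)

lemma thin_1 [simp]: "thin n 1 f = f n"
  by (induction n arbitrary: f) auto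

lemma thin_mono:
  assumes "0 \<le> p" "p \<le> 1" "\<And>i. i \<le> n \<Longrightarrow> f i \<le> g i"
  shows "thin n p f \<le> thin n p g"
  using assms(3)
proof (induction n arbitrary: f g)
  case (Suc n)
  show ?case
    unfolding thin.simps by (intro add_mono mult_left_mono Suc.IH Suc.prems) (use assms in auto)
qed auto

lemma thin_nonneg:
  assumes "0 \<le> p" "p \<le> 1" "\<And>i. i \<le> n \<Longrightarrow> 0 \<le> f i"
  shows "0 \<le> thin n p f"
  using thin_mono[of p n "\<lambda>_. 0" f] assms by auto

lemma thin_le:
  assumes "0 \<le> p" "p \<le> 1" "\<And>i. i \<le> n \<Longrightarrow> f i \<le> B"
  shows "thin n p f \<le> B"
  using thin_mono[of p n f "\<lambda>_. B"] assms by auto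

lemma thin_eq_0:
  assumes "\<And>i. i \<le> n \<Longrightarrow> f i = 0"
  shows "thin n p f = 0"
  using assms by (induction n arbitrary: f) auto

text \<open>Thinning is a semigroup under multiplication of the retention probabilities. This
  composes the effect of many deletion steps into one factor, and turns thinned binomial degrees
  back into binomial ones.\<close>

lemma thin_thin: "thin n a (\<lambda>i. thin i b f) = thin n (a * b) f"
proof (induction n arbitrary: f)
  case (Suc n)
  have "thin (Suc n) a (\<lambda>i. thin i b f) =
      a * thin n a (\<lambda>i. b * thin i b (\<lambda>i. f (Suc i)) + (1 - b) * thin i b f) +
      (1 - a) * thin n a (\<lambda>i. thin i b f)"
    by simp
  also have "\<dots> = a * (b * thin n (a * b) (\<lambda>i. f (Suc i)) + (1 - b) * thin n (a * b) f) +
      (1 - a) * thin n (a * b) f"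
    by (simp only: thin_add thin_cmult Suc.IH)
  finally show ?case
    by (simp add: algebra_simps)
qed auto

lemma thin_near:
  assumes "0 \<le> e" "e \<le> 1" "\<And>i. 0 \<le> g i" "\<And>i. g i \<le> B"
  shows "\<bar>thin n (1 - e) g - g n\<bar> \<le> B * n * e"
  using assms(3,4)
proof (induction n arbitrary: g)
  case (Suc n)
  let ?a = "thin n (1 - e) (\<lambda>i. g (Suc i)) - g (Suc n)" and ?b = "thin n (1 - e) g - g (Suc n)"
  have a: "\<bar>?a\<bar> \<le> B * n * e"
    using Suc.IH[of "\<lambda>i. g (Suc i)"] Suc.prems by auto
  have "0 \<le> thin n (1 - e) g" "thin n (1 - e) g \<le> B"
    using Suc.prems assms(1,2) by (auto intro!: thin_nonneg thin_le)
  then have b: "\<bar>?b\<bar> \<le> B"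
    using Suc.prems(1,2)[of "Suc n"] by linarith
  have "\<bar>thin (Suc n) (1 - e) g - g (Suc n)\<bar> = \<bar>(1 - e) * ?a + e * ?b\<bar>"
    by (simp add: algebra_simps)
  also have "\<dots> \<le> (1 - e) * \<bar>?a\<bar> + e * \<bar>?b\<bar>"
    using assms(1,2) by (intro order.trans[OF abs_triangle_ineq]) (simp add: abs_mult)
  also have "\<dots> \<le> 1 * (B * n * e) + e * B"
    using assms(1,2) a b by (intro add_mono mult_mono) auto
  finally show ?case
    by (simp add: algebra_simps)
qed auto

text \<open>Losing each of \<open>n\<close> points with probability \<open>e\<close> is, to first
  order, the same as losing exactly one point with probability \<open>n * e\<close>. With
  \<open>e = 1 / s\<close> the latter is what happens to a vertex with \<open>n\<close> points when
  one of \<open>s\<close> points is removed uniformly at random. The two laws differ by events of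
  double loss, hence the quadratic error.\<close>

lemma thin_linear_approx:
  assumes "0 \<le> e" "e \<le> 1" "\<And>i. 0 \<le> g i" "\<And>i. g i \<le> B"
  shows "\<bar>thin n (1 - e) g - ((1 - n * e) * g n + n * e * g (n - 1))\<bar> \<le> B * (n * e)\<^sup>2"
  using assms(3,4)
proof (induction n arbitrary: g)
  case (Suc n)
  define a where "a = thin n (1 - e) (\<lambda>i. g (Suc i)) - ((1 - n * e) * g (Suc n) + n * e * g n)"
  define b where "b = thin n (1 - e) g - g n"
  have B: "0 \<le> B"
    using Suc.prems(1,2)[of 0] by linarith
  have "n * e * g (Suc (n - 1)) = n * e * g n"
    by (cases n) auto
  then have a: "\<bar>a\<bar> \<le> B * (n * e)\<^sup>2"
    using Suc.IH[of "\<lambda>i. g (Suc i)"] Suc.prems by (auto simp: a_def)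
  have b: "\<bar>b\<bar> \<le> B * n * e"
    unfolding b_def using Suc.prems assms(1,2) by (intro thin_near) auto
  have c: "\<bar>g (Suc n) - g n\<bar> \<le> B"
    using Suc.prems(1,2)[of n] Suc.prems(1,2)[of "Suc n"] by linarith
  have "thin (Suc n) (1 - e) g - ((1 - Suc n * e) * g (Suc n) + Suc n * e * g (Suc n - 1)) =
      (1 - e) * a + e * b + n * e\<^sup>2 * (g (Suc n) - g n)"
    by (simp add: a_def b_def algebra_simps power2_eq_square)
  also have "\<bar>\<dots>\<bar> \<le> \<bar>(1 - e) * a\<bar> + \<bar>e * b\<bar> + \<bar>n * e\<^sup>2 * (g (Suc n) - g n)\<bar>"
    by linarith
  also have "\<dots> = (1 - e) * \<bar>a\<bar> + e * \<bar>b\<bar> + n * e\<^sup>2 * \<bar>g (Suc n) - g n\<bar>"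
    using assms(1,2) by (simp add: abs_mult)
  also have "\<dots> \<le> 1 * (B * (n * e)\<^sup>2) + e * (B * n * e) + n * e\<^sup>2 * B"
    using assms(1,2) a b c by (intro add_mono mult_mono) auto
  also have "\<dots> \<le> B * (Suc n * e)\<^sup>2"
    using B by (simp add: algebra_simps power2_eq_square)
  finally show ?case .
qed auto

lemma thin_square:
  "thin n p (\<lambda>i. (a + real i)\<^sup>2) = (a + n * p)\<^sup>2 + n * p * (1 - p)"
proof (induction n arbitrary: a)
  case (Suc n)
  have "thin (Suc n) p (\<lambda>i. (a + real i)\<^sup>2) =
     p * thin n p (\<lambda>i. ((a + 1) + real i)\<^sup>2) + (1 - p) * thin n p (\<lambda>i. (a + real i)\<^sup>2)"
    by (simp add: add_ac)
  then show ?case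
    by (simp only: Suc.IH) (simp add: algebra_simps power2_eq_square)
qed auto

section \<open>Size biasing and Poisson approximation\<close>

text \<open>Size biasing replaces the weight \<open>i\<close> by a factor and a shift by one, so
  \<open>i * of_bool (k \<le> i)\<close> turns into the event \<open>k - 1 \<le> i\<close>. This is
  the origin of \<open>k - 1\<close> in \<open>gamma\<close>.\<close>

lemma thin_of_nat_mult:
  fixes p :: real
  shows   "thin (Suc n) p (\<lambda>i. real i * g i) = Suc n * p * thin n p (\<lambda>i. g (Suc i))"
proof (induction n arbitrary: g)
  case (Suc n)
  have "thin (Suc (Suc n)) p (\<lambda>i. real i * g i) =
      p * thin (Suc n) p (\<lambda>i. real i * g (Suc i) + g (Suc i)) + (1 - p) * thin (Suc n) p (\<lambda>i. real i * g i)"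
    unfolding thin.simps(2)[of "Suc n"] by (simp add: algebra_simps)
  also have "\<dots> = p * (thin (Suc n) p (\<lambda>i. real i * g (Suc i)) + thin (Suc n) p (\<lambda>i. g (Suc i)))
      + (1 - p) * thin (Suc n) p (\<lambda>i. real i * g i)"
    by (simp only: thin_add)
  also have "\<dots> = Suc (Suc n) * p * thin (Suc n) p (\<lambda>i. g (Suc i))"
    unfolding Suc.IH Suc.IH[of "\<lambda>i. g (Suc i)"] by (simp add: algebra_simps)
  finally show ?case .
qed simp

lemma thin_indicator:
  fixes p :: real
  shows   "thin n p (\<lambda>i. of_bool (i = j)) = (n choose j) * p ^ j * (1 - p) ^ (n - j)"
proof (induction n arbitrary: j)
  case 0
  show ?case by (cases j) auto
next
  case (Suc n)
  show ?case
  proof (cases j)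
    case 0
    then show ?thesis by (simp add: Suc)
  next
    case (Suc j')
    have "(n choose Suc j') * (1 - p) * (1 - p) ^ (n - Suc j') = (n choose Suc j') * (1 - p) ^ (n - j')"
    proof (cases "Suc j' \<le> n")
      case True
      then have "n - j' = Suc (n - Suc j')" by simp
      then show ?thesis by (simp del: binomial_Suc_Suc)
    qed (simp add: binomial_eq_0)
    then have "(1 - p) * ((n choose Suc j') * p ^ Suc j' * (1 - p) ^ (n - Suc j')) =
        (n choose Suc j') * p ^ Suc j' * (1 - p) ^ (n - j')"
      by (metis (no_types, opaque_lifting) mult.assoc mult.commute)
    then have eq: "(1 - p) * thin n p (\<lambda>i. of_bool (i = Suc j')) =
        (n choose Suc j') * p ^ Suc j' * (1 - p) ^ (n - j')"
      by (simp only: Suc.IH)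
    have "thin (Suc n) p (\<lambda>i. of_bool (i = j)) =
        p * thin n p (\<lambda>i. of_bool (i = j')) + (1 - p) * thin n p (\<lambda>i. of_bool (i = Suc j'))"
      by (simp add: Suc)
    also have "\<dots> = (Suc n choose j) * p ^ j * (1 - p) ^ (Suc n - j)"
      unfolding eq unfolding Suc.IH Suc by (simp add: algebra_simps)
    finally show ?thesis .
  qed
qed

lemma fact_binomial_ge:
  "real n ^ j * (1 - real j ^ 2 / n) \<le> fact j * real (n choose j)"
proof (induction j)
  case (Suc j)
  have eq: "fact (Suc j) * real (n choose Suc j) = fact j * real (n choose j) * real (n - j)"
  proof -
    have "Suc j * (n choose Suc j) = (n - j) * (n choose j)"
      using binomial_absorb_comp[of n j] binomial_absorption[of j n] by simp
    then have "real (Suc j) * real (n choose Suc j) = real (n - j) * real (n choose j)"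
      by (metis of_nat_mult)
    moreover have "fact (Suc j) * real (n choose Suc j) = fact j * (real (Suc j) * real (n choose Suc j))"
      by (simp only: fact_Suc mult_ac of_nat_mult)
    ultimately show ?thesis by (simp only: mult_ac)
  qed
  show ?case
  proof (cases "(Suc j)\<^sup>2 \<le> n")
    case True
    then have jn: "j \<le> n" "0 < n" "real j ^ 2 \<le> n"
      by (auto simp: power2_eq_square simp flip: of_nat_mult)
    have "real n ^ Suc j * (1 - real (Suc j) ^ 2 / n) \<le> real n ^ Suc j * ((1 - real j ^ 2 / n) * (1 - j / n))"
      using jn(2) by (intro mult_left_mono) (auto simp: field_simps power2_eq_square)
    also have "\<dots> = (real n ^ j * (1 - real j ^ 2 / n)) * (n - j)"
      using jn by (simp add: field_simps of_nat_diff)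
    also have "\<dots> \<le> fact j * real (n choose j) * real (n - j)"
      using jn(1) by (intro mult_right_mono Suc.IH) auto
    finally show ?thesis unfolding eq .
  next
    case False
    then have "real n ^ Suc j * (1 - real (Suc j) ^ 2 / n) \<le> 0"
    proof (cases "n = 0")
      case False
      have "real n \<le> real (Suc j) ^ 2"
        using \<open>\<not> (Suc j)\<^sup>2 \<le> n\<close> by (metis less_imp_le not_le of_nat_le_iff of_nat_power)
      with False show ?thesis
        by (intro mult_nonneg_nonpos) (auto simp: field_simps)
    qed auto
    also have "0 \<le> fact (Suc j) * real (n choose Suc j)" by simp
    finally show ?thesis .
  qed
qed simp

text \<open>Pointwise lower bounds serve both directions: a tail is bounded above through its finite
  complement, and below through finitely many of its terms. The two errors come from replacing the
  falling factorial by \<open>n ^ j\<close> and \<open>(1 - p) ^ n\<close> by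
  \<open>exp (- (n * p))\<close>.\<close>

lemma thin_indicator_ge:
  fixes p :: real
  assumes p: "0 < p" "p \<le> 1/2" and n: "0 < n"
  shows "pmf (poisson_pmf (n * p)) j - (real j ^ 2 / n + 2 * real n * p\<^sup>2) \<le> thin n p (\<lambda>i. of_bool (i = j))"
proof -
  define Q where "Q = exp (- (n * p)) * (n * p) ^ j / fact j"
  define a b where "a = 1 - real j ^ 2 / n" and "b = 1 - 2 * real n * p\<^sup>2"
  have Q: "pmf (poisson_pmf (n * p)) j = Q"
  proof -
    have "0 < real n * p" using p n by simp
    then show ?thesis using pmf_poisson[of "n * p" j] by (simp add: Q_def mult_ac)
  qed
  have Q01: "0 \<le> Q" "Q \<le> 1"
    using pmf_le_1[of "poisson_pmf (n * p)" j] p unfolding Q by (simp_all add: Q_def)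
  have ab: "a \<le> 1" "b \<le> 1"
    by (auto simp: a_def b_def)
  have thin0: "0 \<le> thin n p (\<lambda>i. of_bool (i = j))"
    using p by (intro thin_nonneg) auto
  show ?thesis
  proof (cases "0 \<le> a \<and> 0 \<le> b")
    case True
    have "1 - 2 * real n * p\<^sup>2 \<le> exp (- (2 * real n * p\<^sup>2))"
      using exp_ge_add_one_self[of "- (2 * real n * p\<^sup>2)"] by simp
    then have "exp (- (n * p)) * b \<le> exp (- (n * p)) * exp (- (2 * real n * p\<^sup>2))"
      by (simp add: b_def)
    also have "\<dots> = exp (n * (- p - 2 * p\<^sup>2))"
      by (simp add: algebra_simps flip: exp_add)
    also have "\<dots> \<le> exp (n * ln (1 - p))"
      using ln_one_minus_pos_lower_bound[of p] p by (simp add: mult_left_mono)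
    also have "\<dots> = (1 - p) ^ n"
      using p by (simp add: exp_of_nat_mult)
    finally have E: "exp (- (n * p)) * b \<le> (1 - p) ^ n" .
    have "Q - (real j ^ 2 / n + 2 * real n * p\<^sup>2) \<le> Q * (a * b)"
    proof -
      have "Q * (1 - a * b) \<le> 1 * (1 - a * b)"
        using True ab Q01 by (intro mult_right_mono) (auto simp: mult_le_one)
      moreover have "0 \<le> (1 - a) * (1 - b)"
        using ab by simp
      ultimately show ?thesis
        by (simp add: a_def b_def algebra_simps)
    qed
    also have "\<dots> = ((real n ^ j * a) / fact j) * p ^ j * (exp (- (n * p)) * b)"
      by (simp add: Q_def power_mult_distrib)
    also have "\<dots> \<le> (n choose j) * p ^ j * (1 - p) ^ n"
    proof (intro mult_mono E)
      show "real n ^ j * a / fact j \<le> (n choose j)"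
        using fact_binomial_ge[of n j] by (simp add: a_def field_simps)
    qed (use p True in auto)
    also have "\<dots> \<le> (n choose j) * p ^ j * (1 - p) ^ (n - j)"
      using p by (intro mult_left_mono power_decreasing) auto
    finally show ?thesis
      unfolding thin_indicator Q .
  next
    \<comment> \<open>A negative factor means that the claimed error is at least 1, so the bound is
      trivial.\<close>
    case False
    then have "a < 0 \<or> b < 0" by auto
    then have "1 \<le> real j ^ 2 / n + 2 * real n * p\<^sup>2"
    proof
      assume "a < 0"
      moreover have "0 \<le> 2 * real n * p\<^sup>2" by simp
      ultimately show ?thesis unfolding a_def by linarith
    next
      assume "b < 0"
      moreover have "0 \<le> real j ^ 2 / n" by simp
      ultimately show ?thesis unfolding b_def by linarith
    qed
    then show ?thesis
      using thin0 Q01 unfolding Q by linarith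
  qed
qed


lemma poisson_prob_atLeast:
  "measure_pmf.prob (poisson_pmf s) {k..} = 1 - (\<Sum>j<k. pmf (poisson_pmf s) j)"
proof -
  have "measure_pmf.prob (poisson_pmf s) {k..} = 1 - measure_pmf.prob (poisson_pmf s) {..<k}"
    using measure_pmf.prob_compl[of "{..<k}" "poisson_pmf s"] by (simp add: Compl_eq_Diff_UNIV[symmetric])
  also have "measure_pmf.prob (poisson_pmf s) {..<k} = (\<Sum>j<k. pmf (poisson_pmf s) j)"
    by (simp add: measure_measure_pmf_finite)
  finally show ?thesis .
qed

text \<open>Size biasing sets one of the \<open>Suc n\<close> trials aside, so the Poisson mean is
  \<open>n * p\<close>.\<close>

lemma thin_heavy_le:
  fixes p :: real
  assumes p: "0 < p" "p \<le> 1/2" and n: "0 < n" and k: "1 \<le> k"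
    and f: "\<And>i. f i \<le> real i * of_bool (k \<le> i)"
  shows "thin (Suc n) p f \<le> Suc n * p * (measure_pmf.prob (poisson_pmf (n * p)) {k - 1..} +
           k * (real k ^ 2 / n + 2 * real n * p\<^sup>2))"
proof -
  have "thin (Suc n) p f \<le> thin (Suc n) p (\<lambda>i. real i * of_bool (k \<le> i))"
    using p f by (intro thin_mono) auto
  also have "\<dots> = Suc n * p * thin n p (\<lambda>i. of_bool (k - 1 \<le> i))"
    unfolding thin_of_nat_mult using k by (intro arg_cong2[where f = "(*)"] arg_cong[where f = "thin n p"]) (auto simp: fun_eq_iff of_bool_def)
  also have "(\<lambda>i. of_bool (k - 1 \<le> i)) = (\<lambda>i. 1 - (\<Sum>j<k - 1. of_bool (i = j)) :: real)"
  proof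
    fix i
    have "(\<Sum>j<k - 1. of_bool (i = j)) = (of_bool (i < k - 1) :: real)"
      by (simp add: of_bool_def sum.delta)
    then show "of_bool (k - 1 \<le> i) = 1 - (\<Sum>j<k - 1. of_bool (i = j) :: real)"
      by auto
  qed
  also have "thin n p \<dots> = 1 - (\<Sum>j<k - 1. thin n p (\<lambda>i. of_bool (i = j)))"
    by (simp only: thin_diff thin_sum thin_const)
  also have "Suc n * p * \<dots> \<le> Suc n * p * (measure_pmf.prob (poisson_pmf (n * p)) {k - 1..} +
           k * (real k ^ 2 / n + 2 * real n * p\<^sup>2))"
  proof (intro mult_left_mono)
    have "(\<Sum>j<k - 1. pmf (poisson_pmf (n * p)) j) - k * (real k ^ 2 / n + 2 * real n * p\<^sup>2)
        \<le> (\<Sum>j<k - 1. pmf (poisson_pmf (n * p)) j) - (\<Sum>j<k - 1. real k ^ 2 / n + 2 * real n * p\<^sup>2)"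
      by (simp add: mult_right_mono)
    also have "\<dots> = (\<Sum>j<k - 1. pmf (poisson_pmf (n * p)) j - (real k ^ 2 / n + 2 * real n * p\<^sup>2))"
      by (simp add: sum_subtractf)
    also have "\<dots> \<le> (\<Sum>j<k - 1. thin n p (\<lambda>i. of_bool (i = j)))"
    proof (intro sum_mono)
      fix j assume "j \<in> {..<k - 1}"
      then have "real j ^ 2 / n \<le> real k ^ 2 / n"
        by (intro divide_right_mono power_mono) auto
      then show "pmf (poisson_pmf (n * p)) j - (real k ^ 2 / n + 2 * real n * p\<^sup>2) \<le> thin n p (\<lambda>i. of_bool (i = j))"
        using thin_indicator_ge[OF p n, of j] by linarith
    qed
    finally show "1 - (\<Sum>j<k - 1. thin n p (\<lambda>i. of_bool (i = j))) \<le>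
        measure_pmf.prob (poisson_pmf (n * p)) {k - 1..} + k * (real k ^ 2 / n + 2 * real n * p\<^sup>2)"
      unfolding poisson_prob_atLeast by linarith
  qed (use p in auto)
  finally show ?thesis .
qed

lemma thin_heavy_ge:
  fixes p :: real
  assumes p: "0 < p" "p \<le> 1/2" and n: "0 < n"
    and f: "\<And>i. i \<in> {k..J} \<Longrightarrow> real i \<le> f i" "\<And>i. 0 \<le> f i"
  shows "(\<Sum>i=k..J. real i * pmf (poisson_pmf (n * p)) i) - real (Suc J) ^ 2 * (real J ^ 2 / n + 2 * real n * p\<^sup>2)
          \<le> thin n p f"
proof -
  define e where "e = real J ^ 2 / n + 2 * real n * p\<^sup>2"
  have e: "0 \<le> e" by (simp add: e_def)
  have "(\<Sum>i=k..J. real i * e) \<le> (\<Sum>i=k..J. (Suc J) * e)"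
    using e by (intro sum_mono mult_right_mono) auto
  also have "\<dots> \<le> (Suc J) * ((Suc J) * e)"
    using e by (simp add: mult_right_mono del: of_nat_Suc)
  finally have "(\<Sum>i=k..J. real i * e) \<le> real (Suc J) ^ 2 * e"
    by (simp only: power2_eq_square mult.assoc)
  then have "(\<Sum>i=k..J. real i * pmf (poisson_pmf (n * p)) i) - real (Suc J) ^ 2 * e
      \<le> (\<Sum>i=k..J. real i * (pmf (poisson_pmf (n * p)) i - e))"
    by (simp add: right_diff_distrib sum_subtractf)
  also have "\<dots> \<le> (\<Sum>i=k..J. real i * thin n p (\<lambda>l. of_bool (l = i)))"
  proof (intro sum_mono mult_left_mono)
    fix i assume "i \<in> {k..J}"
    then have "real i ^ 2 / n \<le> real J ^ 2 / n"
      by (intro divide_right_mono power_mono) auto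
    then show "pmf (poisson_pmf (n * p)) i - e \<le> thin n p (\<lambda>l. of_bool (l = i))"
      using thin_indicator_ge[OF p n, of i] unfolding e_def by linarith
  qed auto
  also have "\<dots> = thin n p (\<lambda>l. \<Sum>i=k..J. real i * of_bool (l = i))"
    by (simp only: thin_sum thin_cmult)
  also have "\<dots> \<le> thin n p f"
  proof (intro thin_mono)
    fix l
    have "(\<Sum>i=k..J. real i * of_bool (l = i)) = (if l \<in> {k..J} then real l else 0)"
      by (simp add: of_bool_def if_distrib[where f="\<lambda>x. _ * x"] cong: if_cong)
    then show "(\<Sum>i=k..J. real i * of_bool (l = i)) \<le> f l"
      using f by auto
  qed (use p in auto)
  finally show ?thesis
    by (simp add: e_def)
qed

section \<open>Exponential moments\<close>

lemma mean_exp_le: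
  fixes p a :: "'a \<Rightarrow> real"
  assumes "finite A" and p: "\<And>u. u \<in> A \<Longrightarrow> 0 \<le> p u" "(\<Sum>u\<in>A. p u) = 1"
    and a: "\<And>u. u \<in> A \<Longrightarrow> \<bar>a u\<bar> \<le> b" and \<theta>: "\<bar>\<theta>\<bar> * b \<le> 1"
  shows "(\<Sum>u\<in>A. p u * exp (\<theta> * a u)) \<le> exp (\<theta> * (\<Sum>u\<in>A. p u * a u) + (\<theta> * b)\<^sup>2)"
proof -
  have "exp (\<theta> * a u) \<le> 1 + \<theta> * a u + (\<theta> * b)\<^sup>2" if "u \<in> A" for u
  proof -
    have le: "\<bar>\<theta> * a u\<bar> \<le> \<bar>\<theta>\<bar> * b"
      using a[OF that] by (simp add: abs_mult mult_left_mono)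
    then have "exp (\<theta> * a u) \<le> 1 + \<theta> * a u + (\<theta> * a u)\<^sup>2"
    proof (cases "0 \<le> \<theta> * a u")
      case True
      then show ?thesis using le \<theta> by (intro exp_bound) auto
    next
      case False
      define y where "y = - (\<theta> * a u)"
      have y: "0 < y" "y \<le> 1" using False le \<theta> by (auto simp: y_def)
      \<comment> \<open>\<open>exp_bound\<close> covers nonnegative arguments; for
        \<open>- y\<close> the identity \<open>(1 + y) * (1 - y + y ^ 2) = 1 + y ^ 3\<close> gives
        the same bound.\<close>
      have "1 \<le> exp y * (1 - y + y\<^sup>2)"
      proof -
        have "1 + y \<le> exp y" by (rule exp_ge_add_one_self)
        moreover have "0 \<le> 1 - y + y\<^sup>2" using y by simp
        ultimately have "(1 + y) * (1 - y + y\<^sup>2) \<le> exp y * (1 - y + y\<^sup>2)"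
          by (rule mult_right_mono)
        moreover have "(1 + y) * (1 - y + y\<^sup>2) = 1 + y ^ 3"
          by (simp add: algebra_simps power2_eq_square power3_eq_cube)
        moreover have "0 \<le> y ^ 3" using y by simp
        ultimately show ?thesis by linarith
      qed
      then have "exp (- y) \<le> 1 - y + y\<^sup>2"
        by (simp add: exp_minus field_simps)
      then show ?thesis by (simp add: y_def)
    qed
    moreover have "(\<theta> * a u)\<^sup>2 \<le> (\<theta> * b)\<^sup>2"
      using le a[OF that] by (intro abs_le_square_iff[THEN iffD1]) (simp add: abs_mult)
    ultimately show ?thesis by linarith
  qed
  then have "(\<Sum>u\<in>A. p u * exp (\<theta> * a u)) \<le> (\<Sum>u\<in>A. p u * (1 + \<theta> * a u + (\<theta> * b)\<^sup>2))"
    using p by (intro sum_mono mult_left_mono) auto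
  also have "\<dots> = (\<Sum>u\<in>A. p u) * (1 + (\<theta> * b)\<^sup>2) + \<theta> * (\<Sum>u\<in>A. p u * a u)"
    by (simp add: algebra_simps sum.distrib sum_distrib_left sum_distrib_right)
  also have "\<dots> = 1 + (\<theta> * (\<Sum>u\<in>A. p u * a u) + (\<theta> * b)\<^sup>2)"
    using p by simp
  also have "\<dots> \<le> exp (\<theta> * (\<Sum>u\<in>A. p u * a u) + (\<theta> * b)\<^sup>2)"
    by (rule exp_ge_add_one_self)
  finally show ?thesis .
qed

section \<open>Uniform words over a finite alphabet\<close>

definition words :: "'a set \<Rightarrow> nat \<Rightarrow> 'a list set" where
  "words V l = {w. set w \<subseteq> V \<and> length w = l}"

lemma finite_words [simp]: "finite V \<Longrightarrow> finite (words V l)"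
  unfolding words_def by (rule finite_lists_length_eq)

lemma card_words: "finite V \<Longrightarrow> card (words V l) = card V ^ l"
  unfolding words_def by (rule card_lists_length_eq)

lemma words_0 [simp]: "words V 0 = {[]}"
  by (auto simp: words_def)

lemma sum_words_Suc:
  assumes "finite V"
  shows "(\<Sum>w\<in>words V (Suc l). G w) = (\<Sum>u\<in>V. \<Sum>w\<in>words V l. G (u # w))"
proof -
  have "(\<Sum>u\<in>V. \<Sum>w\<in>words V l. G (u # w)) = (\<Sum>(u, w)\<in>V \<times> words V l. G (u # w))"
    by (rule sum.cartesian_product)
  also have "\<dots> = (\<Sum>w\<in>words V (Suc l). G w)"
    by (rule sum.reindex_bij_witness[of _ "\<lambda>w. (hd w, tl w)" "\<lambda>(u, w). u # w"])
       (auto simp: words_def length_Suc_conv)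
  finally show ?thesis ..
qed

lemma sum_words_count:
  fixes g :: "nat \<Rightarrow> real"
  assumes V: "finite V" "v \<in> V"
  shows "(\<Sum>w\<in>words V N. g (c + count (mset w) v)) =
    card V ^ N * thin N (1 / card V) (\<lambda>i. g (c + i))"
proof (induction N arbitrary: c)
  case (Suc N)
  define n where "n = card V"
  have n: "0 < n" using V by (auto simp: n_def card_gt_0_iff)
  let ?S = "\<lambda>c. \<Sum>w\<in>words V N. g (c + count (mset w) v)"
  have "(\<Sum>w\<in>words V (Suc N). g (c + count (mset w) v)) =
      (\<Sum>u\<in>V. if u = v then ?S (Suc c) else ?S c)"
    unfolding sum_words_Suc[OF V(1)] by (intro sum.cong refl) (auto intro!: sum.cong)
  also have "\<dots> = (\<Sum>u\<in>V. ?S c + (if u = v then ?S (Suc c) - ?S c else 0))"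
    by (intro sum.cong) auto
  also have "\<dots> = n * ?S c + (?S (Suc c) - ?S c)"
    using V by (simp add: sum.distrib sum.delta n_def)
  also have "\<dots> = n ^ Suc N * thin (Suc N) (1 / n) (\<lambda>i. g (c + i))"
    unfolding Suc.IH[folded n_def] using n by (simp add: field_simps)
  finally show ?case by (simp add: n_def)
qed simp

text \<open>The letters are drawn one at a time, with \<open>c\<close> recording those already
  drawn, and the conditional expectation of the sum is a martingale. A letter moves a single term of
  it, by at most \<open>B\<close>, so each step costs a factor
  \<open>exp ((\<theta> * B) ^ 2)\<close>.\<close>

lemma sum_words_exp_le:
  fixes g :: "nat \<Rightarrow> real"
  assumes V: "finite V" "V \<noteq> {}" and g: "\<And>i. 0 \<le> g i" "\<And>i. g i \<le> B" and \<theta>: "\<bar>\<theta>\<bar> * B \<le> 1"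
  shows "(\<Sum>w\<in>words V N. exp (\<theta> * (\<Sum>v\<in>V. g (c v + count (mset w) v)))) \<le>
    card V ^ N * exp (\<theta> * (\<Sum>v\<in>V. thin N (1 / card V) (\<lambda>i. g (c v + i))) + N * (\<theta> * B)\<^sup>2)"
proof (induction N arbitrary: c)
  case 0
  show ?case by simp
next
  case (Suc N)
  define n where "n = card V"
  have n: "0 < n" using V by (auto simp: n_def card_gt_0_iff)
  define A where "A = (\<lambda>j. thin N (1 / n) (\<lambda>i. g (j + i)))"
  have A: "0 \<le> A j" "A j \<le> B" for j
    unfolding A_def using n g by (auto intro!: thin_nonneg thin_le)
  define S where "S = (\<Sum>v\<in>V. A (c v))"
  define D where "D = (\<lambda>u. A (Suc (c u)) - A (c u))"
  have D: "\<bar>D u\<bar> \<le> B" for u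
    unfolding D_def using A[of "Suc (c u)"] A[of "c u"] by linarith
  have upd: "(\<Sum>v\<in>V. A (if v = u then Suc (c v) else c v)) = S + D u" if "u \<in> V" for u
  proof -
    have "(\<Sum>v\<in>V. A (if v = u then Suc (c v) else c v)) = (\<Sum>v\<in>V. A (c v) + (if v = u then D u else 0))"
      by (intro sum.cong) (auto simp: D_def)
    with that V show ?thesis by (simp add: sum.distrib S_def)
  qed
  have "(\<Sum>w\<in>words V (Suc N). exp (\<theta> * (\<Sum>v\<in>V. g (c v + count (mset w) v)))) =
      (\<Sum>u\<in>V. \<Sum>w\<in>words V N. exp (\<theta> * (\<Sum>v\<in>V. g ((if v = u then Suc (c v) else c v) + count (mset w) v))))"
    unfolding sum_words_Suc[OF V(1)]
    by (intro sum.cong refl arg_cong[where f = exp] arg_cong2[where f = "(*)"]) (auto intro!: arg_cong[where f = g])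
  also have "\<dots> \<le> (\<Sum>u\<in>V. n ^ N * exp (\<theta> * (S + D u) + N * (\<theta> * B)\<^sup>2))"
  proof (intro sum_mono)
    fix u assume "u \<in> V"
    then show "(\<Sum>w\<in>words V N. exp (\<theta> * (\<Sum>v\<in>V. g ((if v = u then Suc (c v) else c v) + count (mset w) v))))
        \<le> n ^ N * exp (\<theta> * (S + D u) + N * (\<theta> * B)\<^sup>2)"
      using Suc.IH[of "\<lambda>v. if v = u then Suc (c v) else c v"] upd[of u] by (simp add: n_def A_def)
  qed
  also have "\<dots> = real n ^ Suc N * exp (\<theta> * S + N * (\<theta> * B)\<^sup>2) * (\<Sum>u\<in>V. (1 / n) * exp (\<theta> * D u))"
    unfolding sum_distrib_left using n by (intro sum.cong) (simp_all add: exp_add distrib_left)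
  also have "\<dots> \<le> real n ^ Suc N * exp (\<theta> * S + N * (\<theta> * B)\<^sup>2) * exp (\<theta> * (\<Sum>u\<in>V. (1 / n) * D u) + (\<theta> * B)\<^sup>2)"
    using V n \<theta> D by (intro mult_left_mono mean_exp_le) (auto simp: n_def)
  also have "\<dots> = n ^ Suc N * exp (\<theta> * (S + (\<Sum>u\<in>V. (1 / n) * D u)) + Suc N * (\<theta> * B)\<^sup>2)"
    by (simp add: algebra_simps flip: exp_add)
  also have "S + (\<Sum>u\<in>V. (1 / n) * D u) = (\<Sum>v\<in>V. thin (Suc N) (1 / n) (\<lambda>i. g (c v + i)))"
    unfolding S_def D_def by (simp add: A_def algebra_simps flip: sum.distrib)
  finally show ?case by (simp add: n_def)
qed


section \<open>Removing random points from a multiset\<close>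

definition thin_total :: "'a set \<Rightarrow> (nat \<Rightarrow> real) \<Rightarrow> real \<Rightarrow> 'a multiset \<Rightarrow> real" where
  "thin_total V f \<tau> D = (\<Sum>v\<in>V. thin (count D v) \<tau> f)"

definition square_sum :: "'a set \<Rightarrow> 'a multiset \<Rightarrow> real" where
  "square_sum V D = (\<Sum>v\<in>V. (real (count D v))\<^sup>2)"

lemma square_sum_mono: "D \<subseteq># D' \<Longrightarrow> square_sum V D \<le> square_sum V D'"
  unfolding square_sum_def by (intro sum_mono power_mono) (auto dest: mset_subset_eq_count)

abbreviation arrangements :: "'a multiset \<Rightarrow> real" where
  "arrangements D \<equiv> real (card (permutations_of_multiset D))"

text \<open>Divided by \<open>arrangements D\<close>, the weights
  \<open>arrangements (D - {#u#})\<close> are the probabilities \<open>count D u / s\<close> that a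
  uniformly chosen point lies at \<open>u\<close>. The mean change of the thinned total is the
  first-order term of thinning by \<open>1 - 1 / s\<close>, and \<open>square_sum\<close> controls
  the rest.\<close>

lemma sum_remove_one_le:
  fixes f :: "nat \<Rightarrow> real"
  assumes V: "finite V" "set_mset D \<subseteq> V" and D: "D \<noteq> {#}"
    and f: "\<And>i. 0 \<le> f i" "\<And>i. f i \<le> B" and \<theta>: "\<bar>\<theta>\<bar> * B \<le> 1"
    and \<tau>: "0 \<le> \<tau>" "\<tau> \<le> 1" and s: "s = real (size D)"
    and sq: "square_sum V D \<le> A"
  shows "(\<Sum>u\<in>set_mset D. arrangements (D - {#u#}) * exp (\<theta> * thin_total V f \<tau> (D - {#u#})))
    \<le> arrangements D * exp (\<theta> * thin_total V f (\<tau> * (1 - 1 / s)) D + \<bar>\<theta>\<bar> * B * A / s\<^sup>2 + (\<theta> * B)\<^sup>2)"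
proof -
  define h where "h = (\<lambda>j. thin j \<tau> f)"
  have h: "0 \<le> h j" "h j \<le> B" for j
    unfolding h_def using \<tau> f by (auto intro!: thin_nonneg thin_le)
  have B: "0 \<le> B" using f[of 0] by linarith
  have s0: "1 \<le> s" using D s by (metis One_nat_def Suc_leI nonempty_has_size of_nat_1 of_nat_mono)
  define p where "p = (\<lambda>u. count D u / s)"
  define a where "a = (\<lambda>u. h (count D u - 1) - h (count D u))"
  define T where "T = thin_total V f \<tau> D"
  have p1: "(\<Sum>u\<in>set_mset D. p u) = 1"
    using s0 by (simp add: p_def s size_multiset_overloaded_eq flip: sum_divide_distrib)
  have rem: "arrangements (D - {#u#}) = arrangements D * p u" if "u \<in># D" for u
    using real_card_permutations_of_multiset_remove[OF that] s0 by (simp add: p_def s field_simps)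
  have tot: "thin_total V f \<tau> (D - {#u#}) = T + a u" if "u \<in># D" for u
  proof -
    have u: "u \<in> V" using that V by auto
    have "thin_total V f \<tau> (D - {#u#}) = (\<Sum>v\<in>V. h (count D v) + (if v = u then a u else 0))"
      unfolding thin_total_def by (intro sum.cong) (auto simp: a_def h_def)
    then show ?thesis
      using u V by (simp add: sum.distrib T_def thin_total_def h_def)
  qed
  have "(\<Sum>u\<in>set_mset D. arrangements (D - {#u#}) * exp (\<theta> * thin_total V f \<tau> (D - {#u#})))
      = arrangements D * exp (\<theta> * T) * (\<Sum>u\<in>set_mset D. p u * exp (\<theta> * a u))"
    unfolding sum_distrib_left by (intro sum.cong refl) (simp add: rem tot distrib_left exp_add)
  also have "\<dots> \<le> arrangements D * exp (\<theta> * T) * exp (\<theta> * (\<Sum>u\<in>set_mset D. p u * a u) + (\<theta> * B)\<^sup>2)"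
  proof (intro mult_left_mono mean_exp_le)
    fix u
    show "\<bar>a u\<bar> \<le> B"
      unfolding a_def using h[of "count D u"] h[of "count D u - 1"] by linarith
  qed (use p1 s0 \<theta> in \<open>auto simp: p_def\<close>)
  also have "\<dots> = arrangements D * exp (\<theta> * (T + (\<Sum>u\<in>set_mset D. p u * a u)) + (\<theta> * B)\<^sup>2)"
    by (simp add: algebra_simps flip: exp_add)
  also have "\<dots> \<le> arrangements D *
      exp (\<theta> * thin_total V f (\<tau> * (1 - 1 / s)) D + \<bar>\<theta>\<bar> * B * A / s\<^sup>2 + (\<theta> * B)\<^sup>2)"
  proof -
    have pa: "(\<Sum>u\<in>set_mset D. p u * a u) = (\<Sum>u\<in>V. p u * a u)"
      using V by (intro sum.mono_neutral_left) (auto simp: p_def not_in_iff)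
    \<comment> \<open>By \<open>thin_thin\<close>, the first total is a thinning of \<open>h\<close>
      by \<open>1 - 1 / s\<close>, to which \<open>thin_linear_approx\<close> applies at every
      vertex.\<close>
    have "\<bar>thin_total V f (\<tau> * (1 - 1 / s)) D - (T + (\<Sum>u\<in>set_mset D. p u * a u))\<bar>
        = \<bar>\<Sum>v\<in>V. thin (count D v) (1 - 1 / s) h -
            ((1 - count D v * (1 / s)) * h (count D v) + count D v * (1 / s) * h (count D v - 1))\<bar>"
      unfolding pa T_def thin_total_def h_def thin_thin mult.commute[of \<tau>] sum.distrib[symmetric] sum_subtractf[symmetric]
      by (intro arg_cong[where f = abs] sum.cong refl) (simp add: a_def p_def h_def algebra_simps)
    also have "\<dots> \<le> (\<Sum>v\<in>V. B * (count D v * (1 / s))\<^sup>2)"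
      using h s0 by (intro order.trans[OF sum_abs] sum_mono thin_linear_approx) auto
    also have "\<dots> = B * square_sum V D / s\<^sup>2"
      by (simp add: square_sum_def power_divide sum_distrib_left sum_divide_distrib)
    also have "\<dots> \<le> B * A / s\<^sup>2"
      using sq B by (intro divide_right_mono mult_left_mono) auto
    finally have le: "\<bar>thin_total V f (\<tau> * (1 - 1 / s)) D - (T + (\<Sum>u\<in>set_mset D. p u * a u))\<bar> \<le> B * A / s\<^sup>2" .
    have "\<theta> * (T + (\<Sum>u\<in>set_mset D. p u * a u)) - \<theta> * thin_total V f (\<tau> * (1 - 1 / s)) D
       \<le> \<bar>\<theta>\<bar> * \<bar>thin_total V f (\<tau> * (1 - 1 / s)) D - (T + (\<Sum>u\<in>set_mset D. p u * a u))\<bar>"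
      by (subst abs_mult[symmetric]) (simp add: algebra_simps)
    also have "\<dots> \<le> \<bar>\<theta>\<bar> * (B * A / s\<^sup>2)"
      using le by (intro mult_left_mono) auto
    finally show ?thesis
      by (intro mult_left_mono) auto
  qed
  finally show ?thesis .
qed

text \<open>Letter by letter, the retention factors \<open>(s - 1) / s\<close>,
  \<open>(s - 2) / (s - 1)\<close> and so on telescope to \<open>(s - l) / s\<close>. At least
  \<open>s0\<close> points remain throughout, which makes the error per letter uniform.\<close>

lemma sum_remove_word_le:
  fixes f :: "nat \<Rightarrow> real" and \<tau> :: real
  assumes V: "finite V" "set_mset D \<subseteq> V" and l: "real l + s0 \<le> real (size D)" and s0: "0 < s0"
    and f: "\<And>i. 0 \<le> f i" "\<And>i. f i \<le> B" and \<theta>: "\<bar>\<theta>\<bar> * B \<le> 1"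
    and \<tau>: "0 \<le> \<tau>" "\<tau> \<le> 1" and sq: "square_sum V D \<le> A"
  shows "(\<Sum>w | w \<in> words V l \<and> mset w \<subseteq># D. arrangements (D - mset w) * exp (\<theta> * thin_total V f \<tau> (D - mset w)))
    \<le> arrangements D * exp (\<theta> * thin_total V f (\<tau> * (size D - l) / size D) D +
         l * (\<bar>\<theta>\<bar> * B * A / s0\<^sup>2 + (\<theta> * B)\<^sup>2))"
  using V l sq
proof (induction l arbitrary: D)
  case 0
  have "{w. w = [] \<and> mset w \<subseteq># D} = {[]}" by auto
  moreover have "size D \<noteq> 0" using 0 s0 by auto
  ultimately show ?case by simp
next
  case (Suc l)
  define \<eta> where "\<eta> = \<bar>\<theta>\<bar> * B * A / s0\<^sup>2 + (\<theta> * B)\<^sup>2"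
  define s where "s = size D"
  \<comment> \<open>The retention for the \<open>l\<close> letters that follow the first, combined
    with \<open>\<tau>\<close>.\<close>
  define \<tau>' where "\<tau>' = \<tau> * real (s - 1 - l) / real (s - 1)"
  have B: "0 \<le> B" using f[of 0] by linarith
  have A: "0 \<le> A" using order.trans[OF _ Suc.prems(4)] by (simp add: square_sum_def sum_nonneg)
  have s: "real l + 1 + s0 \<le> s" using Suc.prems by (simp add: s_def)
  then have sl: "l + 1 < s" using s0 by linarith
  have D: "D \<noteq> {#}" using sl by (auto simp: s_def)
  have \<tau>': "0 \<le> \<tau>'" "\<tau>' \<le> 1"
  proof -
    show "0 \<le> \<tau>'" using \<tau> by (simp add: \<tau>'_def)
    have "\<tau> * real (s - 1 - l) \<le> 1 * real (s - 1)"
      using \<tau> by (intro mult_mono) auto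
    then show "\<tau>' \<le> 1" using sl by (simp add: \<tau>'_def divide_le_eq)
  qed
  let ?G = "\<lambda>D. arrangements D * exp (\<theta> * thin_total V f \<tau> D)"
  have "(\<Sum>w | w \<in> words V (Suc l) \<and> mset w \<subseteq># D. ?G (D - mset w)) =
        (\<Sum>w\<in>words V (Suc l). if mset w \<subseteq># D then ?G (D - mset w) else 0)"
    using V(1) by (subst sum.inter_filter[symmetric]) (auto intro!: sum.cong)
  also have "\<dots> = (\<Sum>u\<in>V. \<Sum>w\<in>words V l. if add_mset u (mset w) \<subseteq># D then ?G (D - {#u#} - mset w) else 0)"
  proof -
    have "D - mset (u # w) = D - {#u#} - mset w" for u w
      by (metis diff_add_mset_swap diff_diff_add_mset mset.simps(2) add_mset_add_single add.commute)
    then show ?thesis by (simp only: sum_words_Suc V(1) mset.simps)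
  qed
  also have "\<dots> = (\<Sum>u\<in>V. if u \<in># D then (\<Sum>w | w \<in> words V l \<and> mset w \<subseteq># D - {#u#}. ?G (D - {#u#} - mset w)) else 0)"
  proof (intro sum.cong refl)
    fix u
    have iff: "add_mset u M \<subseteq># D \<longleftrightarrow> u \<in># D \<and> M \<subseteq># D - {#u#}" for M
      by (metis add_mset_remove_trivial insert_DiffM insert_subset_eq_iff)
    show "(\<Sum>w\<in>words V l. if add_mset u (mset w) \<subseteq># D then ?G (D - {#u#} - mset w) else 0) =
      (if u \<in># D then (\<Sum>w | w \<in> words V l \<and> mset w \<subseteq># D - {#u#}. ?G (D - {#u#} - mset w)) else 0)"
      unfolding iff using V(1) by (cases "u \<in># D") (auto simp: sum.inter_filter[symmetric] intro!: sum.cong)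
  qed
  also have "\<dots> = (\<Sum>u\<in>set_mset D. \<Sum>w | w \<in> words V l \<and> mset w \<subseteq># D - {#u#}. ?G (D - {#u#} - mset w))"
    using Suc.prems(1,2) by (subst sum.inter_filter[symmetric]) (auto intro!: sum.cong)
  also have "\<dots> \<le> (\<Sum>u\<in>set_mset D. arrangements (D - {#u#}) *
      exp (\<theta> * thin_total V f \<tau>' (D - {#u#}) + l * \<eta>))"
  proof (intro sum_mono)
    fix u assume u: "u \<in># D"
    have sz: "size (D - {#u#}) = s - 1" using u by (simp add: s_def size_Diff_singleton)
    have "square_sum V (D - {#u#}) \<le> A"
      using square_sum_mono[of "D - {#u#}" D V] Suc.prems(4) by simp
    moreover have "set_mset (D - {#u#}) \<subseteq> V"
      using Suc.prems(2) by (meson in_diffD subset_iff)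
    moreover have "real l + s0 \<le> real (size (D - {#u#}))"
      unfolding sz using s by linarith
    ultimately show "(\<Sum>w | w \<in> words V l \<and> mset w \<subseteq># D - {#u#}. ?G (D - {#u#} - mset w))
       \<le> arrangements (D - {#u#}) * exp (\<theta> * thin_total V f \<tau>' (D - {#u#}) + l * \<eta>)"
      using Suc.IH[of "D - {#u#}"] V(1) unfolding sz \<tau>'_def \<eta>_def by simp
  qed
  also have "\<dots> = exp (l * \<eta>) * (\<Sum>u\<in>set_mset D. arrangements (D - {#u#}) * exp (\<theta> * thin_total V f \<tau>' (D - {#u#})))"
    by (simp add: exp_add sum_distrib_left mult_ac)
  also have "\<dots> \<le> exp (l * \<eta>) * (arrangements D * exp (\<theta> * thin_total V f (\<tau>' * (1 - 1 / s)) D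
       + \<bar>\<theta>\<bar> * B * A / (real s)\<^sup>2 + (\<theta> * B)\<^sup>2))"
    using Suc.prems D f \<theta> \<tau>' by (intro mult_left_mono sum_remove_one_le) (auto simp: s_def)
  also have "\<dots> \<le> exp (l * \<eta>) * (arrangements D * exp (\<theta> * thin_total V f (\<tau>' * (1 - 1 / s)) D + \<eta>))"
  proof -
    have "\<bar>\<theta>\<bar> * B * A / (real s)\<^sup>2 \<le> \<bar>\<theta>\<bar> * B * A / s0\<^sup>2"
      using s s0 A B by (intro divide_left_mono power_mono mult_nonneg_nonneg) auto
    then show ?thesis by (intro mult_left_mono) (auto simp: \<eta>_def)
  qed
  also have "\<tau>' * (1 - 1 / s) = \<tau> * (s - Suc l) / s"
    using sl by (simp add: \<tau>'_def field_simps of_nat_diff)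
  also have "exp (l * \<eta>) * (arrangements D * exp (\<theta> * thin_total V f (\<tau> * real (s - Suc l) / real s) D + \<eta>)) =
      arrangements D * exp (\<theta> * thin_total V f (\<tau> * real (s - Suc l) / real s) D + Suc l * \<eta>)"
    by (simp add: algebra_simps flip: exp_add)
  finally show ?case
    unfolding \<eta>_def s_def .
qed

section \<open>Configurations and peeling\<close>

abbreviation configs :: "'v set \<Rightarrow> nat \<Rightarrow> 'e set \<Rightarrow> ('e \<Rightarrow> 'v list) set" where
  "configs V d E \<equiv> PiE E (\<lambda>_. words V d)"

definition total_mset :: "'e set \<Rightarrow> ('e \<Rightarrow> 'v list) \<Rightarrow> 'v multiset" where
  "total_mset E f = (\<Sum>e\<in>E. mset (f e))"

definition inner_edges :: "'e set \<Rightarrow> ('e \<Rightarrow> 'v list) \<Rightarrow> 'v set \<Rightarrow> 'e set" where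
  "inner_edges E f W = {e \<in> E. set (f e) \<subseteq> W}"

text \<open>Points are counted with multiplicity, as a word may repeat a vertex; on words without
  repetitions this is the condition \<open>min_degree_ge\<close>.\<close>

definition stable :: "nat \<Rightarrow> 'e set \<Rightarrow> ('e \<Rightarrow> 'v list) \<Rightarrow> 'v set \<Rightarrow> bool" where
  "stable k E f W \<longleftrightarrow> (\<forall>v\<in>W. k \<le> count (total_mset (inner_edges E f W) f) v)"

text \<open>Measured in hyperedges, so that \<open>core_size V k E f = card E\<close> says that
  peeling cannot go on.\<close>

definition core_size :: "'v set \<Rightarrow> nat \<Rightarrow> 'e set \<Rightarrow> ('e \<Rightarrow> 'v list) \<Rightarrow> nat" where
  "core_size V k E f = Max {card (inner_edges E f W) |W. W \<subseteq> V \<and> stable k E f W}"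

lemma count_total_mset: "count (total_mset E f) v = (\<Sum>e\<in>E. count (mset (f e)) v)"
  by (simp add: total_mset_def count_sum)

lemma size_total_mset:
  assumes "f \<in> configs V d E"
  shows "size (total_mset E f) = d * card E"
proof -
  have "size (total_mset E f) = (\<Sum>e\<in>E. length (f e))"
    unfolding total_mset_def by (induction E rule: infinite_finite_induct) auto
  also have "\<dots> = (\<Sum>e\<in>E. d)"
    using assms by (intro sum.cong) (auto simp: PiE_def Pi_def words_def)
  finally show ?thesis by simp
qed

lemma set_total_mset:
  assumes "finite E"
  shows "set_mset (total_mset E f) = (\<Union>e\<in>E. set (f e))"
  using assms by (simp add: total_mset_def set_mset_sum)

lemma inner_edges_subset: "inner_edges E f W \<subseteq> E"
  by (auto simp: inner_edges_def)

lemma total_mset_mono: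
  assumes "finite E" "F \<subseteq> E"
  shows "total_mset F f \<subseteq># total_mset E f"
  unfolding subseteq_mset_def count_total_mset using assms by (auto intro: sum_mono2)

lemma stable_empty [simp]: "stable k E f {}"
  by (simp add: stable_def)

context
  fixes E :: "'e set" and V :: "'v set"
  assumes finE: "finite E" and finV: "finite V"
begin

lemma finite_stable_cards: "finite {card (inner_edges E f W) |W. W \<subseteq> V \<and> stable k E f W}"
  by (rule finite_subset[of _ "(\<lambda>W. card (inner_edges E f W)) ` Pow V"]) (use finV in auto)

lemma core_size_ge: "W \<subseteq> V \<Longrightarrow> stable k E f W \<Longrightarrow> card (inner_edges E f W) \<le> core_size V k E f"
  unfolding core_size_def by (intro Max_ge finite_stable_cards) auto

lemma core_size_attained:
  obtains W where "W \<subseteq> V" "stable k E f W" "core_size V k E f = card (inner_edges E f W)"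
proof -
  have "{card (inner_edges E f W) |W. W \<subseteq> V \<and> stable k E f W} \<noteq> {}"
    by (auto intro!: exI[of _ "{}"])
  then have "core_size V k E f \<in> {card (inner_edges E f W) |W. W \<subseteq> V \<and> stable k E f W}"
    unfolding core_size_def by (intro Max_in finite_stable_cards)
  then show ?thesis using that by blast
qed

lemma core_size_le: "core_size V k E f \<le> card E"
  using core_size_attained[of k f] finE by (metis card_mono inner_edges_subset)

lemma core_size_eqI:
  assumes "W \<subseteq> V" "stable k E f W" "card (inner_edges E f W) = q"
    and "\<And>W. W \<subseteq> V \<Longrightarrow> stable k E f W \<Longrightarrow> card (inner_edges E f W) \<le> q"
  shows "core_size V k E f = q"
  unfolding core_size_def using assms by (intro Max_eqI finite_stable_cards) auto

lemma core_size_full: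
  assumes f: "f \<in> configs V d E" and deg: "\<And>v. v \<in># total_mset E f \<Longrightarrow> k \<le> count (total_mset E f) v"
  shows "core_size V k E f = card E"
proof (rule core_size_eqI)
  let ?W = "set_mset (total_mset E f)"
  show "?W \<subseteq> V"
    using f by (auto simp: set_total_mset finE words_def PiE_def Pi_def)
  have "inner_edges E f ?W = E"
    by (auto simp: inner_edges_def set_total_mset finE)
  then show "stable k E f ?W" "card (inner_edges E f ?W) = card E"
    using deg by (auto simp: stable_def)
  show "card (inner_edges E f W) \<le> card E" for W
    by (intro card_mono finE inner_edges_subset)
qed

end

lemma stable_mono:
  assumes "finite E" "F \<subseteq> E" "stable k F f W"
  shows "stable k E f W"
  unfolding stable_def
proof
  fix v assume "v \<in> W"
  then have "k \<le> count (total_mset (inner_edges F f W) f) v"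
    using assms by (auto simp: stable_def)
  also have "\<dots> \<le> count (total_mset (inner_edges E f W) f) v"
    using assms by (intro mset_subset_eq_count total_mset_mono) (auto simp: inner_edges_def)
  finally show "k \<le> count (total_mset (inner_edges E f W) f) v" .
qed

text \<open>
  \<open>core_size\<close> is the number of hyperedges of the core, so this is the step of the peeling process.
\<close>

lemma core_size_remove:
  assumes fin: "finite E" "finite V" and e: "e \<in> E" "v \<in> set (f e)" and deg: "count (total_mset E f) v < k"
  shows "core_size V k (E - {e}) f = core_size V k E f"
proof -
  obtain W where W: "W \<subseteq> V" "stable k E f W" "core_size V k E f = card (inner_edges E f W)"
    using core_size_attained[OF fin] .
  have "v \<notin> W"
  proof
    assume "v \<in> W"
    then have "k \<le> count (total_mset (inner_edges E f W) f) v"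
      using W by (auto simp: stable_def)
    also have "\<dots> \<le> count (total_mset E f) v"
      by (intro mset_subset_eq_count total_mset_mono fin inner_edges_subset)
    finally show False using deg by simp
  qed
  then have eq: "inner_edges (E - {e}) f W = inner_edges E f W"
    using e by (auto simp: inner_edges_def)
  show ?thesis
  proof (rule core_size_eqI)
    show "stable k (E - {e}) f W"
      using W eq by (simp add: stable_def)
    fix W' assume W': "W' \<subseteq> V" "stable k (E - {e}) f W'"
    then have "stable k E f W'"
      using fin by (intro stable_mono[of E "E - {e}"]) auto
    then have "card (inner_edges E f W') \<le> core_size V k E f"
      using W' fin by (intro core_size_ge) auto
    moreover have "card (inner_edges (E - {e}) f W') \<le> card (inner_edges E f W')"
      by (intro card_mono finite_subset[OF inner_edges_subset fin(1)]) (auto simp: inner_edges_def)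
    ultimately show "card (inner_edges (E - {e}) f W') \<le> core_size V k E f" by simp
  qed (use fin W eq in auto)
qed

lemma core_size_cong:
  assumes "\<And>e. e \<in> E \<Longrightarrow> f e = g e"
  shows "core_size V k E f = core_size V k E g"
proof -
  have "inner_edges E f W = inner_edges E g W" for W
    using assms by (auto simp: inner_edges_def)
  moreover have "total_mset (inner_edges E g W) f = total_mset (inner_edges E g W) g" for W
    unfolding total_mset_def using assms by (intro sum.cong) (auto simp: inner_edges_def)
  ultimately show ?thesis
    by (simp add: core_size_def stable_def)
qed

section \<open>Counting configurations with given degrees\<close>

lemma finite_configs [simp]: "finite E \<Longrightarrow> finite V \<Longrightarrow> finite (configs V d E)"
  by (intro finite_PiE) auto

lemma concat_inj_on_words:
  assumes "length xs = length ys" "\<And>x. x \<in> set xs \<union> set ys \<Longrightarrow> length x = d" "concat xs = concat ys"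
  shows "xs = ys"
  using assms by (induction xs ys rule: list_induct2) auto

text \<open>Concatenating the words along a fixed enumeration of \<open>E\<close> is injective, as
  all words have the same length.\<close>

lemma card_configs_total_le:
  assumes fin: "finite E" "finite V"
  shows "card {f \<in> configs V d E. total_mset E f = D} \<le> card (permutations_of_multiset D)"
proof -
  obtain es where es: "set es = E" "distinct es"
    using finite_distinct_list[OF fin(1)] by blast
  define F where "F = (\<lambda>f :: 'a \<Rightarrow> 'b list. concat (map f es))"
  have "inj_on F {f \<in> configs V d E. total_mset E f = D}"
  proof
    fix f g
    assume fg: "f \<in> {f \<in> configs V d E. total_mset E f = D}" "g \<in> {f \<in> configs V d E. total_mset E f = D}"
      and eq: "F f = F g"
    have "map f es = map g es"
      by (rule concat_inj_on_words[where d = d])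
         (use fg eq es in \<open>auto simp: F_def words_def PiE_def Pi_def\<close>)
    then show "f = g"
      using fg es by (intro PiE_ext[of f E _ g]) auto
  qed
  moreover have "F ` {f \<in> configs V d E. total_mset E f = D} \<subseteq> permutations_of_multiset D"
  proof -
    have "mset (F f) = total_mset E f" for f
      unfolding F_def total_mset_def es(1)[symmetric] using es(2)
      by (induction es) (auto simp: )
    then show ?thesis by (auto intro: permutations_of_multisetI)
  qed
  ultimately show ?thesis
    by (intro card_inj_on_le[of F]) auto
qed

text \<open>Mark an occurrence of \<open>v\<close> and delete it: by symmetry each of the
  \<open>Suc l\<close> positions contributes the same.\<close>

lemma sum_words_count_mult:
  fixes G :: "'v multiset \<Rightarrow> real"
  assumes V: "finite V" "v \<in> V"
  shows "(\<Sum>w\<in>words V (Suc l). count (mset w) v * G (mset w)) =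
    Suc l * (\<Sum>w\<in>words V l. G (add_mset v (mset w)))"
proof (induction l arbitrary: G)
  case 0
  have "(\<Sum>u\<in>V. real (count {#u#} v) * G {#u#}) = (\<Sum>u\<in>V. if u = v then G {#v#} else 0)"
    by (intro sum.cong) auto
  then show ?case
    using V by (simp add: sum_words_Suc)
next
  case (Suc l)
  have "(\<Sum>w\<in>words V (Suc (Suc l)). count (mset w) v * G (mset w)) =
    (\<Sum>u\<in>V. \<Sum>w\<in>words V (Suc l). (of_bool (u = v) + real (count (mset w) v)) * G (add_mset u (mset w)))"
    using V by (subst sum_words_Suc) (auto intro!: sum.cong)
  also have "\<dots> = (\<Sum>u\<in>V. of_bool (u = v) * (\<Sum>w\<in>words V (Suc l). G (add_mset u (mset w)))) +
      (\<Sum>u\<in>V. \<Sum>w\<in>words V (Suc l). count (mset w) v * G (add_mset u (mset w)))"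
    by (simp only: distrib_right sum.distrib sum_distrib_left)
  also have "(\<Sum>u\<in>V. of_bool (u = v) * (\<Sum>w\<in>words V (Suc l). G (add_mset u (mset w)))) =
      (\<Sum>w\<in>words V (Suc l). G (add_mset v (mset w)))"
    using V by (subst sum.mono_neutral_right[of V "{v}"]) auto
  also have "(\<Sum>u\<in>V. \<Sum>w\<in>words V (Suc l). count (mset w) v * G (add_mset u (mset w))) =
      Suc l * (\<Sum>u\<in>V. \<Sum>w\<in>words V l. G (add_mset u (add_mset v (mset w))))"
    by (simp only: Suc.IH[of "\<lambda>M. G (add_mset _ M)"] sum_distrib_left)
  also have "(\<Sum>u\<in>V. \<Sum>w\<in>words V l. G (add_mset u (add_mset v (mset w)))) =
      (\<Sum>w\<in>words V (Suc l). G (add_mset v (mset w)))"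
    using V by (subst sum_words_Suc) (auto simp: add_mset_commute)
  finally show ?case by (simp add: algebra_simps)
qed

definition core_count :: "'v set \<Rightarrow> nat \<Rightarrow> nat \<Rightarrow> nat \<Rightarrow> 'e set \<Rightarrow> 'v multiset \<Rightarrow> nat" where
  "core_count V d k q E D = card {f \<in> configs V d E. total_mset E f = D \<and> core_size V k E f = q}"

text \<open>Double counting of pairs of a configuration and one of its points at the light vertex
  \<open>v\<close>. The point sits in some hyperedge \<open>e\<close> at one of \<open>Suc l\<close>
  positions, the other letters of \<open>e\<close> form the word \<open>w\<close>, and deleting
  \<open>e\<close> leaves the core as it was.\<close>

lemma core_count_remove_le:
  fixes E :: "'e set" and V :: "'v set"
  assumes fin: "finite E" "finite V" and v: "v \<in># D" "count D v < k" "v \<in> V"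
  shows "count D v * real (core_count V (Suc l) k q E D) \<le>
    (\<Sum>e\<in>E. Suc l * (\<Sum>w | w \<in> words V l \<and> mset w \<subseteq># D - {#v#}.
       real (core_count V (Suc l) k q (E - {e}) (D - {#v#} - mset w))))"
proof -
  define S where "S = {f \<in> configs V (Suc l) E. total_mset E f = D \<and> core_size V k E f = q}"
  define G where "G = (\<lambda>e M. if M \<subseteq># D then real (core_count V (Suc l) k q (E - {e}) (D - M)) else 0)"
  have finS: "finite S" unfolding S_def using fin by auto
  \<comment> \<open>For a fixed word at \<open>e\<close>, restriction to the other hyperedges is
    injective. The weight annihilates the words that avoid \<open>v\<close>, for which
    \<open>e\<close> might belong to the core.\<close>
  have fib: "real (count (mset w) v) * real (card {f \<in> S. f e = w}) \<le> real (count (mset w) v) * G e (mset w)"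
    if e: "e \<in> E" and w: "w \<in> words V (Suc l)" for e w
  proof (cases "v \<in> set w")
    case True
    have tot: "total_mset E f = mset (f e) + total_mset (E - {e}) f" for f :: "'e \<Rightarrow> 'v list"
      unfolding total_mset_def using e fin by (simp add: sum.remove)
    have "card {f \<in> S. f e = w} \<le> G e (mset w)"
    proof (cases "mset w \<subseteq># D")
      case sub: True
      let ?r = "\<lambda>f :: 'e \<Rightarrow> 'v list. restrict f (E - {e})"
      have "card {f \<in> S. f e = w} \<le> core_count V (Suc l) k q (E - {e}) (D - mset w)"
        unfolding core_count_def
      proof (rule card_inj_on_le[of ?r])
        show "inj_on ?r {f \<in> S. f e = w}"
        proof
          fix f g assume fg: "f \<in> {f \<in> S. f e = w}" "g \<in> {f \<in> S. f e = w}" and eq: "?r f = ?r g"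
          show "f = g"
          proof (rule PiE_ext[of f E "\<lambda>_. words V (Suc l)" g])
            fix x assume "x \<in> E"
            then show "f x = g x" using fg fun_cong[OF eq, of x] by (cases "x = e") auto
          qed (use fg in \<open>auto simp: S_def\<close>)
        qed
        show "?r ` {f \<in> S. f e = w} \<subseteq> {f \<in> configs V (Suc l) (E - {e}).
            total_mset (E - {e}) f = D - mset w \<and> core_size V k (E - {e}) f = q}"
        proof (rule image_subsetI)
          fix f assume f: "f \<in> {f \<in> S. f e = w}"
          have "total_mset (E - {e}) (?r f) = total_mset (E - {e}) f"
            unfolding total_mset_def by (intro sum.cong) auto
          also have "\<dots> = D - mset w"
            using f tot[of f] by (auto simp: S_def)
          finally have 1: "total_mset (E - {e}) (?r f) = D - mset w" .
          have "core_size V k (E - {e}) (?r f) = core_size V k (E - {e}) f"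
            by (intro core_size_cong) auto
          also have "\<dots> = core_size V k E f"
            using f True v by (intro core_size_remove fin e) (auto simp: S_def)
          finally have 2: "core_size V k (E - {e}) (?r f) = q"
            using f by (simp add: S_def)
          show "?r f \<in> {f \<in> configs V (Suc l) (E - {e}).
            total_mset (E - {e}) f = D - mset w \<and> core_size V k (E - {e}) f = q}"
            using 1 2 f by (auto simp: S_def PiE_def Pi_def)
        qed
      qed (use fin in auto)
      then show ?thesis using sub by (simp add: G_def)
    next
      case False
      then have "{f \<in> S. f e = w} = {}"
        using tot by (auto simp: S_def)
      with False show ?thesis
        unfolding G_def by (simp only: card.empty if_False of_nat_0 order_refl)
    qed
    then show ?thesis by (intro mult_left_mono) auto
  next
    case False
    then have 0: "count (mset w) v = 0" by simp
    show ?thesis unfolding 0 by simp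
  qed
  have "count D v * real (core_count V (Suc l) k q E D) = (\<Sum>f\<in>S. real (count (total_mset E f) v))"
  proof -
    have "(\<Sum>f\<in>S. real (count (total_mset E f) v)) = (\<Sum>f\<in>S. real (count D v))"
      by (intro sum.cong) (auto simp: S_def)
    then show ?thesis by (simp add: core_count_def S_def)
  qed
  also have "\<dots> = (\<Sum>e\<in>E. \<Sum>f\<in>S. real (count (mset (f e)) v))"
    by (subst sum.swap) (simp add: count_total_mset)
  also have "\<dots> = (\<Sum>e\<in>E. \<Sum>w\<in>words V (Suc l). real (count (mset w) v) * real (card {f \<in> S. f e = w}))"
  proof (intro sum.cong refl)
    fix e assume e: "e \<in> E"
    have "(\<Sum>f\<in>S. real (count (mset (f e)) v)) =
        (\<Sum>w\<in>words V (Suc l). \<Sum>f | f \<in> S \<and> f e = w. real (count (mset (f e)) v))"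
      using e fin finS by (subst sum.group) (auto simp: S_def)
    also have "\<dots> = (\<Sum>w\<in>words V (Suc l). real (count (mset w) v) * real (card {f \<in> S. f e = w}))"
      by (intro sum.cong refl) simp
    finally show "(\<Sum>f\<in>S. real (count (mset (f e)) v)) = \<dots>" .
  qed
  also have "\<dots> \<le> (\<Sum>e\<in>E. \<Sum>w\<in>words V (Suc l). real (count (mset w) v) * G e (mset w))"
    by (intro sum_mono fib)
  also have "\<dots> = (\<Sum>e\<in>E. Suc l * (\<Sum>w\<in>words V l. G e (add_mset v (mset w))))"
    using fin v by (simp only: sum_words_count_mult)
  also have "\<dots> = (\<Sum>e\<in>E. Suc l * (\<Sum>w | w \<in> words V l \<and> mset w \<subseteq># D - {#v#}.
       real (core_count V (Suc l) k q (E - {e}) (D - {#v#} - mset w))))"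
  proof -
    have iff: "add_mset v M \<subseteq># D \<longleftrightarrow> M \<subseteq># D - {#v#}" for M
      using v(1) by (metis insert_DiffM mset_subset_eq_add_mset_cancel)
    have diff: "D - add_mset v (mset w) = D - {#v#} - mset w" for w
      by (metis add_mset_add_single diff_diff_add_mset add.commute)
    have "(\<Sum>w\<in>words V l. G e (add_mset v (mset w))) = (\<Sum>w | w \<in> words V l \<and> mset w \<subseteq># D - {#v#}.
       real (core_count V (Suc l) k q (E - {e}) (D - {#v#} - mset w)))" for e
      unfolding G_def iff diff using fin(2) by (subst sum.inter_filter[symmetric]) (auto intro!: sum.cong)
    then show ?thesis by simp
  qed
  finally show ?thesis .
qed

text \<open>
  The number of points at a heavy vertex, truncated at \<open>J\<close> to have bounded increments.
\<close>

definition heavy :: "nat \<Rightarrow> nat \<Rightarrow> nat \<Rightarrow> real" where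
  "heavy k J j = (if k \<le> j then real (min j J) else 0)"

lemma heavy_nonneg [simp]: "0 \<le> heavy k J j" and heavy_le_J: "heavy k J j \<le> J"
  and heavy_le: "heavy k J j \<le> real j * of_bool (k \<le> j)"
  and heavy_small: "j < k \<Longrightarrow> heavy k J j = 0"
  by (auto simp: heavy_def)

text \<open>Removing one hyperedge at a light vertex deletes \<open>d - 1\<close> uniformly random points out of
  \<open>d r - 1\<close>, so a point at a heavy vertex survives with probability \<open>(d r - d) / (d r - 1)\<close>.\<close>

definition survival :: "nat \<Rightarrow> nat \<Rightarrow> nat \<Rightarrow> real" where
  "survival d t r = (\<Prod>i\<in>{t<..r}. real (d * i - d) / real (d * i - 1))"

lemma survival_refl [simp]: "survival d t t = 1"
  by (simp add: survival_def)

lemma survival_Suc: "t \<le> r \<Longrightarrow> survival d t (Suc r) = survival d t r * real (d * r) / real (d * Suc r - 1)"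
proof -
  assume "t \<le> r"
  then have "{t<..Suc r} = insert (Suc r) {t<..r}" by auto
  then show ?thesis by (simp add: survival_def)
qed

lemma survival_bounds:
  assumes "1 \<le> d"
  shows "0 \<le> survival d t r" "survival d t r \<le> 1"
proof -
  have *: "0 \<le> real (d * i - d) / real (d * i - 1) \<and> real (d * i - d) / real (d * i - 1) \<le> 1" for i
    using assms by (auto simp: divide_le_eq_1)
  show "0 \<le> survival d t r"
    unfolding survival_def by (intro prod_nonneg ballI) (rule *[THEN conjunct1])
  show "survival d t r \<le> 1"
    unfolding survival_def by (intro prod_le_1) (rule *)
qed

text \<open>
  Here \<open>t\<close> is the number of hyperedges at which peeling is observed: for the lower threshold
  \<open>q = 0 < t\<close> and \<open>\<theta> < 0\<close>, for the upper one \<open>q = t\<close> and \<open>\<theta> > 0\<close>.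
\<close>

lemma core_count_le:
  fixes E :: "'e set" and V :: "'v set" and t l J :: nat and \<theta> A \<kappa> s0 \<eta> :: real
  defines "s0 \<equiv> real (Suc l * t)"
  defines "\<eta> \<equiv> \<bar>\<theta>\<bar> * J * A / s0\<^sup>2 + (\<theta> * J)\<^sup>2"
  assumes fin: "finite E" "finite V" and t: "1 \<le> t" "q \<le> t" "t \<le> card E" and k: "1 \<le> k"
    and D: "set_mset D \<subseteq> V" "square_sum V D \<le> A" and \<theta>: "\<bar>\<theta>\<bar> * J \<le> 1"
    and base: "\<And>F f. F \<subseteq> E \<Longrightarrow> card F = t \<Longrightarrow> f \<in> configs V (Suc l) F \<Longrightarrow> core_size V k F f = q \<Longrightarrow>
       square_sum V (total_mset F f) \<le> A \<Longrightarrow> 0 \<le> \<theta> * (thin_total V (heavy k J) 1 (total_mset F f) - \<kappa>)"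
  shows "core_count V (Suc l) k q E D \<le> arrangements D *
     exp (\<theta> * (thin_total V (heavy k J) (survival (Suc l) t (card E)) D - \<kappa>) + (card E - t) * (Suc l * \<eta>))"
  using fin(1) t(3) D base
proof (induction "card E - t" arbitrary: E D)
  case 0
  then have cE: "card E = t" by simp
  show ?case
  proof (cases "core_count V (Suc l) k q E D = 0")
    case False
    then obtain f where f: "f \<in> configs V (Suc l) E" "total_mset E f = D" "core_size V k E f = q"
      unfolding core_count_def by (metis (mono_tags, lifting) Collect_empty_eq card.empty)
    have "0 \<le> \<theta> * (thin_total V (heavy k J) 1 D - \<kappa>)"
      using 0(6)[of E f] f cE 0(5) by simp
    have "core_count V (Suc l) k q E D \<le> card {f \<in> configs V (Suc l) E. total_mset E f = D}"
      unfolding core_count_def using 0(2) fin(2) by (intro card_mono) auto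
    then have "core_count V (Suc l) k q E D \<le> card (permutations_of_multiset D)"
      using card_configs_total_le[OF 0(2) fin(2), of "Suc l" D] by linarith
    then have "real (core_count V (Suc l) k q E D) \<le> arrangements D * 1" by simp
    also have "\<dots> \<le> arrangements D * exp (\<theta> * (thin_total V (heavy k J) 1 D - \<kappa>))"
      using \<open>0 \<le> \<theta> * _\<close> by (intro mult_left_mono) auto
    finally show ?thesis using cE by simp
  qed auto
next
  case (Suc x)
  show ?case
  proof (cases "core_count V (Suc l) k q E D = 0")
    case False
    define r where "r = card E - 1"
    have r: "card E = Suc r" "t \<le> r" "x = r - t" using Suc(2,4) by (auto simp: r_def)
    obtain f where f: "f \<in> configs V (Suc l) E" "total_mset E f = D" "core_size V k E f = q"
      using False unfolding core_count_def by (metis (mono_tags, lifting) Collect_empty_eq card.empty)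
    \<comment> \<open>Since \<open>q \<le> t < card E\<close>, the core does not contain every
      hyperedge, so some vertex of \<open>D\<close> is light.\<close>
    obtain v where v: "v \<in># D" "count D v < k"
      using core_size_full[OF Suc(3) fin(2) f(1), of k] f r t by fastforce
    have vV: "v \<in> V" using v Suc by auto
    have sD: "size D = Suc l * Suc r" using size_total_mset[OF f(1)] f r by simp
    define \<tau> where "\<tau> = survival (Suc l) t r"
    have \<tau>: "0 \<le> \<tau>" "\<tau> \<le> 1" using survival_bounds[of "Suc l" t r] by (auto simp: \<tau>_def)
    define D' where "D' = D - {#v#}"
    have D': "set_mset D' \<subseteq> V" "square_sum V D' \<le> A"
      using Suc.prems(3,4) square_sum_mono[of D' D V] unfolding D'_def by (auto dest: in_diffD)
    have sD': "size D' = Suc l * r + l" using v sD by (simp add: D'_def size_Diff_singleton)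
    let ?H = "heavy k J"
    have "count D v * real (core_count V (Suc l) k q E D) \<le>
      (\<Sum>e\<in>E. Suc l * (\<Sum>w | w \<in> words V l \<and> mset w \<subseteq># D'. real (core_count V (Suc l) k q (E - {e}) (D' - mset w))))"
      unfolding D'_def by (intro core_count_remove_le Suc.prems(1) fin v vV)
    also have "\<dots> \<le> (\<Sum>e\<in>E. Suc l * (\<Sum>w | w \<in> words V l \<and> mset w \<subseteq># D'.
       arrangements (D' - mset w) * exp (\<theta> * (thin_total V ?H \<tau> (D' - mset w) - \<kappa>) + (r - t) * (Suc l * \<eta>))))"
    proof (intro sum_mono mult_left_mono)
      fix e w assume e: "e \<in> E" and w: "w \<in> {w. w \<in> words V l \<and> mset w \<subseteq># D'}"
      have c: "card (E - {e}) = r" using e r Suc.prems(1) by simp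
      show "real (core_count V (Suc l) k q (E - {e}) (D' - mset w)) \<le> arrangements (D' - mset w) *
        exp (\<theta> * (thin_total V ?H \<tau> (D' - mset w) - \<kappa>) + (r - t) * (Suc l * \<eta>))"
        unfolding \<tau>_def c[symmetric]
      proof (rule Suc.hyps(1))
        show "square_sum V (D' - mset w) \<le> A"
          using D'(2) square_sum_mono[of "D' - mset w" D' V] by simp
        show "set_mset (D' - mset w) \<subseteq> V" using D'(1) by (auto dest: in_diffD)
        show "0 \<le> \<theta> * (thin_total V (heavy k J) 1 (total_mset F f) - \<kappa>)"
          if "F \<subseteq> E - {e}" "card F = t" "f \<in> configs V (Suc l) F" "core_size V k F f = q"
             "square_sum V (total_mset F f) \<le> A" for F f
          using that by (intro Suc.prems(5)) auto
      qed (use c r Suc.prems(1) in auto)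
    qed auto
    also have "\<dots> = Suc r * Suc l * (exp ((r - t) * (Suc l * \<eta>) - \<theta> * \<kappa>) * (\<Sum>w | w \<in> words V l \<and> mset w \<subseteq># D'.
       arrangements (D' - mset w) * exp (\<theta> * thin_total V ?H \<tau> (D' - mset w))))"
    proof -
      have "exp (\<theta> * (T - \<kappa>) + X) = exp (X - \<theta> * \<kappa>) * exp (\<theta> * T)" for T X
        by (simp add: algebra_simps flip: exp_add)
      then show ?thesis
        unfolding sum_distrib_left sum_constant r
        by (intro sum.cong refl) (simp only: of_nat_mult mult_ac)
    qed
    also have "\<dots> \<le> Suc r * Suc l * (exp ((r - t) * (Suc l * \<eta>) - \<theta> * \<kappa>) *
       (arrangements D' * exp (\<theta> * thin_total V ?H (\<tau> * real (size D' - l) / real (size D')) D' + l * \<eta>)))"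
    proof (intro mult_left_mono)
      have "real (Suc l * t) \<le> real (Suc l * r)" using r by (intro of_nat_mono mult_le_mono) auto
      then show "(\<Sum>w | w \<in> words V l \<and> mset w \<subseteq># D'. arrangements (D' - mset w) * exp (\<theta> * thin_total V ?H \<tau> (D' - mset w)))
        \<le> arrangements D' * exp (\<theta> * thin_total V ?H (\<tau> * real (size D' - l) / real (size D')) D' + l * \<eta>)"
        unfolding \<eta>_def using fin D' \<tau> \<theta> t heavy_le_J sD'
        by (intro sum_remove_word_le) (auto simp: s0_def add_pos_nonneg)
    qed auto
    also have "\<tau> * real (size D' - l) / real (size D') = survival (Suc l) t (Suc r)"
      using r by (simp add: survival_Suc \<tau>_def sD')
    \<comment> \<open>The point removed at \<open>v\<close> does not matter: a light vertex
      contributes \<open>0\<close> before and after.\<close>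
    also have "thin_total V ?H (survival (Suc l) t (Suc r)) D' = thin_total V ?H (survival (Suc l) t (Suc r)) D"
      unfolding thin_total_def
    proof (intro sum.cong refl)
      fix u assume "u \<in> V"
      show "thin (count D' u) (survival (Suc l) t (Suc r)) ?H = thin (count D u) (survival (Suc l) t (Suc r)) ?H"
      proof (cases "u = v")
        case True
        have "thin j p ?H = 0" if "j < k" for j p
          using that by (intro thin_eq_0 heavy_small) auto
        then show ?thesis using True v by (simp add: D'_def)
      qed (simp add: D'_def)
    qed
    also have "Suc r * Suc l * (exp ((r - t) * (Suc l * \<eta>) - \<theta> * \<kappa>) *
       (arrangements D' * exp (\<theta> * thin_total V ?H (survival (Suc l) t (Suc r)) D + l * \<eta>)))
      = (real (Suc r * Suc l) * arrangements D') *
        exp (\<theta> * (thin_total V ?H (survival (Suc l) t (Suc r)) D - \<kappa>) + ((r - t) * (Suc l * \<eta>) + l * \<eta>))"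
      by (simp add: algebra_simps flip: exp_add)
    \<comment> \<open>The factor is the size of \<open>D\<close>, so the product is the number of
      arrangements of \<open>D\<close> times the multiplicity of \<open>v\<close>, which cancels
      against the left-hand side.\<close>
    also have "real (Suc r * Suc l) * arrangements D' = count D v * arrangements D"
      unfolding D'_def using real_card_permutations_of_multiset_remove[OF v(1)]
      by (simp add: sD field_simps del: of_nat_Suc)
    finally have "real (count D v) * real (core_count V (Suc l) k q E D) \<le> real (count D v) * (arrangements D *
        exp (\<theta> * (thin_total V ?H (survival (Suc l) t (Suc r)) D - \<kappa>) + ((r - t) * (Suc l * \<eta>) + l * \<eta>)))"
      by (simp add: mult_ac)
    then have "real (core_count V (Suc l) k q E D) \<le> arrangements D *
        exp (\<theta> * (thin_total V ?H (survival (Suc l) t (Suc r)) D - \<kappa>) + ((r - t) * (Suc l * \<eta>) + l * \<eta>))"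
      using v(1) by (simp add: count_greater_zero_iff[symmetric] del: count_greater_zero_iff)
    also have "\<dots> \<le> arrangements D *
        exp (\<theta> * (thin_total V ?H (survival (Suc l) t (Suc r)) D - \<kappa>) + (Suc r - t) * (Suc l * \<eta>))"
    proof -
      have A: "0 \<le> A" using order.trans[OF _ Suc.prems(4)] by (simp add: square_sum_def sum_nonneg)
      have "0 \<le> \<eta>" using A by (simp add: \<eta>_def)
      then show ?thesis
        using r by (intro mult_left_mono) (auto simp: Suc_diff_le algebra_simps)
    qed
    finally show ?thesis by (simp add: r(1))
  qed auto
qed

section \<open>From given degrees to uniform configurations\<close>

lemma total_mset_in_words:
  assumes fin: "finite E" "finite V" and f: "f \<in> configs V d E"
  shows "total_mset E f \<in> mset ` words V (d * card E)"
proof -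
  obtain w where w: "mset w = total_mset E f" using ex_mset by blast
  have "set_mset (total_mset E f) \<subseteq> V"
    using f fin by (auto simp: set_total_mset words_def PiE_def Pi_def)
  then have "w \<in> words V (d * card E)"
    using w size_total_mset[OF f] by (auto simp: words_def simp flip: set_mset_mset size_mset)
  with w show ?thesis by (metis imageI)
qed

lemma arrangements_le_card_words:
  assumes "finite V" "D \<in> mset ` words V N"
  shows "arrangements D \<le> card {w \<in> words V N. mset w = D}"
proof -
  have "permutations_of_multiset D \<subseteq> {w \<in> words V N. mset w = D}"
    using assms(2)
    by (auto simp: words_def permutations_of_multiset_def dest: mset_eq_setD mset_eq_length)
  then show ?thesis using assms(1) by (intro of_nat_mono card_mono) auto
qed

text \<open>The degrees of a uniform configuration are the letter counts of one long uniform
  word.\<close>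

lemma sum_configs_le:
  fixes G :: "'v multiset \<Rightarrow> real"
  assumes fin: "finite E" "finite V" and G: "\<And>D. 0 \<le> G D"
  shows "(\<Sum>f\<in>configs V d E. G (total_mset E f)) \<le> (\<Sum>w\<in>words V (d * card E). G (mset w))"
proof -
  let ?W = "words V (d * card E)"
  note img = total_mset_in_words[OF fin]
  have "(\<Sum>f\<in>configs V d E. G (total_mset E f)) =
      (\<Sum>D\<in>mset ` ?W. \<Sum>f | f \<in> configs V d E \<and> total_mset E f = D. G (total_mset E f))"
    using fin img by (subst sum.group) auto
  also have "\<dots> = (\<Sum>D\<in>mset ` ?W. card {f \<in> configs V d E. total_mset E f = D} * G D)"
    by (intro sum.cong refl) simp
  also have "\<dots> \<le> (\<Sum>D\<in>mset ` ?W. card {w \<in> ?W. mset w = D} * G D)"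
  proof (intro sum_mono mult_right_mono G)
    fix D assume D: "D \<in> mset ` ?W"
    show "real (card {f \<in> configs V d E. total_mset E f = D}) \<le> real (card {w \<in> ?W. mset w = D})"
      using card_configs_total_le[OF fin, of d D] arrangements_le_card_words[OF fin(2) D] by linarith
  qed
  also have "\<dots> = (\<Sum>D\<in>mset ` ?W. \<Sum>w | w \<in> ?W \<and> mset w = D. G (mset w))"
    by (intro sum.cong refl) simp
  also have "\<dots> = (\<Sum>w\<in>?W. G (mset w))"
    using fin by (subst sum.group) auto
  finally show ?thesis .
qed

text \<open>Markov's inequality for the sum of squared degrees, each degree being binomial with
  parameters \<open>N\<close> and \<open>1 / n\<close>.\<close>

lemma card_square_sum_gt:
  fixes V :: "'v set"
  assumes fin: "finite E" "finite V" and n: "n = card V" "0 < n" and A: "0 < A" and N: "N = d * card E"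
  shows "card {f \<in> configs V d E. A < square_sum V (total_mset E f)} \<le>
    real n ^ N * (n * ((N / n)\<^sup>2 + N / n) / A)"
proof -
  have "A * card {f \<in> configs V d E. A < square_sum V (total_mset E f)} =
      (\<Sum>f | f \<in> configs V d E \<and> A < square_sum V (total_mset E f). A)"
    by simp
  also have "\<dots> \<le> (\<Sum>f | f \<in> configs V d E \<and> A < square_sum V (total_mset E f). square_sum V (total_mset E f))"
    by (intro sum_mono) auto
  also have "\<dots> \<le> (\<Sum>f\<in>configs V d E. square_sum V (total_mset E f))"
    using fin by (intro sum_mono2) (auto simp: square_sum_def intro!: sum_nonneg)
  also have "\<dots> \<le> (\<Sum>w\<in>words V N. square_sum V (mset w))"
    unfolding N by (intro sum_configs_le fin) (auto simp: square_sum_def intro!: sum_nonneg)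
  also have "\<dots> = (\<Sum>v\<in>V. \<Sum>w\<in>words V N. (real (count (mset w) v))\<^sup>2)"
    unfolding square_sum_def by (rule sum.swap)
  also have "\<dots> = (\<Sum>v\<in>V. n ^ N * ((N / n)\<^sup>2 + N / n * (1 - 1 / n)))"
  proof (intro sum.cong refl)
    fix v assume "v \<in> V"
    then show "(\<Sum>w\<in>words V N. (real (count (mset w) v))\<^sup>2) = n ^ N * ((N / n)\<^sup>2 + N / n * (1 - 1 / n))"
      using sum_words_count[OF fin(2), of v "\<lambda>i. (real i)\<^sup>2" 0 N] thin_square[of N "1 / n" 0] n by simp
  qed
  also have "\<dots> \<le> n * (real n ^ N * ((N / n)\<^sup>2 + N / n))"
  proof -
    have "N / n * (1 - 1 / n) \<le> N / n * 1" using n by (intro mult_left_mono) auto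
    then show ?thesis using n by (simp add: mult_left_mono)
  qed
  finally show ?thesis
    using A by (simp only: times_divide_eq_right pos_le_divide_eq mult_ac)
qed

text \<open>Averages the bound for fixed degrees over uniform words. Degrees are then binomial and
  thinnings compose, so a single binomial law with parameter \<open>survival / n\<close> governs the
  points that a vertex retains.\<close>

lemma card_core_size_le:
  fixes E :: "'e set" and V :: "'v set" and t l J n N :: nat and \<theta> A \<kappa> s0 \<eta> :: real
  defines "s0 \<equiv> real (Suc l * t)"
  defines "\<eta> \<equiv> \<bar>\<theta>\<bar> * J * A / s0\<^sup>2 + (\<theta> * J)\<^sup>2"
  assumes n: "n = card V" "0 < n" and N: "N = Suc l * card E"
  assumes fin: "finite E" "finite V" and t: "1 \<le> t" "q \<le> t" "t \<le> card E" and k: "1 \<le> k"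
    and \<theta>: "\<bar>\<theta>\<bar> * J \<le> 1"
    and base: "\<And>F f. F \<subseteq> E \<Longrightarrow> card F = t \<Longrightarrow> f \<in> configs V (Suc l) F \<Longrightarrow> core_size V k F f = q \<Longrightarrow>
       square_sum V (total_mset F f) \<le> A \<Longrightarrow> 0 \<le> \<theta> * (thin_total V (heavy k J) 1 (total_mset F f) - \<kappa>)"
  shows "card {f \<in> configs V (Suc l) E. core_size V k E f = q \<and> square_sum V (total_mset E f) \<le> A} \<le>
    real n ^ N * exp (\<theta> * (n * thin N (survival (Suc l) t (card E) / n) (heavy k J) - \<kappa>) +
      (card E - t) * (Suc l * \<eta>) + N * (\<theta> * J)\<^sup>2)"
proof -
  let ?W = "words V N" and ?\<tau> = "survival (Suc l) t (card E)"
  let ?S = "{f \<in> configs V (Suc l) E. core_size V k E f = q \<and> square_sum V (total_mset E f) \<le> A}"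
  define X where "X = (card E - t) * (Suc l * \<eta>) - \<theta> * \<kappa>"
  note img = total_mset_in_words[OF fin, of _ "Suc l", folded N]
  have \<tau>: "0 \<le> ?\<tau>" "?\<tau> \<le> 1" using survival_bounds[of "Suc l"] by auto
  have "real (card ?S) = (\<Sum>D\<in>mset ` ?W. \<Sum>f | f \<in> ?S \<and> total_mset E f = D. 1)"
    using fin img by (subst sum.group) auto
  also have "\<dots> = (\<Sum>D\<in>mset ` ?W. real (card {f. f \<in> ?S \<and> total_mset E f = D}))"
    by simp
  also have "\<dots> \<le> (\<Sum>D\<in>mset ` ?W. card {w \<in> ?W. mset w = D} * exp (\<theta> * thin_total V (heavy k J) ?\<tau> D + X))"
  proof (intro sum_mono)
    fix D assume D: "D \<in> mset ` ?W"
    show "real (card {f. f \<in> ?S \<and> total_mset E f = D}) \<le>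
      card {w \<in> ?W. mset w = D} * exp (\<theta> * thin_total V (heavy k J) ?\<tau> D + X)"
    proof (cases "square_sum V D \<le> A")
      case True
      have "{f. f \<in> ?S \<and> total_mset E f = D} = {f \<in> configs V (Suc l) E. total_mset E f = D \<and> core_size V k E f = q}"
        using True by auto
      then have "real (card {f. f \<in> ?S \<and> total_mset E f = D}) = core_count V (Suc l) k q E D"
        by (simp add: core_count_def)
      also have "\<dots> \<le> arrangements D * exp (\<theta> * (thin_total V (heavy k J) ?\<tau> D - \<kappa>) + (card E - t) * (Suc l * \<eta>))"
        unfolding \<eta>_def s0_def
        using D True by (intro core_count_le fin t k \<theta> base) (auto simp: words_def)
      also have "\<theta> * (thin_total V (heavy k J) ?\<tau> D - \<kappa>) + (card E - t) * (Suc l * \<eta>) =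
          \<theta> * thin_total V (heavy k J) ?\<tau> D + X"
        by (simp add: X_def algebra_simps)
      also have "arrangements D * exp (\<theta> * thin_total V (heavy k J) ?\<tau> D + X)
          \<le> card {w \<in> ?W. mset w = D} * exp (\<theta> * thin_total V (heavy k J) ?\<tau> D + X)"
        by (intro mult_right_mono arrangements_le_card_words fin D) auto
      finally show ?thesis .
    next
      case False
      then have "{f. f \<in> ?S \<and> total_mset E f = D} = {}" by auto
      then show ?thesis by (simp only: card.empty) simp
    qed
  qed
  also have "\<dots> = (\<Sum>D\<in>mset ` ?W. \<Sum>w | w \<in> ?W \<and> mset w = D. exp (\<theta> * thin_total V (heavy k J) ?\<tau> (mset w) + X))"
    by (intro sum.cong refl) simp
  also have "\<dots> = (\<Sum>w\<in>?W. exp (\<theta> * thin_total V (heavy k J) ?\<tau> (mset w) + X))"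
    using fin by (subst sum.group) auto
  also have "\<dots> = exp X * (\<Sum>w\<in>?W. exp (\<theta> * (\<Sum>v\<in>V. thin (0 + count (mset w) v) ?\<tau> (heavy k J))))"
    by (simp add: exp_add sum_distrib_left thin_total_def mult_ac)
  also have "\<dots> \<le> exp X * (card V ^ N * exp (\<theta> * (\<Sum>v\<in>V. thin N (1 / card V) (\<lambda>i. thin (0 + i) ?\<tau> (heavy k J))) + N * (\<theta> * J)\<^sup>2))"
    using n \<theta> \<tau> by (intro mult_left_mono sum_words_exp_le fin) (auto intro!: thin_nonneg thin_le heavy_le_J)
  also have "\<dots> = real n ^ N * exp (\<theta> * (n * thin N (?\<tau> / n) (heavy k J) - \<kappa>) +
      (card E - t) * (Suc l * \<eta>) + N * (\<theta> * J)\<^sup>2)"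
    by (simp add: n(1) thin_thin X_def algebra_simps flip: exp_add)
  finally show ?thesis .
qed

section \<open>Size of the survival probability, and heavy points after truncation\<close>

text \<open>Divide the right-hand side by \<open>(1 + y / l) ^ Suc l\<close> and apply Bernoulli's
  inequality. The monotonicity compares the factors of \<open>survival\<close> with powers of
  \<open>r / (r + 1)\<close>.\<close>

lemma compound_power_mono:
  fixes y :: real
  assumes "1 \<le> l" "- real l < y"
  shows "(1 + y / l) ^ l \<le> (1 + y / Suc l) ^ Suc l"
proof -
  define b where "b = 1 + y / l"
  have b: "0 < b" using assms by (simp add: b_def field_simps)
  have ly: "0 < l + y" using assms by simp
  have "1 / b = 1 + Suc l * ((1 + y / Suc l) / b - 1)"
  proof -
    define L where "L = real l"
    have L: "0 < L" "0 < L + y" using assms ly by (auto simp: L_def)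
    have b': "b = (L + y) / L" using L by (simp add: b_def L_def field_simps)
    have "1 + (L + 1) * ((1 + y / (L + 1)) / b - 1) = 1 + ((L + 1 + y) / b - (L + 1))"
      using L by (simp add: right_diff_distrib add_divide_distrib distrib_left)
    also have "\<dots> = ((L + 1 + y) - L * b) / b"
      using b by (simp add: field_simps)
    also have "(L + 1 + y) - L * b = 1"
      using L by (simp add: b')
    finally show ?thesis by (simp add: L_def add.commute)
  qed
  also have "\<dots> \<le> (1 + ((1 + y / Suc l) / b - 1)) ^ Suc l"
  proof (rule Bernoulli_inequality)
    have "0 \<le> 1 + y / Suc l" using assms by (simp add: field_simps)
    then show "- 1 \<le> (1 + y / Suc l) / b - 1" using b by simp
  qed
  finally have "1 / b \<le> (1 + y / Suc l) ^ Suc l / b ^ Suc l"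
    by (simp add: power_divide del: power_Suc)
  then have "1 / b * b ^ Suc l \<le> (1 + y / Suc l) ^ Suc l / b ^ Suc l * b ^ Suc l"
    using b by (intro mult_right_mono) auto
  moreover have "1 / b * b ^ Suc l = b ^ l" "(1 + y / Suc l) ^ Suc l / b ^ Suc l * b ^ Suc l = (1 + y / Suc l) ^ Suc l"
    using b by auto
  ultimately show ?thesis
    unfolding b_def by linarith
qed

text \<open>With \<open>d = Suc l\<close>, the factor that leads from \<open>r\<close> to
  \<open>r + 1\<close> is \<open>1 / (1 + l / (d * r))\<close>. Its \<open>d\<close>-th power is at
  most \<open>(r / (r + 1)) ^ l\<close>, and these bounds telescope. Together with the reverse bound
  below, \<open>survival\<close> behaves like \<open>(t / r) powr ((d - 1) / d)\<close>.\<close>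

lemma survival_power_le:
  assumes "1 \<le> l" "1 \<le> t" "t \<le> r"
  shows "survival (Suc l) t r ^ Suc l \<le> (t / r) ^ l"
  using assms(3)
proof (induction r rule: dec_induct)
  case base
  show ?case using assms by simp
next
  case (step r)
  define z where "z = 1 / real r"
  have r: "1 \<le> r" using step assms by simp
  have z: "0 < z" using r by (simp add: z_def)
  have fac: "real (Suc l * r) / real (Suc l * Suc r - 1) = 1 / (1 + (l * z) / Suc l)"
  proof -
    have "real (Suc l * Suc r - 1) = real (Suc l) * r + l" by (simp add: algebra_simps)
    moreover have "1 + (l * z) / Suc l = (real (Suc l) * r + l) / (real (Suc l) * r)"
      using r by (simp add: z_def add_divide_distrib del: of_nat_Suc)
    ultimately show ?thesis by (simp del: mult_Suc)
  qed
  have "(1 + z) ^ l = (1 + (l * z) / l) ^ l" using assms by simp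
  also have "\<dots> \<le> (1 + (l * z) / Suc l) ^ Suc l"
    using assms z by (intro compound_power_mono) (auto intro: less_le_trans[of _ 0])
  finally have le: "(1 + z) ^ l \<le> (1 + (l * z) / Suc l) ^ Suc l" .
  have "survival (Suc l) t (Suc r) ^ Suc l = survival (Suc l) t r ^ Suc l * (1 / (1 + (l * z) / Suc l) ^ Suc l)"
    unfolding survival_Suc[OF step(1)] times_divide_eq_right[symmetric] fac power_mult_distrib
    by (simp add: power_divide del: power_Suc)
  also have "\<dots> \<le> (t / r) ^ l * (1 / (1 + z) ^ l)"
  proof (intro mult_mono step.IH divide_left_mono le)
    have "0 < 1 + (l * z) / Suc l" using z by (intro add_pos_nonneg) auto
    then show "0 < (1 + (l * z) / Suc l) ^ Suc l * (1 + z) ^ l"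
      using z by (intro mult_pos_pos zero_less_power) auto
    then show "0 \<le> 1 / (1 + (l * z) / Suc l) ^ Suc l"
      using \<open>0 < 1 + (l * z) / Suc l\<close> by simp
  qed auto
  also have "\<dots> = (t / r * (1 / (1 + z))) ^ l"
    by (simp add: power_mult_distrib power_divide)
  also have "t / r * (1 / (1 + z)) = t / Suc r"
    using r by (simp add: z_def field_simps)
  finally show ?case .
qed

text \<open>Comparing with \<open>1 - 1 / r\<close> instead of \<open>1 / (1 + 1 / r)\<close> makes
  the product telescope to shifted ratios, hence \<open>t - 1\<close> and \<open>r - 1\<close>; the
  shift disappears in the limit.\<close>

lemma survival_power_ge:
  assumes "1 \<le> l" "2 \<le> t" "t \<le> r"
  shows "((real t - 1) / (real r - 1)) ^ l \<le> survival (Suc l) t r ^ Suc l"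
  using assms(3)
proof (induction r rule: dec_induct)
  case base
  show ?case using assms by simp
next
  case (step r)
  define z where "z = 1 / real r"
  have r: "2 \<le> r" using step assms by simp
  have z: "0 < z" "z < 1" using r by (auto simp: z_def)
  have fac: "1 - (l * z) / Suc l \<le> real (Suc l * r) / real (Suc l * Suc r - 1)"
  proof -
    define x where "x = real (Suc l * r)"
    have "0 < x" using r by (simp add: x_def add_pos_nonneg)
    then have "x / (x + l) = 1 - l / (x + l)"
      by (simp add: field_simps)
    then have "real (Suc l * r) / real (Suc l * Suc r - 1) = 1 - l / (Suc l * r + l)"
      by (simp add: x_def add_ac)
    moreover have "l / (Suc l * r + l) \<le> l / (real (Suc l) * r)"
      by (rule frac_le) (use r in \<open>auto simp: distrib_right intro!: add_pos_nonneg\<close>)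
    ultimately show ?thesis by (simp add: z_def mult_ac)
  qed
  have "l * z \<le> Suc l" using z by (metis mult.right_neutral mult_mono of_nat_0_le_iff less_imp_le of_nat_le_iff Suc_n_not_le_n linear)
  then have pos: "0 \<le> 1 - (l * z) / Suc l" by (simp add: field_simps)
  have "(1 - z) ^ l = (1 + (- (l * z)) / l) ^ l" using assms by simp
  also have "\<dots> \<le> (1 + (- (l * z)) / Suc l) ^ Suc l"
    using assms z by (intro compound_power_mono) auto
  also have "\<dots> = (1 - (l * z) / Suc l) ^ Suc l" by simp
  also have "\<dots> \<le> (real (Suc l * r) / real (Suc l * Suc r - 1)) ^ Suc l"
    by (intro power_mono fac pos)
  finally have le: "(1 - z) ^ l \<le> (real (Suc l * r) / real (Suc l * Suc r - 1)) ^ Suc l" .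
  have "((real t - 1) / (real (Suc r) - 1)) ^ l = ((real t - 1) / (real r - 1)) ^ l * (1 - z) ^ l"
  proof -
    have "(real t - 1) / (real (Suc r) - 1) = (real t - 1) / (real r - 1) * (1 - z)"
      using r by (simp add: z_def field_simps)
    then show ?thesis by (simp only: power_mult_distrib)
  qed
  also have "\<dots> \<le> survival (Suc l) t r ^ Suc l * (real (Suc l * r) / real (Suc l * Suc r - 1)) ^ Suc l"
    using z survival_bounds[of "Suc l" t r] by (intro mult_mono step.IH le) auto
  also have "\<dots> = survival (Suc l) t (Suc r) ^ Suc l"
    unfolding survival_Suc[OF step(1)] power_mult_distrib[symmetric] by simp
  finally show ?case .
qed

lemma core_size_eq_card_imp_heavy:
  assumes fin: "finite E" "finite V" and f: "core_size V k E f = card E" and v: "v \<in># total_mset E f"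
  shows "k \<le> count (total_mset E f) v"
proof -
  obtain W where W: "W \<subseteq> V" "stable k E f W" "core_size V k E f = card (inner_edges E f W)"
    using core_size_attained[OF fin] .
  then have eq: "inner_edges E f W = E"
    using f by (intro card_subset_eq fin inner_edges_subset) auto
  then have "v \<in> W"
    using v fin by (auto simp: set_total_mset inner_edges_def)
  then show ?thesis using W eq by (simp add: stable_def)
qed

lemma sum_count_eq_size:
  assumes "finite V" "set_mset D \<subseteq> V"
  shows "(\<Sum>v\<in>V. real (count D v)) = size D"
proof -
  have "(\<Sum>v\<in>V. real (count D v)) = (\<Sum>v\<in>set_mset D. real (count D v))"
    using assms by (intro sum.mono_neutral_right) (auto simp: not_in_iff)
  then show ?thesis by (simp add: size_multiset_overloaded_eq)
qed

text \<open>Truncation at \<open>J\<close> costs a vertex of degree \<open>c\<close> at most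
  \<open>c ^ 2 / J\<close>, which sums to at most \<open>A / J\<close>.\<close>

lemma thin_total_heavy_ge:
  assumes fin: "finite V" and D: "set_mset D \<subseteq> V" "square_sum V D \<le> A"
    and hv: "\<And>v. v \<in># D \<Longrightarrow> k \<le> count D v" and J: "0 < J"
  shows "size D - A / J \<le> thin_total V (heavy k J) 1 D"
proof -
  have le: "real c - c\<^sup>2 / J \<le> min c J" for c :: nat
  proof (cases "c \<le> J")
    case True
    then show ?thesis by (simp add: min_def)
  next
    case False
    then have "c * J \<le> c * c" by simp
    then have "real c * J \<le> c\<^sup>2" unfolding power2_eq_square by (metis of_nat_mult of_nat_le_iff)
    then have "real c \<le> c\<^sup>2 / J" using J by (simp add: field_simps)
    then show ?thesis by simp
  qed
  have "(\<Sum>v\<in>V. real (count D v) - (count D v)\<^sup>2 / J) \<le> thin_total V (heavy k J) 1 D"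
    unfolding thin_total_def thin_1
  proof (intro sum_mono)
    fix v
    show "real (count D v) - (count D v)\<^sup>2 / J \<le> heavy k J (count D v)"
    proof (cases "v \<in># D")
      case True
      then show ?thesis using le hv by (simp add: heavy_def)
    next
      case False
      then have 0: "count D v = 0" by (simp add: not_in_iff)
      show ?thesis unfolding 0 by simp
    qed
  qed
  moreover have "(\<Sum>v\<in>V. real (count D v) - (count D v)\<^sup>2 / J) = size D - square_sum V D / J"
    using sum_count_eq_size[OF fin D(1)] by (simp add: sum_subtractf square_sum_def sum_divide_distrib)
  moreover have "square_sum V D / J \<le> A / J"
    using D J by (intro divide_right_mono) auto
  ultimately show ?thesis by linarith
qed

lemma thin_total_heavy_le:
  assumes "finite V" "set_mset D \<subseteq> V"
  shows "thin_total V (heavy k J) 1 D \<le> size D"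
  unfolding thin_total_def thin_1 sum_count_eq_size[OF assms, symmetric]
  by (intro sum_mono order.trans[OF heavy_le]) auto

section \<open>The core threshold\<close>

definition config_prob :: "nat \<Rightarrow> nat \<Rightarrow> nat \<Rightarrow> ((nat \<Rightarrow> nat list) \<Rightarrow> bool) \<Rightarrow> real" where
  "config_prob d n m P = measure_pmf.prob (pmf_of_set (configs {..<n} d {..<m})) {f. P f}"

lemma card_configs:
  fixes n m :: nat
  shows "card (configs {..<n} d {..<m}) = n ^ (d * m)"
  by (simp add: card_PiE card_words power_mult)

lemma configs_nonempty:
  fixes n m :: nat
  assumes "0 < n"
  shows "configs {..<n} d {..<m} \<noteq> {}"
proof
  assume "configs {..<n} d {..<m} = {}"
  then have "card (configs {..<n} d {..<m}) = 0" by (simp only: card.empty)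
  then show False unfolding card_configs using assms by simp
qed

lemma config_prob_eq:
  assumes "0 < n"
  shows "config_prob d n m P = card {f \<in> configs {..<n} d {..<m}. P f} / real n ^ (d * m)"
proof -
  have "configs {..<n} d {..<m} \<inter> {f. P f} = {f \<in> configs {..<n} d {..<m}. P f}" by auto
  then show ?thesis
    unfolding config_prob_def using assms configs_nonempty[OF assms, where d = d and m = m]
    by (subst measure_pmf_of_set) (auto simp: card_configs simp del: card_PiE)
qed

lemma config_prob_nonneg: "0 \<le> config_prob d n m P"
  by (simp add: config_prob_def)

lemma config_prob_mono:
  assumes "0 < n" "\<And>f. f \<in> configs {..<n} d {..<m} \<Longrightarrow> P f \<Longrightarrow> Q f"
  shows "config_prob d n m P \<le> config_prob d n m Q"
  unfolding config_prob_eq[OF assms(1)]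
  using assms by (intro divide_right_mono of_nat_mono card_mono) auto

lemma config_prob_disj: "config_prob d n m (\<lambda>f. P f \<or> Q f) \<le> config_prob d n m P + config_prob d n m Q"
  unfolding config_prob_def
  by (simp add: Collect_disj_eq measure_Un_le)

lemma config_prob_Bex:
  assumes "finite I"
  shows "config_prob d n m (\<lambda>f. \<exists>i\<in>I. P i f) \<le> (\<Sum>i\<in>I. config_prob d n m (P i))"
  unfolding config_prob_def
  by (simp add: Collect_bex_eq measure_UNION_le assms)

lemma survival_pos:
  assumes "2 \<le> d" "1 \<le> t"
  shows "0 < survival d t r"
  unfolding survival_def
proof (intro prod_pos ballI)
  fix i assume "i \<in> {t<..r}"
  then have i: "2 \<le> i" using assms by auto
  have "d * 1 < d * i" using assms i by (intro mult_strict_left_mono) auto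
  moreover have "2 * 2 \<le> d * i" using assms i by (intro mult_le_mono) auto
  ultimately have "0 < d * i - d" "0 < d * i - 1" by auto
  then show "0 < real (d * i - d) / real (d * i - 1)"
    by (intro divide_pos_pos) (simp_all only: of_nat_0_less_iff)
qed

section \<open>Large cores below the threshold\<close>

text \<open>The Poisson mean is at most \<open>lam * Suc l * \<tau>\<close>, so the subcriticality
  assumption gives \<open>Q ^ l \<le> \<rho> ^ l * \<tau>\<close>. Multiplying by
  \<open>\<tau> ^ l\<close> and using \<open>\<tau> ^ Suc l \<le> (q / m) ^ l\<close> yields
  \<open>\<tau> * Q \<le> \<rho> * q / m\<close>. Up to a constant, the expected number of heavy
  points is thus at most a fraction \<open>\<rho>\<close> of the \<open>Suc l * q\<close> points
  that remain.\<close>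

lemma thin_survival_le:
  fixes lam \<rho> :: real and n m q :: nat
  assumes l: "1 \<le> l" and k: "1 \<le> k" and n: "2 \<le> n" and lam: "0 < lam" and \<rho>: "0 \<le> \<rho>"
    and P: "\<And>\<mu>. 0 < \<mu> \<Longrightarrow> lam * Suc l * measure_pmf.prob (poisson_pmf \<mu>) {k - 1..} ^ l \<le> \<rho> ^ l * \<mu>"
    and q: "1 \<le> q" "q \<le> m" and m: "m \<le> lam * n"
  shows "n * thin (Suc l * m) (survival (Suc l) q m / n) (heavy k J) \<le>
    Suc l * \<rho> * q + k * (2 * real k ^ 2 + 2 * (lam * Suc l)\<^sup>2)"
proof -
  define \<tau> where "\<tau> = survival (Suc l) q m"
  define N where "N = Suc l * m - 1"
  have N: "Suc l * m = Suc N" using q by (simp add: N_def)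
  have \<tau>: "0 < \<tau>" "\<tau> \<le> 1"
    unfolding \<tau>_def using survival_pos[of "Suc l" q m] survival_bounds[of "Suc l" q m] l q by auto
  have "2 * 1 \<le> Suc l * m" using l q by (intro mult_le_mono) auto
  then have N1: "1 \<le> N" by (simp add: N_def)
  have Nl: "Suc N \<le> lam * Suc l * n"
  proof -
    have "real (Suc N) = Suc l * real m" unfolding N[symmetric] by (simp only: of_nat_mult)
    also have "\<dots> \<le> Suc l * (lam * n)" by (intro mult_left_mono m) auto
    finally show ?thesis by (simp only: mult_ac)
  qed
  define p where "p = \<tau> / n"
  have p: "0 < p" "p \<le> 1 / 2" using \<tau> n by (auto simp: p_def field_simps)
  define Q where "Q = measure_pmf.prob (poisson_pmf (N * p)) {k - 1..}"
  define err where "err = k * (real k ^ 2 / N + 2 * real N * p\<^sup>2)"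
  have "thin (Suc l * m) p (heavy k J) \<le> Suc N * p * (Q + err)"
    unfolding N Q_def err_def using heavy_le N1 by (intro thin_heavy_le p k) auto
  then have "n * thin (Suc l * m) p (heavy k J) \<le> n * (Suc N * p * (Q + err))"
    by (intro mult_left_mono) auto
  also have "\<dots> = Suc N * (\<tau> * Q) + \<tau> * (Suc N * err)"
    using n by (simp add: p_def field_simps)
  also have "\<dots> \<le> Suc N * (\<rho> * (q / m)) + 1 * (Suc N * err)"
  proof (intro add_mono mult_left_mono mult_right_mono \<tau>)
    have "lam * Suc l * Q ^ l \<le> \<rho> ^ l * (N * p)"
      unfolding Q_def using N1 p by (intro P) auto
    also have "\<dots> \<le> \<rho> ^ l * (lam * Suc l * \<tau>)"
    proof (intro mult_left_mono)
      have "N * p \<le> (lam * Suc l * n) * p" using Nl p by (intro mult_right_mono) auto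
      then show "N * p \<le> lam * Suc l * \<tau>" using n by (simp add: p_def)
    qed (use \<rho> in auto)
    finally have "Q ^ l \<le> \<rho> ^ l * \<tau>" using lam by (simp del: of_nat_Suc)
    then have "(\<tau> * Q) ^ l \<le> \<tau> ^ l * (\<rho> ^ l * \<tau>)"
      unfolding power_mult_distrib using \<tau> by (intro mult_left_mono) auto
    also have "\<dots> = \<rho> ^ l * \<tau> ^ Suc l" by simp
    also have "\<dots> \<le> \<rho> ^ l * (q / m) ^ l"
      unfolding \<tau>_def using \<rho> l q by (intro mult_left_mono survival_power_le) auto
    finally have "(\<tau> * Q) ^ l \<le> (\<rho> * (q / m)) ^ l" by (simp only: power_mult_distrib)
    then show "\<tau> * Q \<le> \<rho> * (q / m)"
      using l \<rho> by (metis Suc_diff_1 less_le_trans mult_nonneg_nonneg of_nat_0_le_iff power_le_imp_le_base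
        zero_le_divide_iff zero_less_one)
  qed (auto simp: err_def)
  also have "Suc N * (\<rho> * (q / m)) = Suc l * \<rho> * q"
    unfolding N[symmetric] of_nat_mult using q by (simp del: of_nat_Suc)
  also have "1 * (Suc N * err) \<le> k * (2 * real k ^ 2 + 2 * (lam * Suc l)\<^sup>2)"
  proof -
    have 1: "Suc N * (real k ^ 2 / N) \<le> 2 * real k ^ 2"
    proof -
      have "Suc N * (real k ^ 2 / N) \<le> (2 * N) * (real k ^ 2 / N)"
        using N1 by (intro mult_right_mono) auto
      then show ?thesis using N1 by simp
    qed
    have "Suc N * (real N * p\<^sup>2) \<le> (Suc N * p)\<^sup>2"
    proof -
      have "(Suc N * p) * (N * p) \<le> (Suc N * p) * (Suc N * p)"
        using p by (intro mult_left_mono mult_right_mono) auto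
      then show ?thesis by (simp only: power2_eq_square mult_ac)
    qed
    also have "\<dots> \<le> (lam * Suc l)\<^sup>2"
    proof (intro power_mono)
      have "Suc N * p \<le> (lam * Suc l * n) * (1 / n)"
        using Nl \<tau> p by (intro mult_mono) (auto simp: p_def divide_right_mono)
      then show "Suc N * p \<le> lam * Suc l" using n by simp
    qed (use p in auto)
    finally have "Suc N * (real k ^ 2 / N + 2 * real N * p\<^sup>2) \<le> 2 * real k ^ 2 + 2 * (lam * Suc l)\<^sup>2"
      using 1 unfolding distrib_left by linarith
    then have "k * (Suc N * (real k ^ 2 / N + 2 * real N * p\<^sup>2)) \<le> k * (2 * real k ^ 2 + 2 * (lam * Suc l)\<^sup>2)"
      by (intro mult_left_mono) auto
    then show ?thesis by (simp only: err_def mult_ac mult_1)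
  qed
  finally show ?thesis by (simp add: p_def \<tau>_def)
qed

text \<open>Peeling is observed with \<open>t = q\<close>, when only the core is left and all
  \<open>Suc l * q\<close> points are heavy, whereas a fraction of at most \<open>\<rho>\<close> is
  expected. The exponent is \<open>\<theta>\<close> times this gap, reduced by the truncation loss
  \<open>C / J\<close>, by the quadratic terms of the exponential moments, and by a
  constant.\<close>

lemma config_prob_core_size_eq_le:
  fixes lam \<rho> \<epsilon> C \<theta> :: real and J :: nat
  assumes l: "1 \<le> l" and k: "1 \<le> k" and n: "2 \<le> n" and lam: "0 < lam" and \<rho>: "0 \<le> \<rho>" "\<rho> \<le> 1"
    and P: "\<And>\<mu>. 0 < \<mu> \<Longrightarrow> lam * Suc l * measure_pmf.prob (poisson_pmf \<mu>) {k - 1..} ^ l \<le> \<rho> ^ l * \<mu>"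
    and q: "1 \<le> q" "q \<le> m" and m: "m \<le> lam * n" and \<epsilon>: "0 < \<epsilon>" "\<epsilon> * n \<le> q"
    and C: "0 < C" and J: "1 \<le> J" and \<theta>: "0 < \<theta>" "\<theta> * J \<le> 1"
  shows "config_prob (Suc l) n m (\<lambda>f. core_size {..<n} k {..<m} f = q \<and>
      square_sum {..<n} (total_mset {..<m} f) \<le> C * n) \<le>
    exp (- (\<theta> * ((Suc l * (1 - \<rho>) * \<epsilon> - C / J - 2 * Suc l * lam * J\<^sup>2 * \<theta>) * n
       - k * (2 * real k ^ 2 + 2 * (lam * Suc l)\<^sup>2) - lam * J * C / (Suc l * \<epsilon>\<^sup>2))))"
proof -
  define d where "d = Suc l"
  define \<kappa> where "\<kappa> = d * real q - C * n / J"
  define \<eta> where "\<eta> = \<bar>\<theta>\<bar> * J * (C * n) / (real (d * q))\<^sup>2 + (\<theta> * J)\<^sup>2"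
  define K1 where "K1 = k * (2 * real k ^ 2 + 2 * (lam * d)\<^sup>2)"
  define K2 where "K2 = lam * J * C / (d * \<epsilon>\<^sup>2)"
  have d: "2 \<le> d" using l by (simp add: d_def)
  have "card {f \<in> configs {..<n} d {..<m}. core_size {..<n} k {..<m} f = q \<and>
      square_sum {..<n} (total_mset {..<m} f) \<le> C * n} \<le>
    real n ^ (d * m) * exp (\<theta> * (n * thin (d * m) (survival d q (card {..<m}) / n) (heavy k J) - \<kappa>) +
      (card {..<m} - q) * (d * \<eta>) + (d * m) * (\<theta> * J)\<^sup>2)"
    unfolding \<eta>_def d_def
  proof (rule card_core_size_le)
    fix F f assume F: "F \<subseteq> {..<m}" "card F = q" and f: "f \<in> configs {..<n} (Suc l) F"
      and cs: "core_size {..<n} k F f = q" and sq: "square_sum {..<n} (total_mset F f) \<le> C * n"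
    have finF: "finite F" using F finite_subset by blast
    have "size (total_mset F f) - C * n / J \<le> thin_total {..<n} (heavy k J) 1 (total_mset F f)"
    proof (rule thin_total_heavy_ge)
      show "set_mset (total_mset F f) \<subseteq> {..<n}"
        using f by (auto simp: set_total_mset finF words_def PiE_def Pi_def)
      show "k \<le> count (total_mset F f) v" if "v \<in># total_mset F f" for v
        using core_size_eq_card_imp_heavy[OF finF _ _ that] cs F by auto
    qed (use sq J in auto)
    then have "0 \<le> thin_total {..<n} (heavy k J) 1 (total_mset F f) - \<kappa>"
      using size_total_mset[OF f] F by (simp add: \<kappa>_def d_def algebra_simps)
    then show "0 \<le> \<theta> * (thin_total {..<n} (heavy k J) 1 (total_mset F f) - \<kappa>)"
      using \<theta> by simp
  qed (use n q k \<theta> in auto)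
  then have "config_prob d n m (\<lambda>f. core_size {..<n} k {..<m} f = q \<and>
      square_sum {..<n} (total_mset {..<m} f) \<le> C * n) \<le>
      exp (\<theta> * (n * thin (d * m) (survival d q m / n) (heavy k J) - \<kappa>) + (m - q) * (d * \<eta>) + (d * m) * (\<theta> * J)\<^sup>2)"
    using n by (subst config_prob_eq) (auto simp: field_simps)
  also have "\<dots> \<le> exp (\<theta> * (d * \<rho> * q + K1 - \<kappa>) + (\<theta> * K2 + d * lam * n * (\<theta> * J)\<^sup>2) + d * (lam * n) * (\<theta> * J)\<^sup>2)"
  proof (subst exp_le_cancel_iff, intro add_mono mult_left_mono diff_right_mono)
    show "n * thin (d * m) (survival d q m / n) (heavy k J) \<le> d * \<rho> * q + K1"
      unfolding d_def K1_def by (rule thin_survival_le) fact+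
    have "(m - q) * (d * \<eta>) \<le> (lam * n) * (d * \<eta>)"
      using m C \<theta> by (intro mult_right_mono) (auto simp: \<eta>_def)
    also have "\<dots> = (lam * n) * (d * (\<bar>\<theta>\<bar> * J * (C * n) / (real (d * q))\<^sup>2)) + d * lam * n * (\<theta> * J)\<^sup>2"
      by (simp add: \<eta>_def algebra_simps)
    also have "(lam * n) * (d * (\<bar>\<theta>\<bar> * J * (C * n) / (real (d * q))\<^sup>2)) \<le>
        (lam * n) * (d * (\<bar>\<theta>\<bar> * J * (C * n) / (d * (\<epsilon> * n))\<^sup>2))"
    proof (intro mult_left_mono divide_left_mono power_mono)
      show "d * (\<epsilon> * n) \<le> real (d * q)" using \<epsilon> by (simp add: mult_left_mono)
      show "0 < (real (d * q))\<^sup>2 * (d * (\<epsilon> * n))\<^sup>2" using d q \<epsilon> n by simp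
    qed (use lam C \<theta> \<epsilon> in auto)
    also have "\<dots> = \<theta> * K2"
      using d n \<epsilon> \<theta> by (simp add: K2_def field_simps power2_eq_square)
    finally show "(m - q) * (d * \<eta>) \<le> \<theta> * K2 + d * lam * n * (\<theta> * J)\<^sup>2" by simp
    show "real (d * m) * (\<theta> * J)\<^sup>2 \<le> d * (lam * n) * (\<theta> * J)\<^sup>2"
      using m by (intro mult_right_mono) (auto intro: mult_left_mono)
  qed (use \<theta> in auto)
  also have "\<dots> \<le> exp (- (\<theta> * ((d * (1 - \<rho>) * \<epsilon> - C / J - 2 * d * lam * J\<^sup>2 * \<theta>) * n - K1 - K2)))"
  proof (subst exp_le_cancel_iff)
    have "d * (1 - \<rho>) * (\<epsilon> * n) \<le> d * (1 - \<rho>) * q"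
      using \<epsilon> \<rho> by (intro mult_left_mono) auto
    then have "\<theta> * (d * \<rho> * q + K1 - \<kappa>) \<le> \<theta> * (K1 + C * n / J - d * (1 - \<rho>) * (\<epsilon> * n))"
      using \<theta> by (intro mult_left_mono) (auto simp: \<kappa>_def algebra_simps)
    then show "\<theta> * (d * \<rho> * q + K1 - \<kappa>) + (\<theta> * K2 + d * lam * n * (\<theta> * J)\<^sup>2) + d * (lam * n) * (\<theta> * J)\<^sup>2 \<le>
      - (\<theta> * ((d * (1 - \<rho>) * \<epsilon> - C / J - 2 * d * lam * J\<^sup>2 * \<theta>) * n - K1 - K2))"
      by (simp add: algebra_simps power2_eq_square)
  qed
  finally show ?thesis by (simp only: d_def K1_def K2_def)
qed

lemma config_prob_square_sum_le:
  assumes "0 < n" "0 < lam" "m \<le> lam * n" "0 < C"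
  shows "config_prob d n m (\<lambda>f. C * n < square_sum {..<n} (total_mset {..<m} f)) \<le> ((d * lam)\<^sup>2 + d * lam) / C"
proof -
  define x where "x = real (d * m) / n"
  have "d * real m \<le> d * (lam * n)" using assms by (intro mult_left_mono) auto
  then have x: "0 \<le> x" "x \<le> d * lam"
    using assms by (auto simp: x_def field_simps)
  have "card {f \<in> configs {..<n} d {..<m}. C * n < square_sum {..<n} (total_mset {..<m} f)} \<le>
      real n ^ (d * m) * (n * (x\<^sup>2 + x) / (C * n))"
    unfolding x_def using assms by (intro card_square_sum_gt) auto
  then have "config_prob d n m (\<lambda>f. C * n < square_sum {..<n} (total_mset {..<m} f)) \<le> n * (x\<^sup>2 + x) / (C * n)"
    using assms by (subst config_prob_eq) (auto simp: pos_divide_le_eq mult_ac)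
  also have "\<dots> = (x\<^sup>2 + x) / C" using assms by simp
  also have "\<dots> \<le> ((d * lam)\<^sup>2 + d * lam) / C"
    using x assms by (intro divide_right_mono add_mono power_mono) auto
  finally show ?thesis .
qed

abbreviation jobs :: "real \<Rightarrow> nat \<Rightarrow> nat" where
  "jobs lam n \<equiv> nat \<lfloor>lam * real n\<rfloor>"

lemma jobs_bounds:
  fixes lam :: real and n :: nat
  assumes "0 < lam"
  shows "jobs lam n \<le> lam * n" "lam * n - 1 < jobs lam n"
proof -
  have "0 \<le> \<lfloor>lam * n\<rfloor>" using assms by simp
  then have "real (jobs lam n) = of_int \<lfloor>lam * n\<rfloor>" by (simp add: of_nat_nat)
  then show "jobs lam n \<le> lam * n" "lam * n - 1 < jobs lam n" by linarith+
qed

text \<open>Allows parameters to be chosen for each \<open>e\<close> before \<open>n\<close> grows;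
  below, \<open>e\<close> pays for the event that \<open>square_sum\<close> exceeds
  \<open>C * n\<close>.\<close>

lemma tendsto_0_by_bound:
  fixes g :: "nat \<Rightarrow> real"
  assumes "\<And>n. 0 \<le> g n" "\<And>e. 0 < e \<Longrightarrow> \<exists>h. h \<longlonglongrightarrow> 0 \<and> (\<forall>\<^sub>F n in sequentially. g n \<le> e + h n)"
  shows "g \<longlonglongrightarrow> 0"
proof (rule tendstoI)
  fix e :: real assume e: "0 < e"
  then obtain h where h: "h \<longlonglongrightarrow> 0" "\<forall>\<^sub>F n in sequentially. g n \<le> e / 2 + h n"
    using assms(2)[of "e / 2"] by auto
  have "\<forall>\<^sub>F n in sequentially. h n < e / 2"
    using h(1) e by (intro order_tendstoD(2)) auto
  with h(2) show "\<forall>\<^sub>F n in sequentially. dist (g n) 0 < e"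
    by eventually_elim (use assms(1) in \<open>auto simp: dist_real_def\<close>)
qed

lemma large_core_unlikely:
  fixes lam \<rho> \<epsilon> :: real
  assumes l: "1 \<le> l" and k: "1 \<le> k" and lam: "0 < lam" and \<rho>: "0 \<le> \<rho>" "\<rho> < 1"
    and P: "\<And>\<mu>. 0 < \<mu> \<Longrightarrow> lam * Suc l * measure_pmf.prob (poisson_pmf \<mu>) {k - 1..} ^ l \<le> \<rho> ^ l * \<mu>"
    and \<epsilon>: "0 < \<epsilon>"
  shows "(\<lambda>n. config_prob (Suc l) n (jobs lam n) (\<lambda>f. \<epsilon> * n \<le> core_size {..<n} k {..<jobs lam n} f)) \<longlonglongrightarrow> 0"
proof (rule tendsto_0_by_bound)
  fix e :: real assume e: "0 < e"
  define d where "d = Suc l"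
  \<comment> \<open>Makes Markov's bound for \<open>square_sum\<close> exceeding
    \<open>C * n\<close> equal to \<open>e\<close>.\<close>
  define C where "C = ((d * lam)\<^sup>2 + d * lam) / e"
  define \<delta> where "\<delta> = d * (1 - \<rho>) * \<epsilon>"
  have "0 < (d * lam)\<^sup>2 + d * lam" using lam by (intro add_pos_pos) (auto simp: d_def)
  then have C: "0 < C" "((d * lam)\<^sup>2 + d * lam) / C = e" using e by (auto simp: C_def)
  have \<delta>: "0 < \<delta>" using \<rho> \<epsilon> by (simp add: \<delta>_def d_def)
  \<comment> \<open>\<open>J\<close> and \<open>\<theta>\<close> are chosen such that truncation and
    the quadratic terms each use up at most a quarter of the gap \<open>\<delta>\<close>. The union
    over all core sizes costs a factor \<open>lam * n\<close>, which the exponential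
    absorbs.\<close>
  obtain J0 :: nat where J0: "4 * C / \<delta> < J0" using reals_Archimedean2 by blast
  define J where "J = max 1 J0"
  have J: "1 \<le> J" "C / J \<le> \<delta> / 4"
  proof -
    have "4 * C / \<delta> < J" using J0 by (simp add: J_def)
    then show "C / J \<le> \<delta> / 4" using \<delta> by (simp add: field_simps J_def)
  qed (simp add: J_def)
  define y where "y = 2 * d * lam * J\<^sup>2"
  have y: "0 < y" using J lam by (simp add: y_def d_def)
  define \<theta> where "\<theta> = min (1 / J) (\<delta> / (4 * y))"
  have \<theta>: "0 < \<theta>" "\<theta> * J \<le> 1" "2 * d * lam * J\<^sup>2 * \<theta> \<le> \<delta> / 4"
  proof -
    show "0 < \<theta>" using J \<delta> y by (simp add: \<theta>_def)
    have "\<theta> * J \<le> 1 / J * J" by (intro mult_right_mono) (auto simp: \<theta>_def)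
    then show "\<theta> * J \<le> 1" using J by simp
    have "y * \<theta> \<le> y * (\<delta> / (4 * y))"
      using y by (intro mult_left_mono) (auto simp: \<theta>_def)
    also have "\<dots> = \<delta> / 4" using y by simp
    finally show "2 * d * lam * J\<^sup>2 * \<theta> \<le> \<delta> / 4" by (simp only: y_def)
  qed
  define K where "K = k * (2 * real k ^ 2 + 2 * (lam * d)\<^sup>2) + lam * J * C / (d * \<epsilon>\<^sup>2)"
  define h where "h = (\<lambda>n::nat. lam * n * exp (- (\<theta> * (\<delta> / 2 * n - K))))"
  have "h \<longlonglongrightarrow> 0"
    unfolding h_def using \<theta>(1) \<delta> lam by real_asymp
  moreover have "\<forall>\<^sub>F n in sequentially.
      config_prob (Suc l) n (jobs lam n) (\<lambda>f. \<epsilon> * n \<le> core_size {..<n} k {..<jobs lam n} f) \<le> e + h n"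
    using eventually_ge_at_top[of 2]
  proof eventually_elim
    fix n :: nat assume n: "2 \<le> n"
    define m where "m = jobs lam n"
    have m: "m \<le> lam * n" using jobs_bounds[OF lam] by (simp add: m_def)
    define Q where "Q = {q \<in> {1..m}. \<epsilon> * n \<le> q}"
    let ?S = "\<lambda>f. square_sum {..<n} (total_mset {..<m} f)"
    let ?c = "\<lambda>f. core_size {..<n} k {..<m} f"
    have "config_prob d n m (\<lambda>f. \<epsilon> * n \<le> ?c f) \<le>
        config_prob d n m (\<lambda>f. C * n < ?S f \<or> (\<exists>q\<in>Q. ?c f = q \<and> ?S f \<le> C * n))"
    proof (rule config_prob_mono)
      fix f assume f: "\<epsilon> * n \<le> ?c f"
      have "?c f \<le> m" using core_size_le[of "{..<m}" "{..<n}" k f] by simp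
      moreover have "0 < \<epsilon> * n" using \<epsilon> n by simp
      then have "0 < ?c f" using f by simp
      ultimately show "C * n < ?S f \<or> (\<exists>q\<in>Q. ?c f = q \<and> ?S f \<le> C * n)"
        using f by (auto simp: Q_def)
    qed (use n in auto)
    also have "\<dots> \<le> config_prob d n m (\<lambda>f. C * n < ?S f) + (\<Sum>q\<in>Q. config_prob d n m (\<lambda>f. ?c f = q \<and> ?S f \<le> C * n))"
      by (intro order.trans[OF config_prob_disj] add_left_mono config_prob_Bex) (simp add: Q_def)
    also have "\<dots> \<le> e + h n"
    proof (intro add_mono)
      show "config_prob d n m (\<lambda>f. C * n < ?S f) \<le> e"
        using config_prob_square_sum_le[OF _ lam m C(1), of d] n unfolding C(2) by simp
      have "(\<Sum>q\<in>Q. config_prob d n m (\<lambda>f. ?c f = q \<and> ?S f \<le> C * n)) \<le>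
         (\<Sum>q\<in>Q. exp (- (\<theta> * (\<delta> / 2 * n - K))))"
      proof (intro sum_mono)
        fix q assume q: "q \<in> Q"
        have "config_prob d n m (\<lambda>f. ?c f = q \<and> ?S f \<le> C * n) \<le>
          exp (- (\<theta> * ((d * (1 - \<rho>) * \<epsilon> - C / J - 2 * d * lam * J\<^sup>2 * \<theta>) * n
             - k * (2 * real k ^ 2 + 2 * (lam * d)\<^sup>2) - lam * J * C / (d * \<epsilon>\<^sup>2))))"
          unfolding d_def
          using l k n lam \<rho> P q m \<epsilon> C(1) J \<theta> by (intro config_prob_core_size_eq_le) (auto simp: Q_def)
        also have "\<dots> \<le> exp (- (\<theta> * (\<delta> / 2 * n - K)))"
        proof -
          have "\<delta> / 2 * n \<le> (d * (1 - \<rho>) * \<epsilon> - C / J - 2 * d * lam * J\<^sup>2 * \<theta>) * n"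
            using J \<theta> unfolding \<delta>_def[symmetric] by (intro mult_right_mono) auto
          then have "\<theta> * (\<delta> / 2 * n - K) \<le> \<theta> * ((d * (1 - \<rho>) * \<epsilon> - C / J - 2 * d * lam * J\<^sup>2 * \<theta>) * n
             - k * (2 * real k ^ 2 + 2 * (lam * d)\<^sup>2) - lam * J * C / (d * \<epsilon>\<^sup>2))"
            using \<theta> unfolding K_def by (intro mult_left_mono) auto
          then show ?thesis by simp
        qed
        finally show "config_prob d n m (\<lambda>f. ?c f = q \<and> ?S f \<le> C * n) \<le> exp (- (\<theta> * (\<delta> / 2 * n - K)))" .
      qed
      also have "\<dots> \<le> h n"
      proof -
        have "card Q \<le> card {1..m}" unfolding Q_def by (intro card_mono) auto
        then have "card Q \<le> lam * n" using m by simp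
        then show ?thesis unfolding h_def sum_constant by (intro mult_right_mono) auto
      qed
      finally show "(\<Sum>q\<in>Q. config_prob d n m (\<lambda>f. ?c f = q \<and> ?S f \<le> C * n)) \<le> h n" .
    qed
    finally show "config_prob (Suc l) n (jobs lam n) (\<lambda>f. \<epsilon> * n \<le> core_size {..<n} k {..<jobs lam n} f) \<le> e + h n"
      by (simp only: d_def m_def)
  qed
  ultimately show "\<exists>h. h \<longlonglongrightarrow> 0 \<and> (\<forall>\<^sub>F n in sequentially.
      config_prob (Suc l) n (jobs lam n) (\<lambda>f. \<epsilon> * n \<le> core_size {..<n} k {..<jobs lam n} f) \<le> e + h n)"
    by blast
qed (rule config_prob_nonneg)

section \<open>Nonempty cores above the threshold\<close>

text \<open>Coupling by thinning twice, as \<open>a = b * (a / b)\<close>.\<close>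

lemma thin_mono_prob:
  assumes "0 \<le> a" "a \<le> b" "b \<le> 1" and f: "mono f"
  shows "thin n a f \<le> thin n b f"
proof (cases "b = 0")
  case False
  then have b: "0 < b" using assms by auto
  then have ab: "b * (a / b) = a" "0 \<le> a / b" "a / b \<le> 1" using assms by auto
  have "thin i (a / b) f \<le> f i" for i
    using ab f by (intro thin_le) (auto dest: monoD)
  then have "thin n b (\<lambda>i. thin i (a / b) f) \<le> thin n b f"
    using assms by (intro thin_mono) auto
  then show ?thesis by (simp only: thin_thin ab)
qed (use assms in auto)

lemma mono_heavy: "mono (heavy k J)"
  by (auto simp: heavy_def mono_def min_def)

lemma jobs_ratio:
  fixes lam :: real
  assumes "0 < lam"
  shows "(\<lambda>n. jobs lam n / n) \<longlonglongrightarrow> lam"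
proof (rule tendsto_sandwich)
  show "\<forall>\<^sub>F n in sequentially. lam - 1 / n \<le> jobs lam n / n"
    using eventually_gt_at_top[of 0]
  proof eventually_elim
    fix n :: nat assume n: "0 < n"
    have "(lam * n - 1) / n \<le> jobs lam n / n"
      using jobs_bounds(2)[OF assms, of n] by (intro divide_right_mono) auto
    then show "lam - 1 / n \<le> jobs lam n / n"
      using n by (simp add: diff_divide_distrib)
  qed
  show "\<forall>\<^sub>F n in sequentially. jobs lam n / n \<le> lam"
    using eventually_gt_at_top[of 0]
    by eventually_elim (use jobs_bounds(1)[OF assms] in \<open>auto simp: field_simps\<close>)
qed real_asymp+

text \<open>Size biasing for the Poisson law: \<open>i\<close> times the weight of \<open>i\<close>
  is \<open>\<mu>\<close> times the weight of \<open>i - 1\<close>, so the sums become partial sums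
  of the law itself.\<close>

lemma sum_heavy_poisson_tendsto:
  assumes \<mu>: "0 < \<mu>" and k: "1 \<le> k"
  shows "(\<lambda>J. \<Sum>i=k..J. real i * pmf (poisson_pmf \<mu>) i) \<longlonglongrightarrow> \<mu> * measure_pmf.prob (poisson_pmf \<mu>) {k - 1..}"
proof -
  let ?p = "pmf (poisson_pmf \<mu>)"
  have sh: "real (Suc i) * ?p (Suc i) = \<mu> * ?p i" for i
    using \<mu> by (simp del: of_nat_Suc)
  have eq: "(\<Sum>i=k..J + k. real i * ?p i) = \<mu> * ((\<Sum>i<J + k. ?p i) - (\<Sum>i<k - 1. ?p i))" for J
  proof (induction J)
    case 0
    obtain k' where "k = Suc k'" using k by (cases k) auto
    then show ?case using sh[of k'] by simp
  next
    case (Suc J)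
    then show ?case using sh[of "J + k"] by (simp add: algebra_simps)
  qed
  have "?p sums 1"
  proof -
    have "(\<lambda>i. \<mu> ^ i /\<^sub>R fact i * exp (- \<mu>)) sums (exp \<mu> * exp (- \<mu>))"
      by (intro sums_mult2 exp_converges)
    moreover have "?p = (\<lambda>i. \<mu> ^ i /\<^sub>R fact i * exp (- \<mu>))"
      using \<mu> by (simp add: fun_eq_iff divide_inverse mult_ac)
    ultimately show ?thesis by (simp add: exp_minus)
  qed
  then have "(\<lambda>J. \<Sum>i<J + k. ?p i) \<longlonglongrightarrow> 1"
    unfolding sums_def by (rule LIMSEQ_ignore_initial_segment)
  then have "(\<lambda>J. \<Sum>i=k..J + k. real i * ?p i) \<longlonglongrightarrow> \<mu> * (1 - (\<Sum>i<k - 1. ?p i))"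
    unfolding eq by (intro tendsto_intros)
  then show ?thesis
    unfolding poisson_prob_atLeast by (rule LIMSEQ_offset)
qed

text \<open>Let \<open>x0\<close> be the fraction of hyperedges left when the survival probability
  has dropped to \<open>\<tau>0\<close>, that is, \<open>x0 ^ l = \<tau>0 ^ d\<close>. The
  hypothesis says \<open>x0 < \<tau>0 * p\<close>, so the predicted number
  \<open>n * \<mu> * p\<close> of heavy points exceeds the number \<open>n * lam * d * x0\<close> of
  all points. To reach an empty core, peeling would have to pass through this impossible
  state.\<close>

lemma zero_core_unlikely:
  fixes lam \<tau>0 :: real
  assumes l: "1 \<le> l" and k: "1 \<le> k" and lam: "0 < lam" and \<tau>0: "0 < \<tau>0" "\<tau>0 \<le> 1"
    and P: "\<tau>0 < measure_pmf.prob (poisson_pmf (lam * Suc l * \<tau>0)) {k - 1..} ^ l"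
  shows "(\<lambda>n. config_prob (Suc l) n (jobs lam n) (\<lambda>f. core_size {..<n} k {..<jobs lam n} f = 0)) \<longlonglongrightarrow> 0"
proof (rule tendsto_0_by_bound)
  fix e :: real assume e: "0 < e"
  define d where "d = Suc l"
  define \<mu> where "\<mu> = lam * d * \<tau>0"
  define p where "p = measure_pmf.prob (poisson_pmf \<mu>) {k - 1..}"
  define x0 where "x0 = root l (\<tau>0 ^ d)"
  \<comment> \<open>Strictly above \<open>x0\<close>, to leave room for rounding in \<open>t\<close>
    and for the shift in \<open>survival_power_ge\<close>; strictly below
    \<open>\<tau>0 * p\<close>, to leave the gap \<open>\<delta>\<close>.\<close>
  define x where "x = (x0 + \<tau>0 * p) / 2"
  have \<mu>: "0 < \<mu>" using lam \<tau>0 by (simp add: \<mu>_def d_def)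
  have p: "0 \<le> p" "p \<le> 1" "\<tau>0 < p ^ l" using P by (auto simp: p_def \<mu>_def d_def)
  have x0: "0 < x0" "x0 ^ l = \<tau>0 ^ d"
    using l \<tau>0 by (auto simp: x0_def)
  have "x0 < \<tau>0 * p"
  proof (rule power_less_imp_less_base)
    show "x0 ^ l < (\<tau>0 * p) ^ l"
      using p \<tau>0 by (simp add: x0 d_def power_mult_distrib mult.commute[of \<tau>0])
  qed (use p \<tau>0 in auto)
  moreover have "\<tau>0 * p \<le> 1 * 1" using \<tau>0 p by (intro mult_mono) auto
  ultimately have x: "x0 < x" "x < \<tau>0 * p" "x < 1" "0 < x" using x0 by (auto simp: x_def)
  define \<delta> where "\<delta> = lam * d * (\<tau>0 * p - x)"
  have \<delta>: "0 < \<delta>" using x lam by (simp add: \<delta>_def d_def)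
  have \<mu>p: "\<mu> * p = lam * d * x + \<delta>" by (simp add: \<delta>_def \<mu>_def algebra_simps)
  define C where "C = ((d * lam)\<^sup>2 + d * lam) / e"
  have "0 < (d * lam)\<^sup>2 + d * lam" using lam by (intro add_pos_pos) (auto simp: d_def)
  then have C: "0 < C" "((d * lam)\<^sup>2 + d * lam) / C = e" using e by (auto simp: C_def)
  define S where "S = (\<lambda>J s. \<Sum>i=k..J. real i * pmf (poisson_pmf s) i)"
  have "(\<lambda>J. S J \<mu>) \<longlonglongrightarrow> \<mu> * p"
    unfolding S_def p_def by (rule sum_heavy_poisson_tendsto[OF \<mu> k])
  then have "\<forall>\<^sub>F J in sequentially. \<mu> * p - \<delta> / 4 < S J \<mu>"
    using \<delta> by (intro order_tendstoD(1)) auto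
  then obtain J where J: "1 \<le> J" "\<mu> * p - \<delta> / 4 < S J \<mu>"
    using eventually_happens[OF eventually_conj[OF _ eventually_ge_at_top[of 1]]] by fastforce
  define y where "y = 2 * d * lam * J\<^sup>2"
  have y: "0 < y" using J lam by (simp add: y_def d_def)
  define \<theta> where "\<theta> = min (1 / J) (\<delta> / (4 * y))"
  have \<theta>: "0 < \<theta>" "\<theta> * J \<le> 1" "2 * d * lam * J\<^sup>2 * \<theta> \<le> \<delta> / 4"
  proof -
    show "0 < \<theta>" using J \<delta> y by (simp add: \<theta>_def)
    have "\<theta> * J \<le> 1 / J * J" by (intro mult_right_mono) (auto simp: \<theta>_def)
    then show "\<theta> * J \<le> 1" using J by simp
    have "y * \<theta> \<le> y * (\<delta> / (4 * y))"
      using y by (intro mult_left_mono) (auto simp: \<theta>_def)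
    also have "\<dots> = \<delta> / 4" using y by simp
    finally show "2 * d * lam * J\<^sup>2 * \<theta> \<le> \<delta> / 4" by (simp only: y_def)
  qed
  \<comment> \<open>Half the limit of \<open>d * t / n\<close>, a lower bound for it once
    \<open>n\<close> is large.\<close>
  define c where "c = d * (x * lam / 2)"
  have c: "0 < c" using x lam by (simp add: c_def d_def)
  define K where "K = lam * d * J * C / c\<^sup>2"
  define h where "h = (\<lambda>n::nat. exp (- (\<theta> * (\<delta> / 4 * n - K))))"
  have "h \<longlonglongrightarrow> 0"
    unfolding h_def using \<theta>(1) \<delta> by real_asymp
  moreover have "\<forall>\<^sub>F n in sequentially.
      config_prob (Suc l) n (jobs lam n) (\<lambda>f. core_size {..<n} k {..<jobs lam n} f = 0) \<le> e + h n"
  proof -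
    \<comment> \<open>The Poisson mean at finite \<open>n\<close>; as it tends to
      \<open>\<mu>\<close>, the finite sum \<open>S J\<close> converges by continuity.\<close>
    define s where "s = (\<lambda>n. real (d * jobs lam n) * (\<tau>0 / n))"
    have s: "s \<longlonglongrightarrow> \<mu>"
    proof -
      have "(\<lambda>n. d * (jobs lam n / n) * \<tau>0) \<longlonglongrightarrow> d * lam * \<tau>0"
        by (intro tendsto_intros jobs_ratio lam)
      then show ?thesis by (simp add: s_def \<mu>_def mult_ac)
    qed
    have s_pos: "\<forall>\<^sub>F n in sequentially. 0 < s n"
      using s \<mu> by (rule order_tendstoD(1))
    have "(\<lambda>n. \<Sum>i=k..J. real i * (s n ^ i / fact i * exp (- s n))) \<longlonglongrightarrow>
        (\<Sum>i=k..J. real i * (\<mu> ^ i / fact i * exp (- \<mu>)))"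
      by (intro tendsto_intros s) auto
    moreover have "(\<Sum>i=k..J. real i * (\<mu> ^ i / fact i * exp (- \<mu>))) = S J \<mu>"
      using \<mu> by (simp add: S_def)
    moreover have "\<forall>\<^sub>F n in sequentially. (\<Sum>i=k..J. real i * (s n ^ i / fact i * exp (- s n))) = S J (s n)"
      using s_pos by eventually_elim (simp add: S_def)
    ultimately have "(\<lambda>n. S J (s n)) \<longlonglongrightarrow> S J \<mu>"
      by (auto intro: Lim_transform_eventually)
    moreover have "(\<lambda>n. real (Suc J) ^ 2 * (real J ^ 2 / (d * jobs lam n) + 2 * (s n * (\<tau>0 / n)))) \<longlonglongrightarrow>
       real (Suc J) ^ 2 * (0 + 2 * (\<mu> * 0))"
    proof -
      have "filterlim (\<lambda>n. lam * n - 1) at_top sequentially" using lam by real_asymp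
      then have "filterlim (\<lambda>n. real (jobs lam n)) at_top sequentially"
        by (rule filterlim_at_top_mono) (use jobs_bounds(2)[OF lam] in \<open>auto intro!: always_eventually less_imp_le\<close>)
      then have "filterlim (\<lambda>n. d * real (jobs lam n)) at_top sequentially"
        by (intro filterlim_tendsto_pos_mult_at_top[OF tendsto_const]) (auto simp: d_def)
      then have 1: "(\<lambda>n. real J ^ 2 / real (d * jobs lam n)) \<longlonglongrightarrow> 0"
        by (intro real_tendsto_divide_at_top[OF tendsto_const]) simp
      have 2: "(\<lambda>n. \<tau>0 / real n) \<longlonglongrightarrow> 0" by real_asymp
      show ?thesis by (intro tendsto_mult tendsto_add tendsto_const 1 2 s)
    qed
    ultimately have "(\<lambda>n. S J (s n) - real (Suc J) ^ 2 * (real J ^ 2 / (d * jobs lam n) + 2 * (s n * (\<tau>0 / n)))) \<longlonglongrightarrow> S J \<mu> - 0"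
      by (intro tendsto_diff) auto
    moreover have "lam * d * x + \<delta> / 2 < S J \<mu> - 0" using J \<mu>p \<delta> by linarith
    ultimately have ev1: "\<forall>\<^sub>F n in sequentially. lam * d * x + \<delta> / 2 <
        S J (s n) - real (Suc J) ^ 2 * (real J ^ 2 / (d * jobs lam n) + 2 * (s n * (\<tau>0 / n)))"
      by (rule order_tendstoD(1))
    \<comment> \<open>The first bound ensures \<open>2 \<le> t\<close>, the second
      \<open>x0 \<le> (t - 1) / (m - 1)\<close> in spite of rounding.\<close>
    define M where "M = max (3 / x) (2 + 2 / (x - x0))"
    have ev2: "\<forall>\<^sub>F n in sequentially. M + 2 \<le> lam * n - 1 \<and> x * lam / 2 * n \<le> x * (lam * n - 1) - 1"
      using lam x by (intro eventually_conj; real_asymp)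
    show ?thesis
      using ev1 ev2 eventually_ge_at_top[of 2]
    proof eventually_elim
      fix n :: nat
      assume th: "lam * d * x + \<delta> / 2 <
          S J (s n) - real (Suc J) ^ 2 * (real J ^ 2 / (d * jobs lam n) + 2 * (s n * (\<tau>0 / n)))"
        and M: "M + 2 \<le> lam * n - 1 \<and> x * lam / 2 * n \<le> x * (lam * n - 1) - 1" and n: "2 \<le> n"
      define m where "m = jobs lam n"
      have m: "m \<le> lam * n" "lam * n - 1 < m" using jobs_bounds[OF lam, of n] by (auto simp: m_def)
      have mM: "M < m" using m M by linarith
      have m3: "3 / x < m" "2 + 2 / (x - x0) < m" using mM by (auto simp: M_def)
      have "2 < 2 + 2 / (x - x0)" using x by simp
      then have m2: "2 < real m" using m3 by linarith
      define t where "t = nat \<lfloor>x * m\<rfloor>"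
      have t: "t \<le> x * m" "x * m - 1 < t"
        using jobs_bounds[OF x(4), of m] by (auto simp: t_def)
      have "3 < x * m" using m3(1) x by (simp add: field_simps)
      then have t2: "2 \<le> t" using t by linarith
      have "x * m \<le> 1 * real m" using x by (intro mult_right_mono) auto
      then have tm: "t \<le> m" using t by linarith
      have "x0 \<le> (real t - 1) / (real m - 1)"
      proof -
        have "2 / (x - x0) < real m - 1" using m3 by linarith
        then have "2 < (real m - 1) * (x - x0)" using x by (simp add: field_simps)
        then have "x0 * (real m - 1) \<le> x * m - 2" using x by (simp add: algebra_simps)
        also have "\<dots> \<le> real t - 1" using t by linarith
        finally show ?thesis using m2 by (simp add: field_simps)
      qed
      then have "x0 ^ l \<le> ((real t - 1) / (real m - 1)) ^ l"
        using x0 by (intro power_mono) auto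
      also have "\<dots> \<le> survival d t m ^ d"
        unfolding d_def by (intro survival_power_ge l t2 tm)
      finally have surv: "\<tau>0 \<le> survival d t m"
        using x0(2) survival_bounds[of d t m] unfolding x0(2) by (auto simp: d_def intro: power_le_imp_le_base)
      let ?H = "heavy k J"
      have ps: "0 \<le> \<tau>0 / n" "\<tau>0 / n \<le> survival d t m / n" "survival d t m / n \<le> 1" "0 < \<tau>0 / n" "\<tau>0 / n \<le> 1/2"
        using \<tau>0 n surv survival_bounds[of d t m] by (auto simp: d_def divide_right_mono field_simps)
      have "lam * d * x + \<delta> / 2 < thin (d * m) (\<tau>0 / n) ?H"
      proof -
        have "(\<Sum>i=k..J. real i * pmf (poisson_pmf (real (d * m) * (\<tau>0 / n))) i) -
            real (Suc J) ^ 2 * (real J ^ 2 / real (d * m) + 2 * real (d * m) * (\<tau>0 / n)\<^sup>2) \<le> thin (d * m) (\<tau>0 / n) ?H"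
          using ps m2 by (intro thin_heavy_ge) (auto simp: d_def heavy_def)
        then show ?thesis
          using th by (simp add: S_def s_def m_def power2_eq_square mult_ac)
      qed
      also have "\<dots> \<le> thin (d * m) (survival d t m / n) ?H"
        by (intro thin_mono_prob ps mono_heavy)
      finally have thin: "lam * d * x + \<delta> / 2 < thin (d * m) (survival d t m / n) ?H" .
      let ?S = "\<lambda>f. square_sum {..<n} (total_mset {..<m} f)"
      let ?c = "\<lambda>f. core_size {..<n} k {..<m} f"
      define \<eta> where "\<eta> = \<bar>- \<theta>\<bar> * J * (C * n) / (real (d * t))\<^sup>2 + (- \<theta> * J)\<^sup>2"
      have ct: "c * n \<le> real (d * t)"
      proof -
        have "x * (lam * n - 1) \<le> x * m" using m x by (intro mult_left_mono) auto
        then have "x * lam / 2 * n \<le> t" using M t by linarith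
        then have "d * (x * lam / 2 * n) \<le> d * real t" by (intro mult_left_mono) auto
        then show ?thesis by (simp add: c_def)
      qed
      have "config_prob d n m (\<lambda>f. ?c f = 0) \<le>
        config_prob d n m (\<lambda>f. C * n < ?S f \<or> (?c f = 0 \<and> ?S f \<le> C * n))"
      proof (rule config_prob_mono)
        show "0 < n" using n by simp
        show "C * n < ?S f \<or> (?c f = 0 \<and> ?S f \<le> C * n)" if "?c f = 0" for f
          using that by (meson not_less)
      qed
      also have "\<dots> \<le> config_prob d n m (\<lambda>f. C * n < ?S f) + config_prob d n m (\<lambda>f. ?c f = 0 \<and> ?S f \<le> C * n)"
        by (rule config_prob_disj)
      also have "\<dots> \<le> e + h n"
      proof (intro add_mono)
        show "config_prob d n m (\<lambda>f. C * n < ?S f) \<le> e"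
          using config_prob_square_sum_le[OF _ lam m(1) C(1), of d] n unfolding C(2) by simp
        \<comment> \<open>Here the parameter is \<open>- \<theta>\<close>, and
          \<open>\<kappa> = d * t\<close> is the trivial upper bound for the number of heavy points
          among \<open>t\<close> hyperedges.\<close>
        have "card {f \<in> configs {..<n} d {..<m}. ?c f = 0 \<and> ?S f \<le> C * n} \<le>
          real n ^ (d * m) * exp (- \<theta> * (n * thin (d * m) (survival d t (card {..<m}) / n) ?H - d * t) +
            (card {..<m} - t) * (d * \<eta>) + (d * m) * (- \<theta> * J)\<^sup>2)"
          unfolding \<eta>_def d_def
        proof (rule card_core_size_le)
          fix F f assume F: "F \<subseteq> {..<m}" "card F = t" and f: "f \<in> configs {..<n} (Suc l) F"
          have finF: "finite F" using F finite_subset by blast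
          have "thin_total {..<n} ?H 1 (total_mset F f) \<le> size (total_mset F f)"
            by (rule thin_total_heavy_le) (use f in \<open>auto simp: set_total_mset finF words_def PiE_def Pi_def\<close>)
          then have "thin_total {..<n} ?H 1 (total_mset F f) - real (Suc l * t) \<le> 0"
            using size_total_mset[OF f] F by simp
          then show "0 \<le> - \<theta> * (thin_total {..<n} ?H 1 (total_mset F f) - real (Suc l * t))"
            using \<theta>(1) by (simp add: mult_nonneg_nonpos del: of_nat_Suc)
        qed (use n t2 tm k \<theta> in auto)
        then have "config_prob d n m (\<lambda>f. ?c f = 0 \<and> ?S f \<le> C * n) \<le>
            exp (- \<theta> * (n * thin (d * m) (survival d t m / n) ?H - d * t) + (m - t) * (d * \<eta>) + (d * m) * (- \<theta> * J)\<^sup>2)"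
          using n by (subst config_prob_eq) (auto simp: pos_divide_le_eq mult_ac)
        also have "\<dots> \<le> h n"
          unfolding h_def
        proof (subst exp_le_cancel_iff)
          have 1: "- \<theta> * (n * thin (d * m) (survival d t m / n) ?H - d * t) \<le> - \<theta> * (\<delta> / 2 * n)"
          proof -
            have "d * real t \<le> d * (x * (lam * n))"
              using t m x by (intro mult_left_mono order.trans[OF t(1)] ) auto
            moreover have "n * (lam * d * x + \<delta> / 2) \<le> n * thin (d * m) (survival d t m / n) ?H"
              using thin by (intro mult_left_mono) auto
            ultimately have "\<delta> / 2 * n \<le> n * thin (d * m) (survival d t m / n) ?H - d * t"
              by (simp add: algebra_simps)
            then show ?thesis using \<theta>(1) by simp
          qed
          have "(m - t) * (d * \<eta>) \<le> (lam * n) * (d * \<eta>)"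
            using m C \<theta> by (intro mult_right_mono) (auto simp: \<eta>_def)
          also have "\<dots> = (lam * n) * (d * (\<theta> * J * (C * n) / (real (d * t))\<^sup>2)) + d * lam * n * (\<theta> * J)\<^sup>2"
            using \<theta>(1) by (simp add: \<eta>_def algebra_simps)
          also have "(lam * n) * (d * (\<theta> * J * (C * n) / (real (d * t))\<^sup>2)) \<le>
              (lam * n) * (d * (\<theta> * J * (C * n) / (c * n)\<^sup>2))"
          proof (intro mult_left_mono divide_left_mono power_mono ct)
            show "0 < (real (d * t))\<^sup>2 * (c * n)\<^sup>2" 
              using t2 n c unfolding d_def by (intro mult_pos_pos zero_less_power) (auto intro: add_pos_nonneg)
          qed (use lam C \<theta> c in auto)
          also have "\<dots> = \<theta> * K"
            using n c by (simp add: K_def field_simps power2_eq_square)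
          finally have 2: "(m - t) * (d * \<eta>) \<le> \<theta> * K + d * lam * n * (\<theta> * J)\<^sup>2" by simp
          have 3: "(d * m) * (- \<theta> * J)\<^sup>2 \<le> d * (lam * n) * (\<theta> * J)\<^sup>2"
            using m by (auto simp: power2_eq_square intro!: mult_right_mono mult_left_mono)
          have "2 * d * lam * J\<^sup>2 * \<theta> * (\<theta> * n) \<le> \<delta> / 4 * (\<theta> * n)"
            using \<theta> by (intro mult_right_mono) auto
          then have "2 * (d * lam * n * (\<theta> * J)\<^sup>2) \<le> \<theta> * (\<delta> / 4 * n)"
            by (simp add: power2_eq_square mult_ac)
          with 1 2 3 show "- \<theta> * (n * thin (d * m) (survival d t m / n) ?H - d * t) + (m - t) * (d * \<eta>) + (d * m) * (- \<theta> * J)\<^sup>2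
             \<le> - (\<theta> * (\<delta> / 4 * n - K))"
            by (simp add: algebra_simps)
        qed
        finally show "config_prob d n m (\<lambda>f. ?c f = 0 \<and> ?S f \<le> C * n) \<le> h n" .
      qed
      finally show "config_prob (Suc l) n (jobs lam n) (\<lambda>f. core_size {..<n} k {..<jobs lam n} f = 0) \<le> e + h n"
        by (simp only: d_def m_def)
    qed
  qed
  ultimately show "\<exists>h. h \<longlonglongrightarrow> 0 \<and> (\<forall>\<^sub>F n in sequentially.
      config_prob (Suc l) n (jobs lam n) (\<lambda>f. core_size {..<n} k {..<jobs lam n} f = 0) \<le> e + h n)"
    by blast
qed (rule config_prob_nonneg)

section \<open>First moment bound for small cores\<close>

lemma choose_le_exp:
  assumes "0 < s"
  shows "real (n choose s) \<le> (exp 1 * n / s) ^ s"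
proof -
  \<comment> \<open>That this probability is at most 1 says
    \<open>s ^ s \<le> fact s * exp s\<close>, a cheap form of Stirling's bound.\<close>
  have "pmf (poisson_pmf (real s)) s \<le> 1" by (rule pmf_le_1)
  then have "real s ^ s \<le> fact s * exp (real s)"
    using assms by (simp add: exp_minus field_simps)
  also have "exp (real s) = exp 1 ^ s" by (simp flip: exp_of_nat_mult)
  finally have ss: "real s ^ s \<le> fact s * exp 1 ^ s" .
  have "real ((n choose s) * fact s) \<le> real (n ^ s)"
    by (intro of_nat_mono binomial_fact_pow)
  then have "real (n choose s) * fact s \<le> real n ^ s" by simp
  then have le: "real (n choose s) * fact s * exp 1 ^ s \<le> real n ^ s * exp 1 ^ s"
    by (intro mult_right_mono) auto
  have "real (n choose s) * real s ^ s \<le> real (n choose s) * (fact s * exp 1 ^ s)"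
    using ss by (intro mult_left_mono) auto
  also have "\<dots> \<le> real n ^ s * exp 1 ^ s" using le by (simp only: mult.assoc)
  finally have "real (n choose s) * real s ^ s \<le> (exp 1 * n) ^ s"
    by (simp only: power_mult_distrib mult.commute)
  then show ?thesis
    using assms by (simp add: power_divide pos_le_divide_eq)
qed

text \<open>Union bound over \<open>W\<close> and over sets of \<open>a\<close> hyperedges; each
  hyperedge lies in \<open>W\<close> with probability \<open>(s / n) ^ d\<close>, independently of
  the others.\<close>

lemma config_prob_dense_le:
  assumes n: "0 < n"
  shows "config_prob d n m (\<lambda>f. \<exists>W\<subseteq>{..<n}. card W = s \<and> a \<le> card (inner_edges {..<m} f W)) \<le>
    real (n choose s) * real (m choose a) * (s / n) ^ (d * a)"
proof -
  let ?WW = "{W. W \<subseteq> {..<n} \<and> card W = s}" and ?AA = "{A. A \<subseteq> {..<m} \<and> card A = a}"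
  let ?F = "\<lambda>W A. PiE {..<m} (\<lambda>e. if e \<in> A then words W d else words {..<n} d)"
  have "{f \<in> configs {..<n} d {..<m}. \<exists>W\<subseteq>{..<n}. card W = s \<and> a \<le> card (inner_edges {..<m} f W)}
      \<subseteq> (\<Union>W\<in>?WW. \<Union>A\<in>?AA. ?F W A)"
  proof
    fix f assume "f \<in> {f \<in> configs {..<n} d {..<m}. \<exists>W\<subseteq>{..<n}. card W = s \<and> a \<le> card (inner_edges {..<m} f W)}"
    then obtain W where f: "f \<in> configs {..<n} d {..<m}" and W: "W \<subseteq> {..<n}" "card W = s"
      "a \<le> card (inner_edges {..<m} f W)" by auto
    obtain A where A: "A \<subseteq> inner_edges {..<m} f W" "card A = a"
      using obtain_subset_with_card_n[OF W(3)] by metis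
    have "f \<in> ?F W A"
      using f A by (auto simp: PiE_def Pi_def words_def inner_edges_def)
    moreover have "A \<in> ?AA" using A by (auto simp: inner_edges_def)
    ultimately show "f \<in> (\<Union>W\<in>?WW. \<Union>A\<in>?AA. ?F W A)" using W by blast
  qed
  then have "card {f \<in> configs {..<n} d {..<m}. \<exists>W\<subseteq>{..<n}. card W = s \<and> a \<le> card (inner_edges {..<m} f W)}
      \<le> card (\<Union>W\<in>?WW. \<Union>A\<in>?AA. ?F W A)"
    by (intro card_mono finite_UN_I finite_PiE) (auto dest: finite_subset)
  also have "\<dots> \<le> (\<Sum>W\<in>?WW. card (\<Union>A\<in>?AA. ?F W A))"
    by (intro card_UN_le) auto
  also have "\<dots> \<le> (\<Sum>W\<in>?WW. \<Sum>A\<in>?AA. card (?F W A))"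
    by (intro sum_mono card_UN_le) auto
  also have "\<dots> = (\<Sum>W\<in>?WW. \<Sum>A\<in>?AA. s ^ (d * a) * n ^ (d * (m - a)))"
  proof (intro sum.cong refl)
    fix W A assume W: "W \<in> ?WW" and A: "A \<in> ?AA"
    have finW: "finite W" using W finite_subset by auto
    have finA: "finite A" using A finite_subset by auto
    have "card (?F W A) = (\<Prod>e<m. if e \<in> A then s ^ d else n ^ d)"
      using W finW by (auto simp: card_PiE card_words intro!: prod.cong)
    also have "\<dots> = (s ^ d) ^ card ({..<m} \<inter> A) * (n ^ d) ^ card ({..<m} \<inter> - A)"
      by (simp add: prod.If_cases)
    also have "{..<m} \<inter> A = A" using A by auto
    also have "{..<m} \<inter> - A = {..<m} - A" by auto
    also have "card ({..<m} - A) = m - a" using A finA by (simp add: card_Diff_subset)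
    finally show "card (?F W A) = s ^ (d * a) * n ^ (d * (m - a))"
      using A by (simp add: power_mult)
  qed
  also have "\<dots> = (n choose s) * (m choose a) * (s ^ (d * a) * n ^ (d * (m - a)))"
    using n_subsets[of "{..<n}" s] n_subsets[of "{..<m}" a] by simp
  finally have le: "card {f \<in> configs {..<n} d {..<m}. \<exists>W\<subseteq>{..<n}. card W = s \<and> a \<le> card (inner_edges {..<m} f W)} \<le>
    (n choose s) * (m choose a) * (s ^ (d * a) * n ^ (d * (m - a)))" .
  have "config_prob d n m (\<lambda>f. \<exists>W\<subseteq>{..<n}. card W = s \<and> a \<le> card (inner_edges {..<m} f W)) \<le>
    real ((n choose s) * (m choose a) * (s ^ (d * a) * n ^ (d * (m - a)))) / real n ^ (d * m)"
    unfolding config_prob_eq[OF n] by (intro divide_right_mono of_nat_mono le) auto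
  also have "\<dots> = real (n choose s) * real (m choose a) * (s / n) ^ (d * a)"
  proof (cases "a \<le> m")
    case True
    then have "d * m = d * a + d * (m - a)" by (simp add: diff_mult_distrib2)
    then have "real n ^ (d * m) = real n ^ (d * a) * real n ^ (d * (m - a))" by (simp add: power_add)
    then show ?thesis using n by (simp add: power_divide)
  qed (simp add: binomial_eq_0)
  finally show ?thesis .
qed

text \<open>The \<open>d\<close>-th power is estimated, so that \<open>3 * s \<le> d * a\<close> can
  be used as an exponent without rounding. Each vertex of the dense set then contributes
  \<open>(exp 1 / z) ^ d * y ^ 3\<close>, of order \<open>z ^ (2 * d - 3)\<close>, a positive power
  for \<open>d \<ge> 2\<close>. With minimum degree \<open>2\<close> in place of \<open>3\<close>
  the exponent would be \<open>d - 2\<close>, which vanishes for graphs.\<close>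

lemma dense_bound:
  fixes lam c K z :: real
  assumes d: "2 \<le> d" and s: "1 \<le> s" and n: "0 < n" and a: "3 * s \<le> d * a" and lam: "0 < lam" and m: "m \<le> lam * n"
    and c: "c = exp 1 * lam * d / 3" and K: "K = exp 1 ^ d * c ^ 3" and z: "z = s / n"
    and small: "z \<le> 1" "c * z \<le> 1" "K * z \<le> (1 / 4) ^ d"
  shows "real (n choose s) * real (m choose a) * (s / n) ^ (d * a) \<le> root d (K / n) * (1 / 2) ^ (s - 1)"
proof -
  define y where "y = c * z ^ (d - 1)"
  define T where "T = real (n choose s) * real (m choose a) * z ^ (d * a)"
  have z0: "0 < z" using s n by (simp add: z)
  have c0: "0 < c" using lam d by (simp add: c)
  have K0: "0 < K" using c0 by (simp add: K)
  have a0: "0 < a" using a s by (cases a) auto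
  have y0: "0 < y" using c0 z0 by (simp add: y_def)
  have "z ^ (d - 1) \<le> z ^ 1" using d z0 small by (intro power_decreasing) auto
  then have "y \<le> c * z" using c0 by (simp add: y_def)
  then have y1: "y \<le> 1" using small by linarith
  have y: "exp 1 * m / a * z ^ d \<le> y"
  proof -
    have "3 * real s \<le> d * real a" using a by (metis of_nat_le_iff of_nat_mult of_nat_numeral)
    then have "1 / real a \<le> d / (3 * real s)" using a0 s by (simp add: field_simps)
    then have "m * (1 / a) \<le> (lam * n) * (d / (3 * s))"
      using m lam by (intro mult_mono) auto
    also have "\<dots> = lam * d / (3 * z)" using n by (simp add: z)
    finally have "exp 1 * (m * (1 / a)) * z ^ d \<le> exp 1 * (lam * d / (3 * z)) * z ^ d"
      using z0 by (intro mult_right_mono mult_left_mono) auto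
    also have "\<dots> = c * (z ^ d / z)" by (simp add: c)
    also have "z ^ d / z = z ^ (d - 1)" using d z0 by (cases d) auto
    finally show ?thesis by (simp add: y_def)
  qed
  have T0: "0 \<le> T" using z0 by (simp add: T_def)
  have "T \<le> (exp 1 * n / s) ^ s * (exp 1 * m / a) ^ a * z ^ (d * a)"
    unfolding T_def using s a0 z0 by (intro mult_right_mono mult_mono choose_le_exp) auto
  also have "\<dots> = (exp 1 / z) ^ s * (exp 1 * m / a * z ^ d) ^ a"
  proof -
    have "(exp 1 * m / a * z ^ d) ^ a = (exp 1 * m / a) ^ a * z ^ (d * a)"
      by (simp only: power_mult_distrib power_mult)
    moreover have "exp 1 * n / s = exp 1 / z" by (simp add: z)
    ultimately show ?thesis by (simp only: mult.assoc)
  qed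
  also have "\<dots> \<le> (exp 1 / z) ^ s * y ^ a"
    using y z0 by (intro mult_left_mono power_mono) auto
  finally have "T ^ d \<le> ((exp 1 / z) ^ s * y ^ a) ^ d"
    using T0 by (intro power_mono)
  also have "\<dots> = (exp 1 / z) ^ (s * d) * y ^ (d * a)"
    by (simp add: power_mult_distrib mult.commute flip: power_mult)
  also have "\<dots> \<le> (exp 1 / z) ^ (s * d) * y ^ (3 * s)"
    using y0 y1 a z0 by (intro mult_left_mono power_decreasing) auto
  also have "\<dots> = ((exp 1 / z) ^ d * y ^ 3) ^ s"
    by (simp add: power_mult_distrib mult.commute flip: power_mult)
  also have "(exp 1 / z) ^ d * y ^ 3 = K * z ^ (2 * d - 3)"
  proof -
    have "(z ^ (d - 1)) ^ 3 = z ^ d * z ^ (2 * d - 3)"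
      unfolding power_mult[symmetric] power_add[symmetric] using d by (intro arg_cong[where f = "(^) z"]) auto
    then show ?thesis
      using z0 by (simp add: y_def K power_mult_distrib power_divide)
  qed
  also have "(K * z ^ (2 * d - 3)) ^ s \<le> (K * z) ^ s"
  proof (intro power_mono mult_left_mono)
    have "z ^ (2 * d - 3) \<le> z ^ 1" using d z0 small by (intro power_decreasing) auto
    then show "z ^ (2 * d - 3) \<le> z" by simp
  qed (use K0 z0 in auto)
  \<comment> \<open>One factor is kept to produce \<open>K / n\<close>, which tends to
    \<open>0\<close>. The others are at most \<open>(1 / 4) ^ d\<close>, small enough to absorb the
    factor \<open>s\<close> and still give a convergent geometric series.\<close>
  also have "\<dots> = (K * z) * (K * z) ^ (s - 1)" using s by (cases s) auto
  also have "\<dots> \<le> (K * z) * ((1 / 4) ^ d) ^ (s - 1)"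
    using K0 z0 small by (intro mult_left_mono power_mono) auto
  also have "\<dots> = (K / n) * real s * (((1 / 4) ^ (s - 1)) ^ d)"
    by (simp add: z mult.commute flip: power_mult)
  also have "\<dots> \<le> root d (K / n) ^ d * real s ^ d * (((1 / 4) ^ (s - 1)) ^ d)"
  proof (intro mult_right_mono mult_mono)
    show "K / n \<le> root d (K / n) ^ d" using d K0 by simp
    have "real s ^ 1 \<le> real s ^ d" using d s by (intro power_increasing) auto
    then show "real s \<le> real s ^ d" by simp
  qed (use K0 d in auto)
  also have "\<dots> = (root d (K / n) * (real s * (1 / 4) ^ (s - 1))) ^ d"
    by (simp add: power_mult_distrib)
  finally have le: "T ^ d \<le> (root d (K / n) * (real s * (1 / 4) ^ (s - 1))) ^ d" .
  have r0: "0 \<le> root d (K / n)" using d K0 by simp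
  then have "0 \<le> root d (K / n) * (real s * (1 / 4) ^ (s - 1))" by simp
  from power_mono_iff[OF T0 this, of d] le d
  have "T \<le> root d (K / n) * (real s * (1 / 4) ^ (s - 1))" by simp
  also have "\<dots> \<le> root d (K / n) * (1 / 2) ^ (s - 1)"
  proof (intro mult_left_mono r0)
    have "Suc j \<le> 2 ^ j" for j :: nat by (induction j) auto
    from this[of "s - 1"] have "s \<le> 2 ^ (s - 1)" using s by simp
    then have "real s \<le> 2 ^ (s - 1)" by (metis of_nat_le_iff of_nat_numeral of_nat_power)
    then have "real s * (1 / 4) ^ (s - 1) \<le> 2 ^ (s - 1) * (1 / 4) ^ (s - 1)"
      by (intro mult_right_mono) auto
    also have "\<dots> = (1 / 2) ^ (s - 1)" by (simp flip: power_mult_distrib)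
    finally show "real s * (1 / 4) ^ (s - 1) \<le> (1 / 2) ^ (s - 1)" .
  qed
  finally show ?thesis by (simp add: T_def z)
qed

lemma stable_card_le:
  assumes fin: "finite E" "finite V" and f: "f \<in> configs V d E" and W: "W \<subseteq> V" "stable k E f W"
  shows "k * card W \<le> d * card (inner_edges E f W)"
proof -
  let ?I = "inner_edges E f W"
  have finI: "finite ?I" by (rule finite_subset[OF inner_edges_subset fin(1)])
  have "real (\<Sum>v\<in>W. count (total_mset ?I f) v) = real (size (total_mset ?I f))"
    using sum_count_eq_size[of W "total_mset ?I f"] W fin finite_subset[of W V]
    by (auto simp: set_total_mset finI inner_edges_def)
  then have sum: "(\<Sum>v\<in>W. count (total_mset ?I f) v) = size (total_mset ?I f)"
    by (rule of_nat_eq_iff[THEN iffD1])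
  have "(\<lambda>e\<in>?I. f e) \<in> configs V d ?I"
    using f by (auto simp: inner_edges_def PiE_def Pi_def)
  then have "size (total_mset ?I (\<lambda>e\<in>?I. f e)) = d * card ?I" by (rule size_total_mset)
  then have size: "size (total_mset ?I f) = d * card ?I" by (simp add: total_mset_def)
  have "k * card W = (\<Sum>v\<in>W. k)" by simp
  also have "\<dots> \<le> (\<Sum>v\<in>W. count (total_mset ?I f) v)"
    using W by (intro sum_mono) (auto simp: stable_def)
  finally show ?thesis unfolding sum size .
qed

lemma small_core_unlikely:
  fixes lam :: real
  assumes d: "2 \<le> d" and k: "3 \<le> k" and lam: "0 < lam"
  obtains \<epsilon> :: real where "0 < \<epsilon>"
    "(\<lambda>n. config_prob d n (jobs lam n) (\<lambda>f. 0 < core_size {..<n} k {..<jobs lam n} f \<and>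
        core_size {..<n} k {..<jobs lam n} f < \<epsilon> * n)) \<longlonglongrightarrow> 0"
proof -
  define c where "c = exp 1 * lam * d / 3"
  define K where "K = exp 1 ^ d * c ^ 3"
  have c: "0 < c" using lam d by (simp add: c_def)
  have K: "0 < K" using c by (simp add: K_def)
  \<comment> \<open>The smallness conditions of \<open>dense_bound\<close> on
    \<open>z = s / n\<close>. The division by \<open>d\<close> below converts this bound on vertices
    into one on hyperedges.\<close>
  define \<epsilon>' where "\<epsilon>' = min 1 (min (1 / c) ((1 / 4) ^ d / K))"
  have \<epsilon>': "0 < \<epsilon>'" "\<epsilon>' \<le> 1" "c * \<epsilon>' \<le> 1" "K * \<epsilon>' \<le> (1 / 4) ^ d"
  proof -
    have "\<epsilon>' \<le> 1 / c" "\<epsilon>' \<le> (1 / 4) ^ d / K" by (auto simp: \<epsilon>'_def)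
    then show "c * \<epsilon>' \<le> 1" "K * \<epsilon>' \<le> (1 / 4) ^ d" using c K by (auto simp: field_simps)
  qed (use c K in \<open>auto simp: \<epsilon>'_def\<close>)
  define \<epsilon> where "\<epsilon> = \<epsilon>' / d"
  have \<epsilon>: "0 < \<epsilon>" using \<epsilon>' d by (simp add: \<epsilon>_def)
  have bound: "config_prob d n (jobs lam n) (\<lambda>f. 0 < core_size {..<n} k {..<jobs lam n} f \<and>
        core_size {..<n} k {..<jobs lam n} f < \<epsilon> * n) \<le> root d (K / n) * 2" if n: "0 < n" for n
  proof -
    define m where "m = jobs lam n"
    have m: "m \<le> lam * n" using jobs_bounds[OF lam] by (simp add: m_def)
    let ?c = "\<lambda>f. core_size {..<n} k {..<m} f"
    \<comment> \<open>\<open>3 * s / d\<close> rounded up.\<close>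
    define a where "a = (\<lambda>s. (3 * s + (d - 1)) div d)"
    have a: "3 * s \<le> d * a s" for s
    proof -
      have "3 * s + (d - 1) = d * a s + (3 * s + (d - 1)) mod d" by (simp add: a_def)
      moreover have "(3 * s + (d - 1)) mod d < d" using d by simp
      ultimately show ?thesis by linarith
    qed
    have a_le: "a s \<le> q" if "3 * s \<le> d * q" for s q
    proof -
      have "a s \<le> (d * q + (d - 1)) div d" unfolding a_def using that by (intro div_le_mono) simp
      also have "\<dots> = q" using d by (intro div_nat_eqI) auto
      finally show ?thesis .
    qed
    define S where "S = {s \<in> {1..n}. s \<le> \<epsilon>' * n}"
    have "config_prob d n m (\<lambda>f. 0 < ?c f \<and> ?c f < \<epsilon> * n) \<le>
      config_prob d n m (\<lambda>f. \<exists>s\<in>S. \<exists>W\<subseteq>{..<n}. card W = s \<and> a s \<le> card (inner_edges {..<m} f W))"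
    proof (rule config_prob_mono[OF n])
      fix f assume f: "f \<in> configs {..<n} d {..<m}" and q: "0 < ?c f \<and> ?c f < \<epsilon> * n"
      obtain W where W: "W \<subseteq> {..<n}" "stable k {..<m} f W" "?c f = card (inner_edges {..<m} f W)"
        using core_size_attained[of "{..<m}" "{..<n}" k f] by auto
      have finW: "finite W" using W finite_subset by auto
      have "card W * 3 \<le> k * card W" using k by simp
      also have "\<dots> \<le> d * ?c f" unfolding W(3) using f W by (intro stable_card_le) auto
      finally have le: "3 * card W \<le> d * ?c f" by simp
      obtain e where e: "e \<in> inner_edges {..<m} f W"
        using q W by (metis card.empty ex_in_conv less_numeral_extra(3))
      then have "set (f e) \<subseteq> W" "length (f e) = d"
        using f by (auto simp: inner_edges_def PiE_def Pi_def words_def)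
      then have "W \<noteq> {}" using d by (cases "f e") auto
      then have "1 \<le> card W" using finW by (simp add: Suc_leI card_gt_0_iff)
      moreover have "card W \<le> n" using card_mono[OF _ W(1)] by simp
      moreover have "card W \<le> \<epsilon>' * n"
      proof -
        have "card W \<le> d * ?c f" using le by linarith
        then have "real (card W) \<le> real (d * ?c f)" by (rule of_nat_mono)
        also have "\<dots> = d * real (?c f)" by simp
        also have "\<dots> \<le> d * (\<epsilon> * n)" using q by (intro mult_left_mono) auto
        also have "\<dots> = \<epsilon>' * n" using d by (simp add: \<epsilon>_def)
        finally show ?thesis .
      qed
      ultimately have "card W \<in> S" by (simp add: S_def)
      moreover have "a (card W) \<le> card (inner_edges {..<m} f W)"
        using a_le[OF le] W by simp
      ultimately show "\<exists>s\<in>S. \<exists>W\<subseteq>{..<n}. card W = s \<and> a s \<le> card (inner_edges {..<m} f W)"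
        using W by blast
    qed
    also have "\<dots> \<le> (\<Sum>s\<in>S. config_prob d n m (\<lambda>f. \<exists>W\<subseteq>{..<n}. card W = s \<and> a s \<le> card (inner_edges {..<m} f W)))"
      by (rule config_prob_Bex) (simp add: S_def)
    also have "\<dots> \<le> (\<Sum>s\<in>S. root d (K / n) * (1 / 2) ^ (s - 1))"
    proof (intro sum_mono order.trans[OF config_prob_dense_le[OF n]])
      fix s assume s: "s \<in> S"
      define z where "z = s / n"
      have z: "0 \<le> z" "z \<le> \<epsilon>'" using s n by (auto simp: z_def S_def field_simps)
      have zc: "c * z \<le> c * \<epsilon>'" "K * z \<le> K * \<epsilon>'" using z c K by auto
      show "real (n choose s) * real (m choose a s) * (s / n) ^ (d * a s) \<le> root d (K / n) * (1 / 2) ^ (s - 1)"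
        using s z zc \<epsilon>' by (intro dense_bound[OF d _ n a lam m c_def K_def z_def]) (auto simp: S_def)
    qed
    also have "\<dots> \<le> (\<Sum>s\<in>{1..n}. root d (K / n) * (1 / 2) ^ (s - 1))"
      using d K by (intro sum_mono2) (auto simp: S_def)
    also have "\<dots> = root d (K / n) * (\<Sum>s<n. (1 / 2) ^ s)"
      unfolding sum_distrib_left[symmetric] using n
      by (intro arg_cong2[where f = "(*)"] refl sum.reindex_bij_witness[of _ Suc "\<lambda>s. s - 1"]) auto
    also have "\<dots> \<le> root d (K / n) * 2"
    proof (intro mult_left_mono)
      show "(\<Sum>s<n. (1 / 2 :: real) ^ s) \<le> 2" by (subst sum_gp_strict) auto
    qed (use d K in auto)
    finally show ?thesis by (simp add: m_def)
  qed
  have "(\<lambda>n. root d (K / real n) * 2) \<longlonglongrightarrow> root d 0 * 2"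
    by (intro tendsto_intros)
  then have lim: "(\<lambda>n. root d (K / real n) * 2) \<longlonglongrightarrow> 0" by simp
  show ?thesis
  proof (rule that[OF \<epsilon>], rule tendsto_sandwich[OF _ _ tendsto_const lim])
    show "\<forall>\<^sub>F n in sequentially. config_prob d n (jobs lam n) (\<lambda>f. 0 < core_size {..<n} k {..<jobs lam n} f \<and>
        core_size {..<n} k {..<jobs lam n} f < \<epsilon> * n) \<le> root d (K / n) * 2"
      using eventually_gt_at_top[of 0] by eventually_elim (rule bound)
  qed (simp add: config_prob_nonneg)
qed

section \<open>The threshold in terms of gamma\<close>

lemma gamma_le:
  assumes "0 < \<mu>"
  shows "gamma k d \<le> \<mu> * fact (d - 1) / measure_pmf.prob (poisson_pmf \<mu>) {k - 1..} ^ (d - 1)"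
  unfolding gamma_def
  by (rule cINF_lower) (use assms in \<open>auto intro!: bdd_belowI[of _ 0]\<close>)

lemma gamma_less_obtain:
  assumes "gamma k d < x"
  obtains \<mu> where "0 < \<mu>" "\<mu> * fact (d - 1) / measure_pmf.prob (poisson_pmf \<mu>) {k - 1..} ^ (d - 1) < x"
  using assms unfolding gamma_def by (subst (asm) cINF_less_iff) (auto intro!: bdd_belowI[of _ 0])

lemma poisson_prob_atLeast_pos:
  assumes "0 < \<mu>"
  shows "0 < measure_pmf.prob (poisson_pmf \<mu>) {k..}"
proof -
  have "0 < pmf (poisson_pmf \<mu>) k" using assms by simp
  also have "\<dots> = measure_pmf.prob (poisson_pmf \<mu>) {k}" by (simp add: pmf.rep_eq)
  also have "\<dots> \<le> measure_pmf.prob (poisson_pmf \<mu>) {k..}"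
    by (intro measure_pmf.finite_measure_mono) auto
  finally show ?thesis .
qed

text \<open>As \<open>gamma\<close> is an infimum, every \<open>\<mu>\<close> satisfies the
  subcriticality condition with the same ratio \<open>\<rho>0 < 1\<close>. Cores below and above
  \<open>\<epsilon> * n\<close> hyperedges are then excluded separately.\<close>

lemma core_unlikely:
  fixes lam :: real
  assumes d: "2 \<le> d" and k: "3 \<le> k" and lam: "0 < lam" and g: "lam * fact d < gamma k d"
  shows "(\<lambda>n. config_prob d n (jobs lam n) (\<lambda>f. 0 < core_size {..<n} k {..<jobs lam n} f)) \<longlonglongrightarrow> 0"
proof -
  obtain l where l: "d = Suc l" "1 \<le> l" using d by (cases d) auto
  define \<rho>0 where "\<rho>0 = lam * fact d / gamma k d"
  have g0: "0 < gamma k d" using g lam by (smt (verit) fact_gt_zero mult_pos_pos)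
  have \<rho>0: "0 < \<rho>0" "\<rho>0 < 1" using g g0 lam by (auto simp: \<rho>0_def)
  define \<rho> where "\<rho> = root l \<rho>0"
  have \<rho>: "0 \<le> \<rho>" "\<rho> < 1" "\<rho> ^ l = \<rho>0" using \<rho>0 l by (auto simp: \<rho>_def)
  have P: "lam * Suc l * measure_pmf.prob (poisson_pmf \<mu>) {k - 1..} ^ l \<le> \<rho> ^ l * \<mu>" if \<mu>: "0 < \<mu>" for \<mu>
  proof -
    let ?P = "measure_pmf.prob (poisson_pmf \<mu>) {k - 1..}"
    have "gamma k d * ?P ^ l \<le> \<mu> * fact l"
      using gamma_le[OF \<mu>, of k d] poisson_prob_atLeast_pos[OF \<mu>, of "k - 1"] l by (simp add: pos_le_divide_eq)
    then have "\<rho>0 * (gamma k d * ?P ^ l) \<le> \<rho>0 * (\<mu> * fact l)" using \<rho>0 by (intro mult_left_mono) auto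
    moreover have "\<rho>0 * gamma k d = lam * Suc l * fact l" 
    proof -
      have "\<rho>0 * gamma k d = lam * fact d" using g0 by (simp add: \<rho>0_def)
      then show ?thesis unfolding l(1) fact_Suc by simp
    qed
    ultimately have "fact l * (lam * Suc l * ?P ^ l) \<le> fact l * (\<rho>0 * \<mu>)"
      by (metis mult.assoc mult.commute)
    then show ?thesis unfolding \<rho> by (rule mult_left_le_imp_le) simp
  qed
  obtain \<epsilon> :: real where \<epsilon>: "0 < \<epsilon>" and small:
    "(\<lambda>n. config_prob d n (jobs lam n) (\<lambda>f. 0 < core_size {..<n} k {..<jobs lam n} f \<and>
        core_size {..<n} k {..<jobs lam n} f < \<epsilon> * n)) \<longlonglongrightarrow> 0"
    using small_core_unlikely[OF d k lam] .
  have large: "(\<lambda>n. config_prob d n (jobs lam n) (\<lambda>f. \<epsilon> * n \<le> core_size {..<n} k {..<jobs lam n} f)) \<longlonglongrightarrow> 0"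
    unfolding l(1) by (rule large_core_unlikely[OF l(2) _ lam \<rho>(1,2) P \<epsilon>]) (use k in auto)
  show ?thesis
  proof (rule tendsto_sandwich[OF _ _ tendsto_const])
    show "\<forall>\<^sub>F n in sequentially. config_prob d n (jobs lam n) (\<lambda>f. 0 < core_size {..<n} k {..<jobs lam n} f) \<le>
      config_prob d n (jobs lam n) (\<lambda>f. 0 < core_size {..<n} k {..<jobs lam n} f \<and>
        core_size {..<n} k {..<jobs lam n} f < \<epsilon> * n) +
      config_prob d n (jobs lam n) (\<lambda>f. \<epsilon> * n \<le> core_size {..<n} k {..<jobs lam n} f)"
      using eventually_gt_at_top[of 0]
    proof eventually_elim
      fix n :: nat assume "0 < n"
      let ?c = "\<lambda>f. core_size {..<n} k {..<jobs lam n} f"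
      have "config_prob d n (jobs lam n) (\<lambda>f. 0 < ?c f) \<le>
          config_prob d n (jobs lam n) (\<lambda>f. (0 < ?c f \<and> ?c f < \<epsilon> * n) \<or> \<epsilon> * n \<le> ?c f)"
      proof (rule config_prob_mono[OF \<open>0 < n\<close>])
        fix f assume "0 < ?c f"
        then show "(0 < ?c f \<and> ?c f < \<epsilon> * n) \<or> \<epsilon> * n \<le> ?c f" by (meson not_le)
      qed
      also note config_prob_disj
      finally show "config_prob d n (jobs lam n) (\<lambda>f. 0 < ?c f) \<le>
        config_prob d n (jobs lam n) (\<lambda>f. 0 < ?c f \<and> ?c f < \<epsilon> * n) +
        config_prob d n (jobs lam n) (\<lambda>f. \<epsilon> * n \<le> ?c f)" .
    qed
  qed (use tendsto_add[OF small large] in \<open>auto simp: config_prob_nonneg\<close>)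
qed

text \<open>Some \<open>\<mu>\<close> has its quotient in \<open>gamma\<close> below
  \<open>lam * fact d\<close>; then \<open>\<tau>0 = \<mu> / (lam * d)\<close> is the survival
  probability at which heavy points would outnumber all points.\<close>

lemma core_likely:
  fixes lam :: real
  assumes d: "2 \<le> d" and k: "1 \<le> k" and lam: "0 < lam" and g: "gamma k d < lam * fact d"
  shows "(\<lambda>n. config_prob d n (jobs lam n) (\<lambda>f. core_size {..<n} k {..<jobs lam n} f = 0)) \<longlonglongrightarrow> 0"
proof -
  obtain l where l: "d = Suc l" "1 \<le> l" using d by (cases d) auto
  obtain \<mu> where \<mu>: "0 < \<mu>" and less: "\<mu> * fact (d - 1) / measure_pmf.prob (poisson_pmf \<mu>) {k - 1..} ^ (d - 1) < lam * fact d"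
    using gamma_less_obtain[OF g] .
  let ?P = "measure_pmf.prob (poisson_pmf \<mu>) {k - 1..}"
  define \<tau>0 where "\<tau>0 = \<mu> / (lam * d)"
  have P: "0 < ?P" "?P \<le> 1" using poisson_prob_atLeast_pos[OF \<mu>] by auto
  have "\<mu> * fact l < lam * fact d * ?P ^ l" using less P l by (simp add: pos_divide_less_eq)
  then have "\<mu> * fact l < (lam * d * ?P ^ l) * fact l" using l by (simp add: algebra_simps)
  then have "\<mu> < lam * d * ?P ^ l" by (rule mult_right_less_imp_less) simp
  then have \<tau>P: "\<tau>0 < ?P ^ l" using lam d by (simp add: \<tau>0_def field_simps)
  moreover have "?P ^ l \<le> 1" using P by (intro power_le_one) auto
  ultimately have "\<tau>0 \<le> 1" by linarith
  moreover have "0 < \<tau>0" using \<mu> lam d by (simp add: \<tau>0_def)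
  moreover have "lam * Suc l * \<tau>0 = \<mu>" using lam d unfolding \<tau>0_def l(1) by (simp del: of_nat_Suc)
  ultimately show ?thesis
    unfolding l(1) using \<tau>P by (intro zero_core_unlikely l k lam) auto
qed

section \<open>Transfer to hypergraphs and makespan\<close>

definition config_hypergraph :: "nat \<Rightarrow> nat \<Rightarrow> (nat \<Rightarrow> nat list) \<Rightarrow> (nat, nat) hypergraph" where
  "config_hypergraph n m f = \<lparr>verts = {..<n}, hedges = {..<m}, ends = set \<circ> f\<rparr>"

definition simple_words :: "'a set \<Rightarrow> nat \<Rightarrow> 'a list set" where
  "simple_words V d = {xs \<in> words V d. distinct xs}"

lemma simple_words_eq_UN:
  "finite V \<Longrightarrow> simple_words V d = (\<Union>A\<in>{A. A \<subseteq> V \<and> card A = d}. permutations_of_set A)"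
  by (auto simp: simple_words_def words_def permutations_of_set_def distinct_card)

text \<open>Every \<open>d\<close>-subset has the same number \<open>fact d\<close> of
  orderings.\<close>

lemma uniform_subset_eq_map_set:
  assumes "finite V" "d \<le> card V"
  shows "pmf_of_set {A. A \<subseteq> V \<and> card A = d} = map_pmf set (pmf_of_set (simple_words V d))"
proof -
  let ?S = "{A. A \<subseteq> V \<and> card A = d}"
  have fin: "finite A" if "A \<in> ?S" for A using that assms finite_subset by auto
  have ne: "?S \<noteq> {}" using obtain_subset_with_card_n[OF assms(2)] by blast
  have finS: "finite ?S" using assms by simp
  have "pmf_of_set (simple_words V d) = do {A \<leftarrow> pmf_of_set ?S; pmf_of_set (permutations_of_set A)}"
    unfolding simple_words_eq_UN[OF assms(1)]
  proof (rule pmf_of_set_UN[where n = "fact d"])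
    show "disjoint_family_on permutations_of_set ?S"
      by (auto simp: disjoint_family_on_def permutations_of_set_def)
    show "card (permutations_of_set A) = fact d" if "A \<in> ?S" for A
      using fin[OF that] that by simp
    show "permutations_of_set A \<noteq> {}" if "A \<in> ?S" for A
      using fin[OF that] by simp
    show "finite (\<Union> (permutations_of_set ` ?S))"
      by (intro finite_UN_I finS) simp
  qed (rule ne)
  then have "map_pmf set (pmf_of_set (simple_words V d)) =
      do {A \<leftarrow> pmf_of_set ?S; map_pmf set (pmf_of_set (permutations_of_set A))}"
    by (simp add: map_bind_pmf)
  also have "\<dots> = do {A \<leftarrow> pmf_of_set ?S; return_pmf A}"
  proof (intro bind_pmf_cong refl)
    fix A assume "A \<in> set_pmf (pmf_of_set ?S)"
    then have A: "A \<in> ?S" using finS ne by simp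
    have "map_pmf set (pmf_of_set (permutations_of_set A)) = map_pmf (\<lambda>_. A) (pmf_of_set (permutations_of_set A))"
    proof (intro map_pmf_cong refl)
      fix xs assume "xs \<in> set_pmf (pmf_of_set (permutations_of_set A))"
      then have "xs \<in> permutations_of_set A" using fin[OF A] by simp
      then show "set xs = A" by (rule permutations_of_setD)
    qed
    then show "map_pmf set (pmf_of_set (permutations_of_set A)) = return_pmf A" by simp
  qed
  finally show ?thesis by (simp add: bind_return_pmf')
qed

lemma finite_simple_words [simp]: "finite V \<Longrightarrow> finite (simple_words V d)"
  by (simp add: simple_words_def)

lemma card_simple_words_ge:
  assumes "d \<le> n"
  shows "(n - d) ^ d \<le> card (simple_words {..<n} d)"
proof -
  have "simple_words {..<n} d = {xs. length xs = d \<and> distinct xs \<and> set xs \<subseteq> {..<n}}"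
    by (auto simp: simple_words_def words_def)
  then have "card (simple_words {..<n} d) = \<Prod>{n - d + 1..n}"
    using card_lists_distinct_length_eq[of "{..<n}" d] assms by simp
  also have "(\<Prod>i\<in>{n - d + 1..n}. n - d) \<le> \<Prod>{n - d + 1..n}"
    by (intro prod_mono) auto
  then have "(n - d) ^ d \<le> \<Prod>{n - d + 1..n}" using assms by simp
  finally show ?thesis by simp
qed

text \<open>Conditioning on words without repetitions costs the reciprocal of their proportion among
  all words, at most \<open>n / (n - d)\<close> for each of the \<open>d * m\<close>
  letters.\<close>

lemma random_hypergraph_prob_le:
  assumes d: "d < n"
    and imp: "\<And>f. (\<And>e. e < m \<Longrightarrow> f e \<in> simple_words {..<n} d) \<Longrightarrow> Q (config_hypergraph n m f) \<Longrightarrow> R (restrict f {..<m})"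
  shows "measure_pmf.prob (random_hypergraph d n m) {G. Q G} \<le> config_prob d n m R * (real n / real (n - d)) ^ (d * m)"
proof -
  let ?D = "simple_words {..<n} d" and ?E = "{..<m}"
  let ?P = "PiE_dflt ?E [] (\<lambda>_. ?D)"
  have cD: "(n - d) ^ d \<le> card ?D" using d by (intro card_simple_words_ge) simp
  then have D0: "0 < card ?D" using d by (metis less_le_trans zero_less_diff zero_less_power)
  then have ne: "?D \<noteq> {}" by auto
  have finP: "finite ?P" "?P \<noteq> {}" using ne by auto
  have "random_hypergraph d n m = map_pmf (config_hypergraph n m) (pmf_of_set ?P)"
  proof -
    have "Pi_pmf ?E {} (\<lambda>_. pmf_of_set {A. A \<subseteq> {..<n} \<and> card A = d}) =
        Pi_pmf ?E {} (\<lambda>_. map_pmf set (pmf_of_set ?D))"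
      using d by (subst uniform_subset_eq_map_set) auto
    also have "\<dots> = map_pmf (\<lambda>h. set \<circ> h) (Pi_pmf ?E [] (\<lambda>_. pmf_of_set ?D))"
      by (rule Pi_pmf_map) auto
    also have "Pi_pmf ?E [] (\<lambda>_. pmf_of_set ?D) = pmf_of_set ?P"
      using ne by (intro Pi_pmf_of_set) auto
    finally show ?thesis
      by (simp add: random_hypergraph_def map_pmf_comp config_hypergraph_def[abs_def] comp_def)
  qed
  then have "measure_pmf.prob (random_hypergraph d n m) {G. Q G} =
      measure_pmf.prob (pmf_of_set ?P) {f. Q (config_hypergraph n m f)}"
    by (simp add: vimage_def)
  also have "\<dots> = card {f \<in> ?P. Q (config_hypergraph n m f)} / card ?P"
    using finP by (simp add: measure_pmf_of_set Int_def)
  also have "card ?P = card ?D ^ m"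
    by (simp add: card_PiE_dflt)
  also have "card {f \<in> ?P. Q (config_hypergraph n m f)} \<le> card {f \<in> configs {..<n} d ?E. R f}"
  proof (rule card_inj_on_le[of "\<lambda>f. restrict f ?E"])
    show "inj_on (\<lambda>f. restrict f ?E) {f \<in> ?P. Q (config_hypergraph n m f)}"
    proof
      fix f g assume f: "f \<in> {f \<in> ?P. Q (config_hypergraph n m f)}" and g: "g \<in> {f \<in> ?P. Q (config_hypergraph n m f)}"
        and eq: "restrict f ?E = restrict g ?E"
      show "f = g"
      proof
        fix x show "f x = g x"
          using f g fun_cong[OF eq, of x] by (cases "x < m") (auto simp: PiE_dflt_def)
      qed
    qed
    show "(\<lambda>f. restrict f ?E) ` {f \<in> ?P. Q (config_hypergraph n m f)} \<subseteq> {f \<in> configs {..<n} d ?E. R f}"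
    proof (rule image_subsetI)
      fix f assume f: "f \<in> {f \<in> ?P. Q (config_hypergraph n m f)}"
      have D: "f e \<in> ?D" if "e < m" for e using f that by (auto simp: PiE_dflt_def)
      have "restrict f ?E \<in> configs {..<n} d ?E"
        unfolding restrict_PiE_iff using D by (auto simp: simple_words_def)
      moreover have "R (restrict f ?E)" using f D by (intro imp) auto
      ultimately show "restrict f ?E \<in> {f \<in> configs {..<n} d ?E. R f}" by blast
    qed
  qed auto
  then have "card {f \<in> ?P. Q (config_hypergraph n m f)} / real (card ?D ^ m) \<le>
      card {f \<in> configs {..<n} d ?E. R f} / real (card ?D ^ m)"
    by (intro divide_right_mono) auto
  also have "\<dots> = config_prob d n m R * (real n ^ (d * m) / real (card ?D ^ m))"
    using d by (simp add: config_prob_eq)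
  also have "\<dots> \<le> config_prob d n m R * (real n / real (n - d)) ^ (d * m)"
  proof (intro mult_left_mono config_prob_nonneg)
    have "real ((n - d) ^ d) ^ m \<le> real (card ?D) ^ m"
      using cD by (intro power_mono) (auto simp del: of_nat_power)
    then have "real n ^ (d * m) / real (card ?D ^ m) \<le> real n ^ (d * m) / real ((n - d) ^ d) ^ m"
      using d D0 by (intro divide_left_mono) auto
    then show "real n ^ (d * m) / real (card ?D ^ m) \<le> (real n / real (n - d)) ^ (d * m)"
      by (simp add: power_divide power_mult)
  qed
  finally show ?thesis .
qed

text \<open>The total cost stays bounded: for \<open>n > 2 * d\<close> it is at most
  \<open>(1 + 2 * d / n) ^ (d * m)\<close>, hence at most \<open>exp (2 * d * (d * lam))\<close>. So
  vanishing probabilities for words carry over to subsets.\<close>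

lemma whp_jobs_hypergraphI:
  fixes lam :: real
  assumes lam: "0 < lam"
    and lim: "(\<lambda>n. config_prob d n (jobs lam n) (R n)) \<longlonglongrightarrow> 0"
    and imp: "\<And>n f. (\<And>e. e < jobs lam n \<Longrightarrow> f e \<in> simple_words {..<n} d) \<Longrightarrow>
        \<not> Q (config_hypergraph n (jobs lam n) f) \<Longrightarrow> R n (restrict f {..<jobs lam n})"
  shows "whp (jobs_hypergraph d lam) Q"
proof -
  define C where "C = exp (2 * d * (d * lam))"
  have bound: "measure_pmf.prob (jobs_hypergraph d lam n) {G. \<not> Q G} \<le> config_prob d n (jobs lam n) (R n) * C"
    if n: "2 * d < n" for n
  proof -
    define m where "m = jobs lam n"
    have m: "m \<le> lam * n" using jobs_bounds[OF lam] by (simp add: m_def)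
    have "measure_pmf.prob (jobs_hypergraph d lam n) {G. \<not> Q G} \<le> config_prob d n m (R n) * (real n / real (n - d)) ^ (d * m)"
      unfolding jobs_hypergraph_def m_def using n by (intro random_hypergraph_prob_le imp) auto
    also have "\<dots> \<le> config_prob d n m (R n) * C"
    proof (intro mult_left_mono config_prob_nonneg)
      have "real n / real (n - d) \<le> 1 + 2 * d / n"
      proof -
        have "real (n - d) = real n - d" using n by (simp add: of_nat_diff)
        moreover have "real n \<le> (1 + 2 * d / n) * (real n - d)"
        proof -
          have "2 * real d * d \<le> d * real n" using n by (simp add: mult.assoc[symmetric] mult_right_mono mult.commute[of _ "real n"])
          then show ?thesis using n by (simp add: field_simps)
        qed
        ultimately show ?thesis using n by (simp add: pos_divide_le_eq)
      qed
      also have "\<dots> \<le> exp (2 * d / n)" by (rule exp_ge_add_one_self)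
      finally have "(real n / real (n - d)) ^ (d * m) \<le> exp (2 * d / n) ^ (d * m)"
        by (intro power_mono) auto
      also have "\<dots> = exp (2 * d / n * (d * m))"
        by (simp add: mult.commute flip: exp_of_nat_mult)
      also have "\<dots> \<le> C"
      proof -
        have "2 * d / n * (d * real m) \<le> 2 * d / n * (d * (lam * n))"
          using m by (intro mult_left_mono) auto
        also have "\<dots> = 2 * d * (d * lam)" using n by simp
        finally show ?thesis by (simp add: C_def)
      qed
      finally show "(real n / real (n - d)) ^ (d * m) \<le> C" .
    qed
    finally show ?thesis by (simp add: m_def)
  qed
  have "(\<lambda>n. measure_pmf.prob (jobs_hypergraph d lam n) {G. \<not> Q G}) \<longlonglongrightarrow> 0"
  proof (rule tendsto_sandwich[OF _ _ tendsto_const])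
    show "\<forall>\<^sub>F n in sequentially. measure_pmf.prob (jobs_hypergraph d lam n) {G. \<not> Q G} \<le> config_prob d n (jobs lam n) (R n) * C"
      using eventually_gt_at_top[of "2 * d"] by eventually_elim (rule bound)
    show "(\<lambda>n. config_prob d n (jobs lam n) (R n) * C) \<longlonglongrightarrow> 0"
      using tendsto_mult[OF lim tendsto_const, of C] by simp
  qed auto
  then have "(\<lambda>n. 1 - measure_pmf.prob (jobs_hypergraph d lam n) {G. \<not> Q G}) \<longlonglongrightarrow> 1 - 0"
    by (intro tendsto_diff tendsto_const)
  moreover have "1 - measure_pmf.prob (jobs_hypergraph d lam n) {G. \<not> Q G} = measure_pmf.prob (jobs_hypergraph d lam n) {G. Q G}" for n
    using measure_pmf.prob_compl[of "{G. \<not> Q G}" "jobs_hypergraph d lam n"] by (simp add: Compl_eq_Diff_UNIV[symmetric] Collect_neg_eq[symmetric])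
  ultimately show ?thesis by (simp add: whp_def)
qed

section \<open>Makespan and cores of a fixed hypergraph\<close>

text \<open>Each server splits its capacity into \<open>k\<close> equal shares and gives one to each
  job assigned to it.\<close>

lemma makespan_le_of_assignment:
  assumes fin: "finite (verts H)" "finite (hedges H)" and k: "1 \<le> k"
    and \<phi>: "\<And>e. e \<in> hedges H \<Longrightarrow> \<phi> e \<in> verts H \<inter> ends H e"
    and le: "\<And>v. v \<in> verts H \<Longrightarrow> card {e \<in> hedges H. \<phi> e = v} \<le> k"
  shows "makespan H \<le> of_nat k"
proof -
  define x where "x = (\<lambda>v e. if \<phi> e = v then 1 / real k else 0)"
  have "x \<in> allocations H"
  proof -
    have "(\<Sum>e | e \<in> hedges H \<and> v \<in> ends H e. x v e) \<le> 1" if v: "v \<in> verts H" for v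
    proof -
      have "(\<Sum>e | e \<in> hedges H \<and> v \<in> ends H e. x v e) \<le> (\<Sum>e\<in>hedges H. x v e)"
        using fin by (intro sum_mono2) (auto simp: x_def)
      also have "\<dots> = card {e \<in> hedges H. \<phi> e = v} * (1 / k)"
        using fin by (simp add: x_def sum.If_cases Int_def)
      also have "\<dots> \<le> k * (1 / k)"
        using le[OF v] by (intro mult_right_mono) auto
      finally show ?thesis using k by simp
    qed
    then show ?thesis
      using \<phi> by (auto simp: allocations_def x_def)
  qed
  moreover have "completion_time H x \<le> of_nat k"
    unfolding completion_time_def
  proof (rule SUP_least)
    fix e assume e: "e \<in> hedges H"
    have "(\<Sum>v\<in>verts H. x v e) = 1 / k"
      using \<phi>[OF e] fin by (simp add: x_def)
    then have "1 / ennreal (\<Sum>v\<in>verts H. x v e) = ennreal 1 / ennreal (1 / k)" by simp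
    also have "\<dots> = of_nat k"
      using k by (subst divide_ennreal) (auto simp: ennreal_of_nat_eq_real_of_nat)
    finally show "1 / ennreal (\<Sum>v\<in>verts H. x v e) \<le> of_nat k" by simp
  qed
  ultimately show ?thesis
    unfolding makespan_def by (rule INF_lower2[of x])
qed

text \<open>The generalisation to \<open>W\<close> carries the induction: \<open>W\<close> is the
  set of vertices not yet deleted, and hyperedges that avoid the next deleted vertex
  \<open>v\<close> lie in \<open>W - {v}\<close>.\<close>

lemma assignment_of_empty_core:
  assumes fin: "finite (verts H)" "finite (hedges H)" and ne: "\<And>e. e \<in> hedges H \<Longrightarrow> ends H e \<noteq> {}"
    and core: "verts (core (Suc k) H) = {}" and W: "W \<subseteq> verts H"
  shows "\<exists>\<phi>. (\<forall>e\<in>hedges H. ends H e \<subseteq> W \<longrightarrow> \<phi> e \<in> ends H e) \<and>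
           (\<forall>v. card {e \<in> hedges H. ends H e \<subseteq> W \<and> \<phi> e = v} \<le> k)"
  using finite_subset[OF W fin(1)] W
  proof (induction rule: finite_psubset_induct)
    case (psubset W)
    show ?case
    proof (cases "W = {}")
      case True
      have "card {e \<in> hedges H. ends H e \<subseteq> W \<and> undefined = v} \<le> k" for v
      proof -
        have "{e \<in> hedges H. ends H e \<subseteq> W \<and> undefined = v} = {}" using True ne by auto
        then show ?thesis by (simp only: card.empty)
      qed
      moreover have "\<not> ends H e \<subseteq> W" if "e \<in> hedges H" for e using True ne[OF that] by auto
      ultimately show ?thesis by (intro exI[of _ "\<lambda>_. undefined"]) blast
    next
      case False
      have "\<not> min_degree_ge (Suc k) (induced H W)"
        using core_largest[OF psubset.prems] False core by blast
      then obtain v where v: "v \<in> W" "vdegree (induced H W) v \<le> k"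
        by (auto simp: min_degree_ge_def induced_def)
      then have deg: "card {e \<in> hedges H. ends H e \<subseteq> W \<and> v \<in> ends H e} \<le> k"
        by (simp add: vdegree_def induced_def conj_assoc)
      have "W - {v} \<subset> W" "W - {v} \<subseteq> verts H" using v psubset.prems by auto
      from psubset.IH[OF this] obtain \<phi> where
        \<phi>: "\<And>e. e \<in> hedges H \<Longrightarrow> ends H e \<subseteq> W - {v} \<Longrightarrow> \<phi> e \<in> ends H e"
           "\<And>u. card {e \<in> hedges H. ends H e \<subseteq> W - {v} \<and> \<phi> e = u} \<le> k"
        by blast
      define \<psi> where "\<psi> = (\<lambda>e. if v \<in> ends H e then v else \<phi> e)"
      have "\<psi> e \<in> ends H e" if "e \<in> hedges H" "ends H e \<subseteq> W" for e
        using that \<phi>(1)[of e] by (auto simp: \<psi>_def)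
      moreover have "card {e \<in> hedges H. ends H e \<subseteq> W \<and> \<psi> e = u} \<le> k" for u
      proof (cases "u = v")
        case True
        have "{e \<in> hedges H. ends H e \<subseteq> W \<and> \<psi> e = u} \<subseteq> {e \<in> hedges H. ends H e \<subseteq> W \<and> v \<in> ends H e}"
          using True \<phi>(1) by (auto simp: \<psi>_def split: if_splits)
        then have "card {e \<in> hedges H. ends H e \<subseteq> W \<and> \<psi> e = u} \<le> card {e \<in> hedges H. ends H e \<subseteq> W \<and> v \<in> ends H e}"
          using fin by (intro card_mono) auto
        then show ?thesis using deg by linarith
      next
        case False
        have "{e \<in> hedges H. ends H e \<subseteq> W \<and> \<psi> e = u} \<subseteq> {e \<in> hedges H. ends H e \<subseteq> W - {v} \<and> \<phi> e = u}"
          using False by (auto simp: \<psi>_def split: if_splits)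
        then have "card {e \<in> hedges H. ends H e \<subseteq> W \<and> \<psi> e = u} \<le> card {e \<in> hedges H. ends H e \<subseteq> W - {v} \<and> \<phi> e = u}"
          using fin by (intro card_mono) auto
        then show ?thesis using \<phi>(2)[of u] by linarith
      qed
      ultimately show ?thesis by blast
    qed
  qed

lemma makespan_le_of_empty_core:
  assumes fin: "finite (verts H)" "finite (hedges H)" and k: "1 \<le> k"
    and ends: "\<And>e. e \<in> hedges H \<Longrightarrow> ends H e \<noteq> {} \<and> ends H e \<subseteq> verts H"
    and core: "verts (core (Suc k) H) = {}"
  shows "makespan H \<le> of_nat k"
proof -
  have ne: "ends H e \<noteq> {}" if "e \<in> hedges H" for e using ends[OF that] by simp
  obtain \<phi> where *: "(\<forall>e\<in>hedges H. ends H e \<subseteq> verts H \<longrightarrow> \<phi> e \<in> ends H e) \<and>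
      (\<forall>v. card {e \<in> hedges H. ends H e \<subseteq> verts H \<and> \<phi> e = v} \<le> k)"
    using assignment_of_empty_core[OF fin ne core subset_refl] ..
  note \<phi> = *[THEN conjunct1] *[THEN conjunct2, THEN spec]
  show ?thesis
  proof (rule makespan_le_of_assignment[OF fin k])
    show "\<phi> e \<in> verts H \<inter> ends H e" if "e \<in> hedges H" for e
      using \<phi>(1) that ends[OF that] by blast
    fix v
    have "{e \<in> hedges H. \<phi> e = v} = {e \<in> hedges H. ends H e \<subseteq> verts H \<and> \<phi> e = v}"
      using ends by blast
    then show "card {e \<in> hedges H. \<phi> e = v} \<le> k" using \<phi>(2)[of v] by simp
  qed
qed

text \<open>Jobs inside the core draw on core servers only. If each received more than
  \<open>d / k\<close>, the total would exceed \<open>card F * (d / k)\<close>. By double counting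
  of incidences this is at least \<open>card W\<close>, the whole capacity of the core.\<close>

lemma makespan_ge_of_core:
  assumes fin: "finite (verts H)" "finite (hedges H)" and k: "1 \<le> k" and d: "1 \<le> d"
    and ends: "\<And>e. e \<in> hedges H \<Longrightarrow> finite (ends H e) \<and> card (ends H e) = d"
    and core: "verts (core k H) \<noteq> {}"
  shows "ennreal (real k / real d) \<le> makespan H"
  unfolding makespan_def
proof (rule INF_greatest)
  fix x assume x: "x \<in> allocations H"
  define W where "W = verts (core k H)"
  define F where "F = {e \<in> hedges H. ends H e \<subseteq> W}"
  have W: "W \<subseteq> verts H" "W \<noteq> {}" using core_verts_subset[of k H] core by (auto simp: W_def)
  have finW: "finite W" using W fin finite_subset by blast
  have finF: "finite F" using fin by (simp add: F_def)
  have deg: "k \<le> card {e \<in> F. v \<in> ends H e}" if "v \<in> W" for v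
    using core_min_degree_ge[OF fin(2), of k] that
    by (auto simp: W_def F_def min_degree_ge_def vdegree_def core_def induced_def conj_assoc)
  have "k * card W \<le> (\<Sum>v\<in>W. card {e \<in> F. v \<in> ends H e})"
    using sum_mono[of W "\<lambda>_. k"] deg by (simp add: mult.commute)
  also have "\<dots> = (\<Sum>e\<in>F. card {v \<in> W. v \<in> ends H e})"
  proof -
    have "(\<Sum>v\<in>W. card {e \<in> F. v \<in> ends H e}) = (\<Sum>v\<in>W. \<Sum>e\<in>F. of_bool (v \<in> ends H e))"
      using finF by (simp add: Int_def)
    also have "\<dots> = (\<Sum>e\<in>F. \<Sum>v\<in>W. of_bool (v \<in> ends H e))" by (rule sum.swap)
    also have "\<dots> = (\<Sum>e\<in>F. card {v \<in> W. v \<in> ends H e})" using finW by (simp add: Int_def)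
    finally show ?thesis .
  qed
  also have "\<dots> = (\<Sum>e\<in>F. d)"
  proof (intro sum.cong refl)
    fix e assume "e \<in> F"
    then have "{v \<in> W. v \<in> ends H e} = ends H e" "e \<in> hedges H" by (auto simp: F_def)
    then show "card {v \<in> W. v \<in> ends H e} = d" using ends by simp
  qed
  finally have kW: "k * card W \<le> d * card F" by (simp add: mult.commute)
  show "ennreal (real k / real d) \<le> completion_time H x"
  proof (rule ccontr)
    assume "\<not> ?thesis"
    then have less: "completion_time H x < ennreal (k / d)" by simp
    have s: "d / k < (\<Sum>v\<in>verts H. x v e)" if e: "e \<in> hedges H" for e
    proof -
      let ?s = "\<Sum>v\<in>verts H. x v e"
      have "1 / ennreal ?s \<le> completion_time H x"
        unfolding completion_time_def using e by (intro SUP_upper) auto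
      then have l: "1 / ennreal ?s < ennreal (k / d)" using less by simp
      \<comment> \<open>A job without capacity has completion time infinity in
        \<open>ennreal\<close>, which the strict upper bound rules out.\<close>
      have "0 < ?s"
      proof (rule ccontr)
        assume "\<not> 0 < ?s"
        then have "ennreal ?s = 0" by (simp add: ennreal_neg)
        then have "1 / ennreal ?s = \<top>" by (simp add: ennreal_divide_zero)
        then show False using l by simp
      qed
      then have "ennreal (1 / ?s) < ennreal (k / d)"
        using l divide_ennreal[of 1 ?s] by simp
      then have "1 / ?s < k / d"
        using \<open>0 < ?s\<close> by (subst (asm) ennreal_less_iff) auto
      then show ?thesis using \<open>0 < ?s\<close> k d by (simp add: field_simps)
    qed
    have "0 < card W" using W finW by (simp add: card_gt_0_iff)
    then have F0: "F \<noteq> {}" using kW k by (auto intro: ccontr)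
    have "real (card W) \<le> card F * (d / k)"
      using kW k by (simp add: field_simps flip: of_nat_mult)
    also have "\<dots> = (\<Sum>e\<in>F. d / k)" by simp
    also have "\<dots> < (\<Sum>e\<in>F. \<Sum>v\<in>verts H. x v e)"
      using finF F0 s by (intro sum_strict_mono) (auto simp: F_def)
    also have "\<dots> = (\<Sum>e\<in>F. \<Sum>v\<in>W. x v e)"
    proof (rule sum.cong[OF refl])
      fix e assume "e \<in> F"
      then show "(\<Sum>v\<in>verts H. x v e) = (\<Sum>v\<in>W. x v e)"
      proof (intro sum.mono_neutral_right ballI)
        fix v assume v: "v \<in> verts H - W"
        then have "v \<notin> ends H e" using \<open>e \<in> F\<close> by (auto simp: F_def)
        then show "x v e = 0" using x v \<open>e \<in> F\<close> by (auto simp: allocations_def F_def)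
      qed (use fin W in auto)
    qed
    also have "\<dots> = (\<Sum>v\<in>W. \<Sum>e\<in>F. x v e)" by (rule sum.swap)
    also have "\<dots> \<le> (\<Sum>v\<in>W. 1)"
    proof (intro sum_mono)
      fix v assume v: "v \<in> W"
      then have vH: "v \<in> verts H" using W by auto
      have "(\<Sum>e\<in>F. x v e) = (\<Sum>e | e \<in> F \<and> v \<in> ends H e. x v e)"
        using finF x vH by (intro sum.mono_neutral_right) (auto simp: allocations_def F_def)
      also have "\<dots> \<le> (\<Sum>e | e \<in> hedges H \<and> v \<in> ends H e. x v e)"
        using fin x vH by (intro sum_mono2) (auto simp: allocations_def F_def)
      also have "\<dots> \<le> 1" using x vH by (auto simp: allocations_def)
      finally show "(\<Sum>e\<in>F. x v e) \<le> 1" .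
    qed
    finally show False by simp
  qed
qed

text \<open>Without repeated letters, multiplicities are degrees, so \<open>stable\<close> becomes
  \<open>min_degree_ge\<close>. As \<open>1 \<le> k\<close>, a nonempty stable set contains a
  hyperedge; as \<open>1 \<le> d\<close>, a set that contains a hyperedge is nonempty.\<close>

lemma core_nonempty_iff:
  assumes d: "1 \<le> d" and k: "1 \<le> k" and f: "\<And>e. e < m \<Longrightarrow> f e \<in> simple_words {..<n} d"
  shows "verts (core k (config_hypergraph n m f)) \<noteq> {} \<longleftrightarrow> 0 < core_size {..<n} k {..<m} (restrict f {..<m})"
proof -
  let ?H = "config_hypergraph n m f" and ?f = "restrict f {..<m}"
  have vH: "verts ?H = {..<n}" "hedges ?H = {..<m}" by (auto simp: config_hypergraph_def)
  have cnt: "count (mset (f e)) v = of_bool (v \<in> set (f e))" if "e < m" for e v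
    using f[OF that] by (simp add: simple_words_def distinct_count_atmost_1)
  have st: "stable k {..<m} ?f W \<longleftrightarrow> min_degree_ge k (induced ?H W)" for W
  proof -
    have "count (total_mset (inner_edges {..<m} ?f W) ?f) v = vdegree (induced ?H W) v" for v
    proof -
      have "count (total_mset (inner_edges {..<m} ?f W) ?f) v = (\<Sum>e\<in>inner_edges {..<m} ?f W. of_bool (v \<in> set (f e)))"
        unfolding count_total_mset by (intro sum.cong) (auto simp: inner_edges_def cnt)
      also have "\<dots> = card {e \<in> inner_edges {..<m} ?f W. v \<in> set (f e)}"
        by (simp add: finite_subset[OF inner_edges_subset] Int_def)
      also have "{e \<in> inner_edges {..<m} ?f W. v \<in> set (f e)} = {e \<in> hedges (induced ?H W). v \<in> ends (induced ?H W) e}"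
        by (auto simp: inner_edges_def config_hypergraph_def induced_def)
      finally show ?thesis unfolding vdegree_def .
    qed
    then show ?thesis by (simp add: stable_def min_degree_ge_def induced_def)
  qed
  show ?thesis
  proof
    assume ne: "verts (core k ?H) \<noteq> {}"
    define W where "W = verts (core k ?H)"
    have "W \<subseteq> {..<n}" using core_verts_subset[of k ?H] by (simp add: W_def vH)
    moreover have "core k ?H = induced ?H W" by (simp add: W_def core_def induced_def)
    then have "stable k {..<m} ?f W" using st core_min_degree_ge[of ?H k] vH by simp
    moreover have "inner_edges {..<m} ?f W \<noteq> {}"
    proof
      assume e: "inner_edges {..<m} ?f W = {}"
      obtain v where "v \<in> W" using ne by (auto simp: W_def)
      then have "k \<le> count (total_mset {} ?f) v" using \<open>stable k {..<m} ?f W\<close> e by (auto simp: stable_def)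
      then show False using k by (simp add: total_mset_def)
    qed
    then have "0 < card (inner_edges {..<m} ?f W)"
      by (simp add: card_gt_0_iff finite_subset[OF inner_edges_subset])
    ultimately show "0 < core_size {..<n} k {..<m} ?f"
      using core_size_ge[of "{..<m}" "{..<n}" W k ?f] by simp
  next
    assume pos: "0 < core_size {..<n} k {..<m} ?f"
    obtain W where W: "W \<subseteq> {..<n}" "stable k {..<m} ?f W" "core_size {..<n} k {..<m} ?f = card (inner_edges {..<m} ?f W)"
      using core_size_attained[of "{..<m}" "{..<n}" k ?f] by auto
    have "inner_edges {..<m} ?f W \<noteq> {}" using pos W by auto
    then obtain e where e: "e < m" "set (f e) \<subseteq> W" by (auto simp: inner_edges_def)
    have "length (f e) = d" using f[OF e(1)] by (simp add: simple_words_def words_def)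
    then have "W \<noteq> {}" using e d by (cases "f e") auto
    moreover have "W \<subseteq> verts (core k ?H)" using W st vH by (intro core_largest) auto
    ultimately show "verts (core k ?H) \<noteq> {}" by blast
  qed
qed

lemma makespan_bounds_whp:
  fixes lam :: real
  assumes d: "2 \<le> d" and lam: "0 < lam" and k: "2 \<le> k"
    and g: "gamma k d < lam * fact d" "lam * fact d < gamma (k + 1) d"
  shows "whp (jobs_hypergraph d lam) (\<lambda>G. verts (core k G) \<noteq> {} \<and> verts (core (k + 1) G) = {} \<and>
          ennreal (real k / real d) \<le> makespan G \<and> makespan G \<le> of_nat k)"
proof (rule whp_jobs_hypergraphI[OF lam])
  let ?R = "\<lambda>n f. core_size {..<n} k {..<jobs lam n} f = 0 \<or> 0 < core_size {..<n} (k + 1) {..<jobs lam n} f"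
  have "(\<lambda>n. config_prob d n (jobs lam n) (\<lambda>f. core_size {..<n} k {..<jobs lam n} f = 0) +
      config_prob d n (jobs lam n) (\<lambda>f. 0 < core_size {..<n} (k + 1) {..<jobs lam n} f)) \<longlonglongrightarrow> 0 + 0"
    using k by (intro tendsto_add core_likely core_unlikely d lam g) auto
  then have lim: "(\<lambda>n. config_prob d n (jobs lam n) (\<lambda>f. core_size {..<n} k {..<jobs lam n} f = 0) +
      config_prob d n (jobs lam n) (\<lambda>f. 0 < core_size {..<n} (k + 1) {..<jobs lam n} f)) \<longlonglongrightarrow> 0" by simp
  show "(\<lambda>n. config_prob d n (jobs lam n) (?R n)) \<longlonglongrightarrow> 0"
    by (rule tendsto_sandwich[OF _ _ tendsto_const lim]; intro always_eventually allI)
       (rule config_prob_nonneg config_prob_disj)+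
next
  let ?R = "\<lambda>n f. core_size {..<n} k {..<jobs lam n} f = 0 \<or> 0 < core_size {..<n} (k + 1) {..<jobs lam n} f"
  fix n f
  assume f: "\<And>e. e < jobs lam n \<Longrightarrow> f e \<in> simple_words {..<n} d"
  let ?H = "config_hypergraph n (jobs lam n) f"
  assume not: "\<not> (verts (core k ?H) \<noteq> {} \<and> verts (core (k + 1) ?H) = {} \<and>
          ennreal (real k / real d) \<le> makespan ?H \<and> makespan ?H \<le> of_nat k)"
  have fin: "finite (verts ?H)" "finite (hedges ?H)" by (auto simp: config_hypergraph_def)
  have ends: "finite (ends ?H e) \<and> card (ends ?H e) = d \<and> ends ?H e \<noteq> {} \<and> ends ?H e \<subseteq> verts ?H"
    if "e \<in> hedges ?H" for e
  proof -
    have e: "e < jobs lam n" using that by (simp add: config_hypergraph_def)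
    have "distinct (f e)" "length (f e) = d" "set (f e) \<subseteq> {..<n}"
      using f[OF e] by (auto simp: simple_words_def words_def)
    then show ?thesis
      using d by (auto simp: config_hypergraph_def distinct_card)
  qed
  have "verts (core k ?H) = {} \<or> verts (core (k + 1) ?H) \<noteq> {}"
  proof (rule ccontr)
    assume "\<not> ?thesis"
    then have c: "verts (core k ?H) \<noteq> {}" "verts (core (Suc k) ?H) = {}" by auto
    have "ennreal (real k / real d) \<le> makespan ?H"
      using k d ends c by (intro makespan_ge_of_core fin) auto
    moreover have "makespan ?H \<le> of_nat k"
      using k ends c by (intro makespan_le_of_empty_core fin) auto
    ultimately show False using not c by simp
  qed
  then show "?R n (restrict f {..<jobs lam n})"
    using core_nonempty_iff[of d k "jobs lam n" f n] core_nonempty_iff[of d "k + 1" "jobs lam n" f n] f d k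
    by auto
qed

section \<open>Sparse graphs\<close>

text \<open>
  The vertices \<open>ws\<close> are two paths, of lengths \<open>l\<close> and \<open>s - l\<close> (the latter may be empty). Edge \<open>r\<close>
  joins vertex \<open>r\<close> to its successor, except that the last vertices of the two paths are joined back
  to vertices \<open>i\<close> and \<open>j\<close>. Edge \<open>s\<close> joins the first vertices of the paths, or vertex \<open>0\<close> to
  vertex \<open>j\<close> if the second path is empty.
\<close>

definition bicyclic_end :: "nat \<Rightarrow> nat \<Rightarrow> nat \<Rightarrow> nat \<Rightarrow> nat \<Rightarrow> nat" where
  "bicyclic_end s l i j r = (if r = l - 1 then i else if r = s - 1 then j else if r < s then Suc r
     else if l < s then l else j)"

definition bicyclic_witness ::
    "('e \<Rightarrow> 'v set) \<Rightarrow> 'v set \<Rightarrow> 'e set \<Rightarrow> nat \<Rightarrow> nat \<Rightarrow> nat \<Rightarrow> nat \<Rightarrow> 'v list \<Rightarrow> 'e list \<Rightarrow> bool" where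
  "bicyclic_witness en V E s l i j ws es \<longleftrightarrow> 1 \<le> s \<and> l \<le> s \<and> i < s \<and> j < s \<and> ws \<in> words V s \<and>
     length es = Suc s \<and> distinct es \<and> set es \<subseteq> E \<and>
     (\<forall>r\<le>s. en (es ! r) = {ws ! (if r < s then r else 0), ws ! bicyclic_end s l i j r})"

text \<open>
  Take a maximal set \<open>A\<close> of edges with distinct representatives \<open>\<phi>\<close>, and an edge \<open>e\<close> outside \<open>A\<close>. From
  each end of \<open>e\<close>, walk along the edges represented by the current vertex. The walk never reaches
  an unrepresented vertex, as shifting the representatives along it would make room for \<open>e\<close>; so it
  runs into itself or into the other walk.
\<close>

lemma orientation_or_bicyclic:
  fixes en :: "'e \<Rightarrow> 'v set"
  assumes fin: "finite E" "finite V" and en: "\<And>e. e \<in> E \<Longrightarrow> card (en e) = 2 \<and> en e \<subseteq> V"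
    and no: "\<nexists>\<phi>. inj_on \<phi> E \<and> (\<forall>e\<in>E. \<phi> e \<in> en e)"
  shows "\<exists>s l i j ws es. bicyclic_witness en V E s l i j ws es"
proof -
  define P where "P = (\<lambda>A. A \<subseteq> E \<and> (\<exists>\<phi>. inj_on \<phi> A \<and> (\<forall>e\<in>A. \<phi> e \<in> en e)))"
  have "finite {A. P A}" by (rule finite_subset[of _ "Pow E"]) (use fin in \<open>auto simp: P_def\<close>)
  moreover have "{} \<in> {A. P A}" by (simp add: P_def)
  ultimately obtain A where A: "P A" and max: "\<And>B. P B \<Longrightarrow> A \<subseteq> B \<Longrightarrow> A = B"
    using finite_has_maximal[of "{A. P A}"] by blast
  obtain \<phi> where AE: "A \<subseteq> E" and inj: "inj_on \<phi> A" and \<phi>: "\<And>x. x \<in> A \<Longrightarrow> \<phi> x \<in> en x"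
    using A by (auto simp: P_def)
  have "A \<noteq> E" using no inj \<phi> by blast
  then obtain e where e: "e \<in> E" "e \<notin> A" using AE by blast
  obtain a b where ab: "en e = {a, b}" using en[OF e(1)] by (auto simp: card_2_iff)
  define own where "own = (\<lambda>v. v \<in> \<phi> ` A)"
  define \<psi> where "\<psi> = inv_into A \<phi>"
  define nxt where "nxt = (\<lambda>v. SOME u. en (\<psi> v) = {v, u})"
  have \<psi>: "\<psi> v \<in> A" "\<phi> (\<psi> v) = v" if "own v" for v
    using that by (auto simp: own_def \<psi>_def inv_into_into f_inv_into_f)
  have \<psi>\<phi>: "\<psi> (\<phi> x) = x" if "x \<in> A" for x using that inj by (simp add: \<psi>_def)
  have nxt: "en (\<psi> v) = {v, nxt v}" if "own v" for v
  proof -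
    have "card (en (\<psi> v)) = 2" "v \<in> en (\<psi> v)" using \<psi>[OF that] \<phi>[of "\<psi> v"] en AE by auto
    then have "\<exists>u. en (\<psi> v) = {v, u}" by (auto simp: card_2_iff)
    then show ?thesis unfolding nxt_def by (rule someI_ex)
  qed
  have walk: "own ((nxt ^^ p) c)" if c: "c \<in> en e" for c p
  proof (rule ccontr)
    assume "\<not> ?thesis"
    then obtain p where np: "\<not> own ((nxt ^^ p) c)" and less: "\<And>i. i < p \<Longrightarrow> own ((nxt ^^ i) c)"
      using exists_least_iff[of "\<lambda>p. \<not> own ((nxt ^^ p) c)"] by auto
    define w where "w = (\<lambda>i. (nxt ^^ i) c)"
    have wS: "nxt (w i) = w (Suc i)" for i by (simp add: w_def)
    have np': "\<not> own (w p)" and less': "\<And>i. i < p \<Longrightarrow> own (w i)" using np less by (auto simp: w_def)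
    \<comment> \<open>After a repetition the walk is periodic, so \<open>w p\<close> would equal an
      earlier vertex, and that one is a representative.\<close>
    have neq: "w i \<noteq> w j" if "i < j" "j \<le> p" for i j
    proof
      assume eq: "w i = w j"
      have "w p = (nxt ^^ (p - j)) (w j)"
        unfolding w_def using that by (simp flip: funpow_add[THEN fun_cong, unfolded comp_def])
      also have "\<dots> = (nxt ^^ (p - j)) (w i)" by (simp add: eq)
      also have "\<dots> = w (p - j + i)" unfolding w_def by (simp add: funpow_add)
      finally show False using less'[of "p - j + i"] np' that by auto
    qed
    have winj: "i = j" if "w i = w j" "i \<le> p" "j \<le> p" for i j
      using neq[of i j] neq[of j i] that by (metis linorder_neqE_nat)
    \<comment> \<open>The shift: \<open>e\<close> takes its end \<open>c\<close>, and an edge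
      represented by one of the first \<open>p\<close> vertices of the walk moves to its other
      end.\<close>
    define \<phi>' where "\<phi>' = (\<lambda>x. if x = e then c else if \<phi> x \<in> w ` {..<p} then nxt (\<phi> x) else \<phi> x)"
    have \<phi>'e: "\<phi>' e = w 0" by (simp add: \<phi>'_def w_def)
    have \<phi>'A: "(\<exists>i<p. \<phi> x = w i \<and> \<phi>' x = w (Suc i)) \<or> (\<phi>' x = \<phi> x \<and> \<phi> x \<notin> w ` {..p})" if "x \<in> A" for x
    proof (cases "\<phi> x \<in> w ` {..<p}")
      case True
      then obtain i where "i < p" "\<phi> x = w i" by auto
      then show ?thesis using True that e wS by (auto simp: \<phi>'_def)
    next
      case False
      have "own (\<phi> x)" using that by (simp add: own_def)
      then have "\<phi> x \<noteq> w p" using np' by auto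
      then have "\<phi> x \<notin> w ` {..p}" using False by (auto simp: le_less)
      then show ?thesis using False that e by (auto simp: \<phi>'_def)
    qed
    have "inj_on \<phi>' (insert e A)"
    proof -
      have 1: "\<phi>' x \<noteq> w 0" if x: "x \<in> A" for x
        using \<phi>'A[OF x]
      proof
        assume "\<exists>i<p. \<phi> x = w i \<and> \<phi>' x = w (Suc i)"
        then show ?thesis using neq[of 0] by force
      next
        assume "\<phi>' x = \<phi> x \<and> \<phi> x \<notin> w ` {..p}"
        then show ?thesis by force
      qed
      have 2: "x = y" if x: "x \<in> A" and y: "y \<in> A" and eq: "\<phi>' x = \<phi>' y" for x y
      proof -
        have "\<phi> x = \<phi> y"
          using \<phi>'A[OF x] \<phi>'A[OF y]
        proof (elim disjE exE conjE)
          fix i j assume *: "i < p" "\<phi> x = w i" "\<phi>' x = w (Suc i)" "j < p" "\<phi> y = w j" "\<phi>' y = w (Suc j)"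
          then have "w (Suc i) = w (Suc j)" using eq by metis
          then have "i = j" using winj[of "Suc i" "Suc j"] * by linarith
          then show ?thesis using * by metis
        next
          fix i assume *: "i < p" "\<phi>' x = w (Suc i)" "\<phi>' y = \<phi> y" "\<phi> y \<notin> w ` {..p}"
          then have "\<phi> y = w (Suc i)" using eq by metis
          then show ?thesis using * by auto
        next
          fix j assume *: "j < p" "\<phi>' y = w (Suc j)" "\<phi>' x = \<phi> x" "\<phi> x \<notin> w ` {..p}"
          then have "\<phi> x = w (Suc j)" using eq by metis
          then show ?thesis using * by auto
        next
          assume "\<phi>' x = \<phi> x" "\<phi>' y = \<phi> y"
          then show ?thesis using eq by metis
        qed
        then show ?thesis using inj x y by (auto dest: inj_onD)
      qed
      show ?thesis
        unfolding inj_on_insert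
      proof
        show "inj_on \<phi>' A" using 2 by (auto intro: inj_onI)
        show "\<phi>' e \<notin> \<phi>' ` (A - {e})" using 1 unfolding \<phi>'e by force
      qed
    qed
    moreover have "\<phi>' x \<in> en x" if x: "x \<in> insert e A" for x
    proof (cases "x = e")
      case True
      then show ?thesis using c by (simp add: \<phi>'_def)
    next
      case False
      then have xA: "x \<in> A" using x by simp
      have "en x = {\<phi> x, nxt (\<phi> x)}" using nxt[of "\<phi> x"] \<psi>\<phi>[OF xA] xA by (simp add: own_def)
      then show ?thesis using False by (auto simp: \<phi>'_def)
    qed
    ultimately have "P (insert e A)" using AE e by (auto simp: P_def)
    from max[OF this] e show False by blast
  qed
  define wa where "wa = (\<lambda>i. (nxt ^^ i) a)"
  define wb where "wb = (\<lambda>i. (nxt ^^ i) b)"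
  have own_w: "own (wa i)" "own (wb i)" for i using walk ab by (auto simp: wa_def wb_def)
  have V_own: "v \<in> V" if "own v" for v using nxt[OF that] \<psi>[OF that] en AE by auto
  \<comment> \<open>Pigeonhole in the finite set \<open>V\<close>; minimality of \<open>l\<close>
    then makes the vertices before it distinct.\<close>
  have "\<exists>l. wa l \<in> wa ` {..<l}"
  proof (rule ccontr)
    assume no: "\<nexists>l. wa l \<in> wa ` {..<l}"
    have "wa i \<noteq> wa j" if "i < j" for i j
    proof
      assume "wa i = wa j"
      then have "wa j \<in> wa ` {..<j}" using that by (metis imageI lessThan_iff)
      then show False using no by blast
    qed
    then have "inj wa" by (intro linorder_injI) auto
    have "range wa \<subseteq> V" using own_w V_own by auto
    then have "finite (range wa)" using fin(2) by (rule finite_subset)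
    then show False using finite_imageD[OF _ \<open>inj wa\<close>] by simp
  qed
  then obtain l where l: "wa l \<in> wa ` {..<l}" and l_min: "\<And>r. r < l \<Longrightarrow> wa r \<notin> wa ` {..<r}"
    using exists_least_iff[of "\<lambda>l. wa l \<in> wa ` {..<l}"] by auto
  \<comment> \<open>The second walk stops where it meets either walk, possibly at once:
    \<open>q = 0\<close> if \<open>b\<close> lies on the first walk.\<close>
  have "\<exists>q. wb q \<in> wa ` {..<l} \<union> wb ` {..<q}"
  proof (rule ccontr)
    assume no: "\<nexists>q. wb q \<in> wa ` {..<l} \<union> wb ` {..<q}"
    have "wb i \<noteq> wb j" if "i < j" for i j
    proof
      assume "wb i = wb j"
      then have "wb j \<in> wb ` {..<j}" using that by (metis imageI lessThan_iff)
      then show False using no by blast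
    qed
    then have "inj wb" by (intro linorder_injI) auto
    have "range wb \<subseteq> V" using own_w V_own by auto
    then have "finite (range wb)" using fin(2) by (rule finite_subset)
    then show False using finite_imageD[OF _ \<open>inj wb\<close>] by simp
  qed
  then obtain q where q: "wb q \<in> wa ` {..<l} \<union> wb ` {..<q}"
    and q_min: "\<And>r. r < q \<Longrightarrow> wb r \<notin> wa ` {..<l} \<union> wb ` {..<r}"
    using exists_least_iff[of "\<lambda>q. wb q \<in> wa ` {..<l} \<union> wb ` {..<q}"] by auto
  define s where "s = l + q"
  define w where "w = (\<lambda>r. if r < l then wa r else wb (r - l))"
  obtain i where i: "i < l" "wa l = wa i" using l by auto
  obtain j where j: "j < s" "wb q = w j"
  proof -
    from q consider r where "r < l" "wb q = wa r" | r where "r < q" "wb q = wb r" by auto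
    then show ?thesis
    proof cases
      case 1
      then show ?thesis using that[of r] by (simp add: w_def s_def)
    next
      case 2
      then show ?thesis using that[of "l + r"] by (simp add: w_def s_def)
    qed
  qed
  have ownw: "own (w r)" for r using own_w by (simp add: w_def)
  have wneq: "w r \<noteq> w r'" if "r < r'" "r' < s" for r r'
  proof (cases "r' < l")
    case True
    have "wa r \<in> wa ` {..<r'}" using that by simp
    then have "wa r \<noteq> wa r'" using l_min[OF True] by metis
    then show ?thesis using True that by (simp add: w_def)
  next
    case False
    then have "wb (r' - l) \<notin> wa ` {..<l} \<union> wb ` {..<r' - l}" using that by (intro q_min) (auto simp: s_def)
    then have no: "wb (r' - l) \<notin> wa ` {..<l}" "wb (r' - l) \<notin> wb ` {..<r' - l}" by auto
    show ?thesis
    proof (cases "r < l")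
      case True
      then have "wa r \<in> wa ` {..<l}" by simp
      then have "wa r \<noteq> wb (r' - l)" using no by metis
      then show ?thesis using False True by (simp add: w_def)
    next
      case r: False
      then have "wb (r - l) \<in> wb ` {..<r' - l}" using that by simp
      then have "wb (r - l) \<noteq> wb (r' - l)" using no by metis
      then show ?thesis using False r by (simp add: w_def)
    qed
  qed
  have winj: "inj_on w {..<s}"
    by (rule linorder_inj_onI) (use wneq in auto)
  define ws where "ws = map w [0..<s]"
  define es where "es = map (\<lambda>r. \<psi> (w r)) [0..<s] @ [e]"
  have es_nth: "es ! r = \<psi> (w r)" if "r < s" for r using that by (simp add: es_def nth_append)
  have es_s: "es ! s = e" by (simp add: es_def nth_append)
  have ends: "en (es ! r) = {ws ! (if r < s then r else 0), ws ! bicyclic_end s l i j r}" if r: "r \<le> s" for r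
  proof (cases "r < s")
    case True
    have "nxt (w r) = w (bicyclic_end s l i j r)"
    proof -
      consider "r = l - 1" | "r \<noteq> l - 1" "r = s - 1" | "r \<noteq> l - 1" "r \<noteq> s - 1" by blast
      then show ?thesis
      proof cases
        case 1
        then have "nxt (w r) = nxt (wa (l - 1))" using i by (simp add: w_def)
        also have "\<dots> = wa (Suc (l - 1))" by (simp add: wa_def)
        also have "Suc (l - 1) = l" using i by simp
        finally show ?thesis using 1 i by (simp add: bicyclic_end_def w_def)
      next
        case 2
        then have "0 < q" "\<not> r < l" "r - l = q - 1" using True i by (auto simp: s_def)
        then have "nxt (w r) = nxt (wb (q - 1))" by (simp add: w_def)
        also have "\<dots> = wb (Suc (q - 1))" by (simp add: wb_def)
        also have "Suc (q - 1) = q" using \<open>0 < q\<close> by simp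
        finally show ?thesis using 2 j by (simp add: bicyclic_end_def)
      next
        case 3
        then have "nxt (w r) = w (Suc r)"
          using True i by (auto simp: w_def wa_def wb_def Suc_diff_le)
        then show ?thesis using 3 True by (simp add: bicyclic_end_def)
      qed
    qed
    moreover have "bicyclic_end s l i j r < s"
      using True i j by (auto simp: bicyclic_end_def s_def)
    ultimately show ?thesis
      using True nxt[OF ownw[of r]] by (simp add: es_nth ws_def)
  next
    case False
    then have rs: "r = s" using r by simp
    have s0: "0 < s" using i by (simp add: s_def)
    have e1: "bicyclic_end s l i j s = (if l < s then l else j)"
      using i by (auto simp: bicyclic_end_def s_def)
    have "w 0 = a" using i by (simp add: w_def wa_def)
    moreover have "w (if l < s then l else j) = b"
    proof (cases "l < s")
      case True
      then show ?thesis by (simp add: w_def wb_def)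
    next
      case False
      then have "q = 0" by (simp add: s_def)
      then show ?thesis using False j by (simp add: wb_def)
    qed
    ultimately show ?thesis
      using rs s0 j by (simp add: es_s e1 ab ws_def)
  qed
  have "distinct es"
  proof -
    have "inj_on (\<lambda>r. \<psi> (w r)) {..<s}"
    proof (rule inj_onI)
      fix r r' assume "r \<in> {..<s}" "r' \<in> {..<s}" "\<psi> (w r) = \<psi> (w r')"
      moreover from this have "w r = w r'" using \<psi>(2)[OF ownw] by metis
      ultimately show "r = r'" using winj by (auto dest: inj_onD)
    qed
    moreover have "\<psi> (w r) \<noteq> e" for r using \<psi>(1)[OF ownw[of r]] e by auto
    ultimately show ?thesis by (auto simp: es_def distinct_map atLeast0LessThan)
  qed
  moreover have "set es \<subseteq> E" using \<psi>(1)[OF ownw] AE e by (auto simp: es_def)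
  moreover have "ws \<in> words V s" using ownw V_own by (auto simp: ws_def words_def)
  moreover have "1 \<le> s" "l \<le> s" "i < s" using i by (auto simp: s_def)
  moreover have "length es = Suc s" by (simp add: es_def)
  ultimately have "bicyclic_witness en V E s l i j ws es"
    using j ends by (simp add: bicyclic_witness_def)
  then show ?thesis by blast
qed

section \<open>First moment bound for bicyclic configurations\<close>

lemma card_words_2_le: "card {xs \<in> words V 2. set xs = {x, y}} \<le> 2"
proof -
  have "{xs \<in> words V 2. set xs = {x, y}} \<subseteq> {[x, y], [y, x]}"
  proof
    fix xs assume xs: "xs \<in> {xs \<in> words V 2. set xs = {x, y}}"
    then have "length xs = Suc (Suc 0)" by (simp add: words_def)
    then obtain u v where "xs = [u, v]" by (auto simp: length_Suc_conv)
    then show "xs \<in> {[x, y], [y, x]}" using xs by (auto simp: doubleton_eq_iff)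
  qed
  then have "card {xs \<in> words V 2. set xs = {x, y}} \<le> card {[x, y], [y, x]}"
    by (intro card_mono) auto
  also have "\<dots> \<le> 2" using card_length[of "[[x, y], [y, x]]"] by (simp only: list.set list.size)
  finally show ?thesis .
qed

text \<open>Words at distinct hyperedges are independent, and at most two of the
  \<open>n ^ 2\<close> words of length \<open>2\<close> have a prescribed set of ends.\<close>

lemma config_prob_pattern_le:
  assumes n: "0 < n" and es: "distinct es" "length es = Suc s" "set es \<subseteq> {..<m}"
  shows "config_prob 2 n m (\<lambda>f. \<forall>r\<le>s. set (f (es ! r)) = {x r, y r}) \<le> (2 / (real n)\<^sup>2) ^ Suc s"
proof -
  define idx where "idx = inv_into {..s} (nth es)"
  have inj: "inj_on (nth es) {..s}"
    using es by (intro inj_on_nth) auto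
  have idx: "idx (es ! r) = r" if "r \<le> s" for r
    using inv_into_f_f[OF inj, of r] that by (simp add: idx_def)
  have mem: "\<exists>r\<le>s. e = es ! r" if "e \<in> set es" for e
    using that es(2) by (metis in_set_conv_nth less_Suc_eq_le)
  let ?B = "\<lambda>e. if e \<in> set es then {xs \<in> words {..<n} 2. set xs = {x (idx e), y (idx e)}} else words {..<n} 2"
  have cs: "card (set es) = Suc s" using es distinct_card by metis
  have "{f \<in> configs {..<n} 2 {..<m}. \<forall>r\<le>s. set (f (es ! r)) = {x r, y r}} \<subseteq> PiE {..<m} ?B"
  proof
    fix f assume f: "f \<in> {f \<in> configs {..<n} 2 {..<m}. \<forall>r\<le>s. set (f (es ! r)) = {x r, y r}}"
    have "f e \<in> ?B e" if "e < m" for e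
    proof (cases "e \<in> set es")
      case True
      then obtain r where "r \<le> s" "e = es ! r" using mem by blast
      then show ?thesis using f that True idx by (auto simp: PiE_def Pi_def)
    qed (use f that in \<open>auto simp: PiE_def Pi_def\<close>)
    then show "f \<in> PiE {..<m} ?B" using f by (auto simp: PiE_def)
  qed
  then have "card {f \<in> configs {..<n} 2 {..<m}. \<forall>r\<le>s. set (f (es ! r)) = {x r, y r}} \<le> card (PiE {..<m} ?B)"
    by (intro card_mono finite_PiE) auto
  also have "\<dots> = (\<Prod>e<m. card (?B e))" by (simp add: card_PiE)
  also have "\<dots> \<le> (\<Prod>e<m. if e \<in> set es then 2 else n\<^sup>2)"
    by (intro prod_mono) (auto simp: card_words intro: card_words_2_le)
  also have "\<dots> = 2 ^ card ({..<m} \<inter> set es) * (n\<^sup>2) ^ card ({..<m} \<inter> - set es)"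
    by (simp add: prod.If_cases)
  also have "{..<m} \<inter> set es = set es" using es by auto
  also have "{..<m} \<inter> - set es = {..<m} - set es" by auto
  also have "card ({..<m} - set es) = m - Suc s" using es cs by (simp add: card_Diff_subset)
  finally have le: "card {f \<in> configs {..<n} 2 {..<m}. \<forall>r\<le>s. set (f (es ! r)) = {x r, y r}} \<le>
      2 ^ Suc s * (n\<^sup>2) ^ (m - Suc s)" by (simp only: cs)
  have "Suc s \<le> m" using card_mono[of "{..<m}" "set es"] es cs by simp
  then have nm: "real n ^ (2 * m) = (real n)\<^sup>2 ^ Suc s * (real n)\<^sup>2 ^ (m - Suc s)"
    by (simp only: power_mult power_add[symmetric] le_add_diff_inverse)
  have "config_prob 2 n m (\<lambda>f. \<forall>r\<le>s. set (f (es ! r)) = {x r, y r}) \<le>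
      real (2 ^ Suc s * (n\<^sup>2) ^ (m - Suc s)) / real n ^ (2 * m)"
    unfolding config_prob_eq[OF n] by (intro divide_right_mono of_nat_mono le) auto
  also have "\<dots> = (2 / (real n)\<^sup>2) ^ Suc s"
    unfolding nm using n by (simp add: power_divide del: power_Suc)
  finally show ?thesis .
qed

text \<open>There are at most \<open>n ^ s * m ^ Suc s\<close> choices of vertices and edges, each
  realised with probability at most \<open>(2 / n ^ 2) ^ Suc s\<close>. One more edge than vertices
  leaves the factor \<open>1 / n\<close>; the cube counts the choices of \<open>l\<close>,
  \<open>i\<close> and \<open>j\<close>.\<close>

lemma config_prob_bicyclic_le:
  assumes n: "0 < n"
  shows "config_prob 2 n m (\<lambda>f. \<exists>s l i j ws es. bicyclic_witness (set \<circ> f) {..<n} {..<m} s l i j ws es) \<le>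
    (\<Sum>s\<in>{1..m}. real (s + 1) ^ 3 * (2 * real m / n) ^ Suc s) / n"
proof -
  define L where "L = (\<lambda>s. {es :: nat list. set es \<subseteq> {..<m} \<and> length es = Suc s \<and> distinct es})"
  define I where "I = (\<lambda>s. {..s} \<times> {..<s} \<times> {..<s} \<times> words {..<n} s \<times> L s)"
  have L_words: "L s \<subseteq> words {..<m} (Suc s)" for s by (auto simp: L_def words_def)
  have finL: "finite (L s)" for s by (rule finite_subset[OF L_words]) simp
  have finI: "finite (I s)" for s using finL by (simp add: I_def)
  have cL: "card (L s) \<le> m ^ Suc s" for s
  proof -
    have "card (L s) \<le> card (words {..<m} (Suc s))"
      by (rule card_mono[OF _ L_words]) simp
    then show ?thesis by (simp add: card_words)
  qed
  have cI: "real (card (I s)) \<le> real (s + 1) ^ 3 * real n ^ s * real m ^ Suc s" for s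
  proof -
    have "card (I s) = (s + 1) * s * s * n ^ s * card (L s)"
      by (simp add: I_def card_cartesian_product card_words algebra_simps)
    also have "\<dots> \<le> (s + 1) * (s + 1) * (s + 1) * n ^ s * m ^ Suc s"
      by (intro mult_le_mono cL le_refl) auto
    finally have "real (card (I s)) \<le> real ((s + 1) * (s + 1) * (s + 1) * n ^ s * m ^ Suc s)"
      by (rule of_nat_mono)
    also have "\<dots> = real (s + 1) ^ 3 * real n ^ s * real m ^ Suc s"
      by (simp only: of_nat_mult of_nat_power power3_eq_cube)
    finally show ?thesis .
  qed
  have "config_prob 2 n m (\<lambda>f. \<exists>s l i j ws es. bicyclic_witness (set \<circ> f) {..<n} {..<m} s l i j ws es) \<le>
    config_prob 2 n m (\<lambda>f. \<exists>s\<in>{1..m}. \<exists>(l, i, j, ws, es)\<in>I s.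
      \<forall>r\<le>s. set (f (es ! r)) = {ws ! (if r < s then r else 0), ws ! bicyclic_end s l i j r})"
  proof (rule config_prob_mono[OF n])
    fix f assume "\<exists>s l i j ws es. bicyclic_witness (set \<circ> f) {..<n} {..<m} s l i j ws es"
    then obtain s l i j ws es where w: "bicyclic_witness (set \<circ> f) {..<n} {..<m} s l i j ws es" by blast
    have "Suc s \<le> m"
      using w card_mono[of "{..<m}" "set es"] distinct_card[of es] by (auto simp: bicyclic_witness_def)
    then have "s \<in> {1..m}" using w by (auto simp: bicyclic_witness_def)
    moreover have "(l, i, j, ws, es) \<in> I s"
      using w by (auto simp: bicyclic_witness_def I_def L_def)
    moreover have "\<forall>r\<le>s. set (f (es ! r)) = {ws ! (if r < s then r else 0), ws ! bicyclic_end s l i j r}"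
      using w by (simp add: bicyclic_witness_def)
    ultimately show "\<exists>s\<in>{1..m}. \<exists>(l, i, j, ws, es)\<in>I s.
      \<forall>r\<le>s. set (f (es ! r)) = {ws ! (if r < s then r else 0), ws ! bicyclic_end s l i j r}"
      by (intro bexI[of _ s] bexI[of _ "(l, i, j, ws, es)"]) simp_all
  qed
  also have "\<dots> \<le> (\<Sum>s\<in>{1..m}. config_prob 2 n m (\<lambda>f. \<exists>(l, i, j, ws, es)\<in>I s.
      \<forall>r\<le>s. set (f (es ! r)) = {ws ! (if r < s then r else 0), ws ! bicyclic_end s l i j r}))"
    by (rule config_prob_Bex) simp
  also have "\<dots> \<le> (\<Sum>s\<in>{1..m}. real (card (I s)) * (2 / (real n)\<^sup>2) ^ Suc s)"
  proof (intro sum_mono)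
    fix s
    have "config_prob 2 n m (\<lambda>f. \<exists>(l, i, j, ws, es)\<in>I s.
      \<forall>r\<le>s. set (f (es ! r)) = {ws ! (if r < s then r else 0), ws ! bicyclic_end s l i j r}) \<le>
      (\<Sum>z\<in>I s. config_prob 2 n m (\<lambda>f. case z of (l, i, j, ws, es) \<Rightarrow>
        \<forall>r\<le>s. set (f (es ! r)) = {ws ! (if r < s then r else 0), ws ! bicyclic_end s l i j r}))"
      by (rule config_prob_Bex[OF finI])
    also have "\<dots> \<le> (\<Sum>z\<in>I s. (2 / (real n)\<^sup>2) ^ Suc s)"
    proof (intro sum_mono)
      fix z assume "z \<in> I s"
      then obtain l i j ws es where z: "z = (l, i, j, ws, es)" "es \<in> L s" by (auto simp: I_def)
      show "config_prob 2 n m (\<lambda>f. case z of (l, i, j, ws, es) \<Rightarrow>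
        \<forall>r\<le>s. set (f (es ! r)) = {ws ! (if r < s then r else 0), ws ! bicyclic_end s l i j r}) \<le> (2 / (real n)\<^sup>2) ^ Suc s"
        unfolding z(1) prod.case using z(2) by (intro config_prob_pattern_le n) (auto simp: L_def)
    qed
    finally show "config_prob 2 n m (\<lambda>f. \<exists>(l, i, j, ws, es)\<in>I s.
      \<forall>r\<le>s. set (f (es ! r)) = {ws ! (if r < s then r else 0), ws ! bicyclic_end s l i j r}) \<le>
      real (card (I s)) * (2 / (real n)\<^sup>2) ^ Suc s" by simp
  qed
  also have "\<dots> \<le> (\<Sum>s\<in>{1..m}. real (s + 1) ^ 3 * real n ^ s * real m ^ Suc s * (2 / (real n)\<^sup>2) ^ Suc s)"
    by (intro sum_mono mult_right_mono cI) auto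
  also have "\<dots> = (\<Sum>s\<in>{1..m}. real (s + 1) ^ 3 * (2 * real m / n) ^ Suc s) / n"
    unfolding sum_divide_distrib
  proof (intro sum.cong refl)
    fix s
    have "real n ^ s * real m ^ Suc s * (2 / (real n)\<^sup>2) ^ Suc s = (2 * real m / n) ^ Suc s / n"
      using n by (simp add: power_divide power_mult_distrib power2_eq_square mult_ac)
    then show "real (s + 1) ^ 3 * real n ^ s * real m ^ Suc s * (2 / (real n)\<^sup>2) ^ Suc s =
        real (s + 1) ^ 3 * (2 * real m / n) ^ Suc s / n"
      by (simp only: mult.assoc times_divide_eq_right)
  qed
  finally show ?thesis .
qed

text \<open>The ratio \<open>2 * lam\<close> is below 1, so the series converges despite its cubic
  factor and the bound is a constant over \<open>n\<close>.\<close>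

lemma bicyclic_unlikely:
  fixes lam :: real
  assumes lam: "0 < lam" "lam < 1 / 2"
  shows "(\<lambda>n. config_prob 2 n (jobs lam n)
    (\<lambda>f. \<exists>s l i j ws es. bicyclic_witness (set \<circ> f) {..<n} {..<jobs lam n} s l i j ws es)) \<longlonglongrightarrow> 0"
proof -
  define r where "r = 2 * lam"
  have r: "0 < r" "r < 1" using lam by (auto simp: r_def)
  define g where "g = (\<lambda>s::nat. real (s + 1) ^ 3 * r ^ Suc s)"
  have "summable g"
  proof (rule summable_comparison_test_bigo)
    show "summable (\<lambda>s. norm (((1 + r) / 2) ^ s))"
      using r by (simp add: norm_power summable_geometric)
    have "r < (1 + r) / 2" using r by simp
    then show "g \<in> O(\<lambda>s. ((1 + r) / 2) ^ s)"
      unfolding g_def using r by real_asymp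
  qed
  have bound: "config_prob 2 n (jobs lam n)
    (\<lambda>f. \<exists>s l i j ws es. bicyclic_witness (set \<circ> f) {..<n} {..<jobs lam n} s l i j ws es) \<le> suminf g / n"
    if n: "0 < n" for n
  proof -
    define m where "m = jobs lam n"
    have m: "m \<le> lam * n" using jobs_bounds[OF lam(1)] by (simp add: m_def)
    have "(\<Sum>s\<in>{1..m}. real (s + 1) ^ 3 * (2 * real m / n) ^ Suc s) \<le> (\<Sum>s\<in>{1..m}. g s)"
      unfolding g_def
    proof (intro sum_mono mult_left_mono power_mono)
      show "2 * real m / n \<le> r" using m n by (simp add: r_def pos_divide_le_eq)
    qed auto
    also have "\<dots> \<le> suminf g"
      using \<open>summable g\<close> r by (intro sum_le_suminf) (auto simp: g_def)
    finally have "(\<Sum>s\<in>{1..m}. real (s + 1) ^ 3 * (2 * real m / n) ^ Suc s) / n \<le> suminf g / n"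
      by (intro divide_right_mono) auto
    then show ?thesis
      using config_prob_bicyclic_le[OF n, of m] unfolding m_def by linarith
  qed
  have lim: "(\<lambda>n. suminf g / real n) \<longlonglongrightarrow> 0" by (rule lim_const_over_n)
  show ?thesis
  proof (rule tendsto_sandwich[OF _ _ tendsto_const lim])
    show "\<forall>\<^sub>F n in sequentially. config_prob 2 n (jobs lam n)
      (\<lambda>f. \<exists>s l i j ws es. bicyclic_witness (set \<circ> f) {..<n} {..<jobs lam n} s l i j ws es) \<le> suminf g / n"
      using eventually_gt_at_top[of 0] by eventually_elim (rule bound)
  qed (simp add: config_prob_nonneg)
qed

lemma makespan_le_1_whp:
  fixes lam :: real
  assumes lam: "0 < lam" "lam < 1 / 2"
  shows "whp (jobs_hypergraph 2 lam) (\<lambda>G. makespan G \<le> 1)"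
proof (rule whp_jobs_hypergraphI[OF lam(1) bicyclic_unlikely[OF lam]])
  fix n f
  let ?m = "jobs lam n"
  assume f: "\<And>e. e < ?m \<Longrightarrow> f e \<in> simple_words {..<n} 2"
    and not: "\<not> makespan (config_hypergraph n ?m f) \<le> 1"
  let ?H = "config_hypergraph n ?m f"
  have H: "verts ?H = {..<n}" "hedges ?H = {..<?m}" "ends ?H = set \<circ> f" by (auto simp: config_hypergraph_def)
  have en: "card ((set \<circ> f) e) = 2 \<and> (set \<circ> f) e \<subseteq> {..<n}" if "e \<in> {..<?m}" for e
    using f[of e] that by (auto simp: simple_words_def words_def distinct_card)
  have "\<nexists>\<phi>. inj_on \<phi> {..<?m} \<and> (\<forall>e\<in>{..<?m}. \<phi> e \<in> (set \<circ> f) e)"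
  proof
    assume "\<exists>\<phi>. inj_on \<phi> {..<?m} \<and> (\<forall>e\<in>{..<?m}. \<phi> e \<in> (set \<circ> f) e)"
    then obtain \<phi> where \<phi>: "inj_on \<phi> {..<?m}" "\<And>e. e \<in> {..<?m} \<Longrightarrow> \<phi> e \<in> (set \<circ> f) e" by blast
    \<comment> \<open>Distinct representatives give every server at most one job.\<close>
    have "makespan ?H \<le> of_nat 1"
    proof (rule makespan_le_of_assignment)
      show "\<phi> e \<in> verts ?H \<inter> ends ?H e" if "e \<in> hedges ?H" for e
        using that \<phi>(2)[of e] en[of e] unfolding H by blast
      show "card {e \<in> hedges ?H. \<phi> e = v} \<le> 1" for v
        unfolding H One_nat_def using \<phi>(1) by (subst card_le_Suc0_iff_eq) (auto dest: inj_onD)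
    qed (auto simp: H)
    then show False using not by simp
  qed
  then have "\<exists>s l i j ws es. bicyclic_witness (set \<circ> f) {..<n} {..<?m} s l i j ws es"
    by (intro orientation_or_bicyclic en finite_lessThan)
  then obtain s l i j ws es where w: "bicyclic_witness (set \<circ> f) {..<n} {..<?m} s l i j ws es" by blast
  have "bicyclic_witness (set \<circ> restrict f {..<?m}) {..<n} {..<?m} s l i j ws es"
  proof -
    have "es ! r \<in> {..<?m}" if "r \<le> s" for r
      using w that by (auto simp: bicyclic_witness_def subset_iff)
    then show ?thesis using w by (auto simp: bicyclic_witness_def)
  qed
  then show "\<exists>s l i j ws es. bicyclic_witness (set \<circ> restrict f {..<?m}) {..<n} {..<?m} s l i j ws es"
    by blast
qed

theorem corollary2:
  fixes d :: nat and lam :: real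
  assumes "d \<ge> 2" and "lam > 0"
  shows "(d = 2 \<and> lam < 1 / 2 \<longrightarrow> whp (jobs_hypergraph d lam) (\<lambda>G. makespan G \<le> 1)) \<and>
    (\<not> (d = 2 \<and> lam < 1 / 2) \<longrightarrow>
      (\<forall>k\<ge>2. gamma k d < lam * fact d \<and> lam * fact d < gamma (k + 1) d \<longrightarrow>
        whp (jobs_hypergraph d lam) (\<lambda>G. verts (core k G) \<noteq> {} \<and> verts (core (k + 1) G) = {} \<and>
          ennreal (real k / real d) \<le> makespan G \<and> makespan G \<le> of_nat k)))"
  using makespan_le_1_whp[of lam] makespan_bounds_whp[of d lam] assms by blast

end
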